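(* Let $G$ be of type $B_n$, let $\mathbf{i}_0=(1\,2\cdots n)^n$, let $c=(c^{(m)}_i)_{1\le i,m\le n}\in(\mathbb{C}^\times)^{n^2}$, and let $k\in\{1,2,\dots,n-1\}$. Then $$\Delta_{w_0s_k\Lambda_k,\Lambda_k}(\Theta^-_{\mathbf{i}_0}(c))=\frac{1}{c^{(k)}_1}+\sum_{j=1}^{k-1}\frac{c^{(j)}_{k-j}}{c^{(j)}_{k-j+1}}.$$
   Context: $G$ is the simply connected simple algebraic group over $\mathbb{C}$ of type $B_n$ ($n\ge2$), $I=\{1,\dots,n\}$, with Chevalley generators $e_i,f_i,h_i$ of its Lie algebra, simple roots $\alpha_i$, fundamental weights $\Lambda_i$ ($\Lambda_i(h_j)=\delta_{ij}$), and Cartan matrix $a_{ij}=\alpha_j(h_i)$ given by $a_{ii}=2$, $a_{n,n-1}=-2$, $a_{ij}=-1$ for other $|i-j|=1$, and $0$ otherwise ($\alpha_n$ is the short root). $T$ is the maximal torus, $U^{\pm}$ the unipotent subgroups generated by $x_i(t)=\exp(te_i)$, resp. $y_i(t)=\exp(tf_i)$; $\alpha_i^\vee:\mathbb{C}^\times\to T$ is the coroot one-parameter subgroup. $W$ is the Weyl group, $s_i$ the simple reflections, $w_0$ the longest element. Set $\overline{s}_i=x_i(-1)y_i(1)x_i(-1)$ and $\overline{w}=\overline{s}_{i_1}\cdots\overline{s}_{i_l}$ for any reduced expression $w=s_{i_1}\cdots s_{i_l}$. Generalized minors: $\Delta_{\Lambda_i}$ is the regular function on $G$ with $\Delta_{\Lambda_i}(u^-tu^+)=\Lambda_i(t)$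 for $u^\pm\in U^\pm$, $t\in T$; for $u,v\in W$, $\Delta_{u\Lambda_i,v\Lambda_i}(g)=\Delta_{\Lambda_i}(\overline{u}^{-1}g\,\overline{v})$ (so $\Delta_{w_0s_k\Lambda_k,\Lambda_k}(g)=\Delta_{\Lambda_k}(\overline{w_0s_k}^{\,-1}g)$). Set $\mathbf{y}_i(c)=y_i(c)\alpha_i^\vee(c^{-1})$. The word $\mathbf{i}_0=(12\cdots n)^n$ is a reduced word of $w_0$ and $$\Theta^-_{\mathbf{i}_0}(c)=\prod_{m=1}^{n}\mathbf{y}_1(c^{(m)}_1)\mathbf{y}_2(c^{(m)}_2)\cdots\mathbf{y}_n(c^{(m)}_n),$$ the factors for $m=1,2,\dots,n$ being multiplied from left to right. *)

theory Defs
  imports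
    "Jordan_Normal_Form.Determinant"
    "HOL-Algebra.Generated_Groups"
    "HOL-Analysis.Complex_Transcendental"
begin

section \<open>Linear algebraic groups over the complex numbers\<close>

text \<open>Linear algebraic groups are given by their groups of complex points, as Zariski closed
  subgroups of some \<open>GL\<^sub>N\<close>; every affine algebraic group has such an embedding. Regular functions on
  a subset of \<open>GL\<^sub>N\<close> are restrictions of polynomials in the matrix entries and \<open>1/det\<close>.\<close>

definition GL :: "nat \<Rightarrow> complex mat monoid" where
  "GL N = units_of (ring_mat TYPE(complex) N ())"

inductive_set GL_regular :: "nat \<Rightarrow> (complex mat \<Rightarrow> complex) set" for N :: nat where
  const: "(\<lambda>g. a) \<in> GL_regular N"
| entry: "i < N \<Longrightarrow> j < N \<Longrightarrow> (\<lambda>g. g $$ (i, j)) \<in> GL_regular N"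
| inv_det: "(\<lambda>g. inverse (Determinant.det g)) \<in> GL_regular N"
| add: "p \<in> GL_regular N \<Longrightarrow> q \<in> GL_regular N \<Longrightarrow> (\<lambda>g. p g + q g) \<in> GL_regular N"
| mult: "p \<in> GL_regular N \<Longrightarrow> q \<in> GL_regular N \<Longrightarrow> (\<lambda>g. p g * q g) \<in> GL_regular N"

definition regular_fun_on :: "nat \<Rightarrow> complex mat set \<Rightarrow> (complex mat \<Rightarrow> complex) \<Rightarrow> bool" where
  "regular_fun_on N S F \<longleftrightarrow> (\<exists>p \<in> GL_regular N. \<forall>g \<in> S. F g = p g)"

definition zariski_closed :: "nat \<Rightarrow> complex mat set \<Rightarrow> bool" where
  "zariski_closed N S \<longleftrightarrow>
     (\<exists>P \<subseteq> GL_regular N. S = {g \<in> carrier (GL N). \<forall>p \<in> P. p g = 0})"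

definition zariski_connected :: "nat \<Rightarrow> complex mat set \<Rightarrow> bool" where
  "zariski_connected N S \<longleftrightarrow>
     \<not> (\<exists>A B. zariski_closed N A \<and> zariski_closed N B \<and> A \<noteq> {} \<and> B \<noteq> {} \<and> A \<inter> B = {} \<and> A \<union> B = S)"

definition linear_algebraic_group :: "nat \<Rightarrow> complex mat set \<Rightarrow> bool" where
  "linear_algebraic_group N G \<longleftrightarrow> subgroup G (GL N) \<and> zariski_closed N G"

text \<open>As usual for algebraic groups, a simple group may have a finite centre.\<close>

definition simple_algebraic_group :: "nat \<Rightarrow> complex mat set \<Rightarrow> bool" where
  "simple_algebraic_group N G \<longleftrightarrow>
     linear_algebraic_group N G \<and> zariski_connected N G \<and>
     (\<exists>a \<in> G. \<exists>b \<in> G. a * b \<noteq> b * a) \<and>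
     (\<forall>H. normal H (GL N \<lparr>carrier := G\<rparr>) \<and> zariski_closed N H \<and> zariski_connected N H
        \<longrightarrow> H = {1\<^sub>m N} \<or> H = G)"

definition mat_exp :: "complex mat \<Rightarrow> complex mat" where
  "mat_exp A = Matrix.mat (dim_row A) (dim_row A) (\<lambda>(i, j). \<Sum>m. (A ^\<^sub>m m) $$ (i, j) / fact m)"

definition lie_algebra :: "nat \<Rightarrow> complex mat set \<Rightarrow> complex mat set" where
  "lie_algebra N G = {X \<in> carrier_mat N N. \<forall>t. mat_exp (t \<cdot>\<^sub>m X) \<in> G}"

definition lie_bracket :: "complex mat \<Rightarrow> complex mat \<Rightarrow> complex mat" where
  "lie_bracket X Y = X * Y - Y * X"

inductive_set lie_generated :: "nat \<Rightarrow> complex mat set \<Rightarrow> complex mat set"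
  for N :: nat and S :: "complex mat set" where
  zero: "0\<^sub>m N N \<in> lie_generated N S"
| incl: "X \<in> S \<Longrightarrow> X \<in> lie_generated N S"
| add: "X \<in> lie_generated N S \<Longrightarrow> Y \<in> lie_generated N S \<Longrightarrow> X + Y \<in> lie_generated N S"
| smult: "X \<in> lie_generated N S \<Longrightarrow> a \<cdot>\<^sub>m X \<in> lie_generated N S"
| bracket: "X \<in> lie_generated N S \<Longrightarrow> Y \<in> lie_generated N S \<Longrightarrow>
            lie_bracket X Y \<in> lie_generated N S"

section \<open>Type B\<close>

definition cartan_B :: "nat \<Rightarrow> nat \<Rightarrow> nat \<Rightarrow> int" where
  "cartan_B n i j =
     (if i \<notin> {1..n} \<or> j \<notin> {1..n} then 0
      else if i = j then 2
      else if i = n \<and> j = n - 1 then -2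
      else if i = j + 1 \<or> j = i + 1 then -1
      else 0)"

text \<open>The Chevalley--Serre relations say that \<open>Lie(G)\<close> is a quotient of the simple Lie algebra of
  type \<open>B\<^sub>n\<close>, hence isomorphic to it as soon as it is nonzero, e.g. for simple \<open>G\<close>. The
  convention is \<open>a\<^sub>i\<^sub>j = \<alpha>\<^sub>j(h\<^sub>i)\<close>.\<close>

definition chevalley_generators_B ::
  "nat \<Rightarrow> nat \<Rightarrow> complex mat set \<Rightarrow>
   (nat \<Rightarrow> complex mat) \<Rightarrow> (nat \<Rightarrow> complex mat) \<Rightarrow> (nat \<Rightarrow> complex mat) \<Rightarrow> bool" where
  "chevalley_generators_B n N G e f h \<longleftrightarrow>
     lie_algebra N G = lie_generated N (e ` {1..n} \<union> f ` {1..n} \<union> h ` {1..n}) \<and>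
     (\<forall>i \<in> {1..n}. \<forall>j \<in> {1..n}.
        lie_bracket (h i) (h j) = 0\<^sub>m N N \<and>
        lie_bracket (e i) (f j) = (if i = j then h i else 0\<^sub>m N N) \<and>
        lie_bracket (h i) (e j) = of_int (cartan_B n i j) \<cdot>\<^sub>m e j \<and>
        lie_bracket (h i) (f j) = of_int (- cartan_B n i j) \<cdot>\<^sub>m f j \<and>
        (i \<noteq> j \<longrightarrow>
          (lie_bracket (e i) ^^ nat (1 - cartan_B n i j)) (e j) = 0\<^sub>m N N \<and>
          (lie_bracket (f i) ^^ nat (1 - cartan_B n i j)) (f j) = 0\<^sub>m N N))"

definition root_elt :: "(nat \<Rightarrow> complex mat) \<Rightarrow> nat \<Rightarrow> complex \<Rightarrow> complex mat" where
  "root_elt e i t = mat_exp (t \<cdot>\<^sub>m e i)"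

text \<open>\<open>root_elt e i\<close> is \<open>x\<^sub>i\<close> and \<open>root_elt f i\<close> is \<open>y\<^sub>i\<close>. The unipotent subgroups \<open>U\<^sup>+\<close> and
  \<open>U\<^sup>-\<close> are obtained from \<open>e\<close> and \<open>f\<close>, respectively.\<close>

definition unipotent_subgroup :: "nat \<Rightarrow> nat \<Rightarrow> (nat \<Rightarrow> complex mat) \<Rightarrow> complex mat set" where
  "unipotent_subgroup n N e = generate (GL N) {root_elt e i t | i t. i \<in> {1..n}}"

text \<open>The coroot \<open>\<alpha>\<^sub>i\<^sup>\<or>\<close> is the homomorphism from the multiplicative group with differential \<open>h\<^sub>i\<close>,
  i.e. it maps \<open>exp z\<close> to \<open>exp (z h\<^sub>i)\<close>. The choice of logarithm is immaterial, since the eigenvalues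
  of the diagonalizable matrix \<open>h\<^sub>i\<close> are integers.\<close>

definition coroot :: "(nat \<Rightarrow> complex mat) \<Rightarrow> nat \<Rightarrow> complex \<Rightarrow> complex mat" where
  "coroot h i t = mat_exp (Ln t \<cdot>\<^sub>m h i)"

definition max_torus :: "nat \<Rightarrow> nat \<Rightarrow> (nat \<Rightarrow> complex mat) \<Rightarrow> complex mat set" where
  "max_torus n N h = generate (GL N) {coroot h i t | i t. i \<in> {1..n} \<and> t \<noteq> 0}"

definition torus_character ::
  "nat \<Rightarrow> nat \<Rightarrow> (nat \<Rightarrow> complex mat) \<Rightarrow> (complex mat \<Rightarrow> complex) \<Rightarrow> bool" where
  "torus_character n N h \<psi> \<longleftrightarrow>
     regular_fun_on N (max_torus n N h) \<psi> \<and>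
     (\<forall>s \<in> max_torus n N h. \<psi> s \<noteq> 0) \<and>
     (\<forall>s \<in> max_torus n N h. \<forall>t \<in> max_torus n N h. \<psi> (s * t) = \<psi> s * \<psi> t)"

text \<open>\<open>\<Lambda>\<^sub>i(h\<^sub>j) = \<delta>\<^sub>i\<^sub>j\<close>, written for the character of the torus with differential \<open>\<Lambda>\<^sub>i\<close>.\<close>

definition fundamental_weight ::
  "nat \<Rightarrow> nat \<Rightarrow> (nat \<Rightarrow> complex mat) \<Rightarrow> nat \<Rightarrow> (complex mat \<Rightarrow> complex) \<Rightarrow> bool" where
  "fundamental_weight n N h i \<psi> \<longleftrightarrow>
     torus_character n N h \<psi> \<and>
     (\<forall>j \<in> {1..n}. \<forall>t. t \<noteq> 0 \<longrightarrow> \<psi> (coroot h j t) = (if j = i then t else 1))"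

text \<open>A semisimple group is simply connected if the character group of its maximal torus is the
  full weight lattice, i.e. if all fundamental weights are characters.\<close>

definition simply_connected_B :: "nat \<Rightarrow> nat \<Rightarrow> (nat \<Rightarrow> complex mat) \<Rightarrow> bool" where
  "simply_connected_B n N h \<longleftrightarrow> (\<forall>i \<in> {1..n}. \<exists>\<psi>. fundamental_weight n N h i \<psi>)"

section \<open>The Weyl group\<close>

text \<open>The Weyl group acts on weights \<open>\<mu>\<close>, represented by their coordinates \<open>j \<mapsto> \<mu>(h\<^sub>j)\<close> with
  respect to the fundamental weights; \<open>s\<^sub>i \<mu> = \<mu> - \<mu>(h\<^sub>i) \<alpha>\<^sub>i\<close>, and \<open>\<alpha>\<^sub>i(h\<^sub>j) = a\<^sub>j\<^sub>i\<close>.\<close>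

type_synonym weight = "nat \<Rightarrow> int"

definition simple_reflection :: "nat \<Rightarrow> nat \<Rightarrow> weight \<Rightarrow> weight" where
  "simple_reflection n i \<mu> = (\<lambda>j. \<mu> j - \<mu> i * cartan_B n j i)"

definition word_elt :: "nat \<Rightarrow> nat list \<Rightarrow> weight \<Rightarrow> weight" where
  "word_elt n is = foldr (\<lambda>i w. simple_reflection n i \<circ> w) is id"

definition weyl_group :: "nat \<Rightarrow> (weight \<Rightarrow> weight) set" where
  "weyl_group n = word_elt n ` lists {1..n}"

definition weyl_length :: "nat \<Rightarrow> (weight \<Rightarrow> weight) \<Rightarrow> nat" where
  "weyl_length n w = (LEAST l. \<exists>is \<in> lists {1..n}. word_elt n is = w \<and> length is = l)"

definition reduced_word :: "nat \<Rightarrow> (weight \<Rightarrow> weight) \<Rightarrow> nat list \<Rightarrow> bool" where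
  "reduced_word n w is \<longleftrightarrow>
     is \<in> lists {1..n} \<and> word_elt n is = w \<and> length is = weyl_length n w"

definition longest_elt :: "nat \<Rightarrow> weight \<Rightarrow> weight" where
  "longest_elt n =
     (THE w. w \<in> weyl_group n \<and> (\<forall>v \<in> weyl_group n. weyl_length n v \<le> weyl_length n w))"

section \<open>Generalized minors\<close>

definition mat_prod :: "nat \<Rightarrow> complex mat list \<Rightarrow> complex mat" where
  "mat_prod N gs = foldr (*) gs (1\<^sub>m N)"

definition s_bar :: "(nat \<Rightarrow> complex mat) \<Rightarrow> (nat \<Rightarrow> complex mat) \<Rightarrow> nat \<Rightarrow> complex mat" where
  "s_bar e f i = root_elt e i (-1) * root_elt f i 1 * root_elt e i (-1)"

text \<open>The lift does not depend on the reduced word, because the \<open>s_bar e f i\<close> satisfy the braid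
  relations.\<close>

definition w_bar ::
  "nat \<Rightarrow> nat \<Rightarrow> (nat \<Rightarrow> complex mat) \<Rightarrow> (nat \<Rightarrow> complex mat) \<Rightarrow> (weight \<Rightarrow> weight) \<Rightarrow> complex mat"
  where
  "w_bar n N e f w = mat_prod N (map (s_bar e f) (SOME is. reduced_word n w is))"

text \<open>\<open>principal_minor n N G e f h \<Lambda>\<^sub>i D\<close> characterizes \<open>D = \<Delta>\<close> for the weight \<open>\<Lambda>\<^sub>i\<close>; it determines
  \<open>D\<close> on \<open>G\<close>, because \<open>U\<^sup>- T U\<^sup>+\<close> is dense.\<close>

definition principal_minor ::
  "nat \<Rightarrow> nat \<Rightarrow> complex mat set \<Rightarrow>
   (nat \<Rightarrow> complex mat) \<Rightarrow> (nat \<Rightarrow> complex mat) \<Rightarrow> (nat \<Rightarrow> complex mat) \<Rightarrow>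
   (complex mat \<Rightarrow> complex) \<Rightarrow> (complex mat \<Rightarrow> complex) \<Rightarrow> bool" where
  "principal_minor n N G e f h \<psi> D \<longleftrightarrow>
     regular_fun_on N G D \<and>
     (\<forall>u \<in> unipotent_subgroup n N f. \<forall>t \<in> max_torus n N h. \<forall>v \<in> unipotent_subgroup n N e.
        D (u * t * v) = \<psi> t)"

text \<open>For a family \<open>\<Delta>\<close> of principal minors, \<open>gen_minor n N e f \<Delta> u v i\<close> is the generalized minor
  for the pair of weights \<open>u \<Lambda>\<^sub>i\<close> and \<open>v \<Lambda>\<^sub>i\<close>.\<close>

definition gen_minor ::
  "nat \<Rightarrow> nat \<Rightarrow> (nat \<Rightarrow> complex mat) \<Rightarrow> (nat \<Rightarrow> complex mat) \<Rightarrow> (nat \<Rightarrow> complex mat \<Rightarrow> complex) \<Rightarrow>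
   (weight \<Rightarrow> weight) \<Rightarrow> (weight \<Rightarrow> weight) \<Rightarrow> nat \<Rightarrow> complex mat \<Rightarrow> complex" where
  "gen_minor n N e f \<Delta> u v i g = \<Delta> i (inv\<^bsub>GL N\<^esub> (w_bar n N e f u) * g * w_bar n N e f v)"

definition y_bold ::
  "(nat \<Rightarrow> complex mat) \<Rightarrow> (nat \<Rightarrow> complex mat) \<Rightarrow> nat \<Rightarrow> complex \<Rightarrow> complex mat" where
  "y_bold f h i c = root_elt f i c * coroot h i (inverse c)"

text \<open>\<open>c m i\<close> stands for \<open>c\<^sub>i\<^sup>(\<^sup>m\<^sup>)\<close>.\<close>

definition Theta_minus ::
  "nat \<Rightarrow> nat \<Rightarrow> (nat \<Rightarrow> complex mat) \<Rightarrow> (nat \<Rightarrow> complex mat) \<Rightarrow> (nat \<Rightarrow> nat \<Rightarrow> complex) \<Rightarrow> complex mat"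
  where
  "Theta_minus n N f h c = mat_prod N [y_bold f h i (c m i). m \<leftarrow> [1..<n + 1], i \<leftarrow> [1..<n + 1]]"

end

theory Submission
  imports Defs "HOL-Complex_Analysis.Conformal_Mappings"
begin

text \<open>A product of elements \<open>x\<^sub>i(s)\<close>, \<open>y\<^sub>i(t)\<close> and \<open>\<alpha>\<^sub>i\<^sup>\<or>(c)\<close> in which the parameters \<open>s\<close> are small has a
  Gauss decomposition obtained from the rank one identities \<open>x\<^sub>i(s) y\<^sub>i(t) = y\<^sub>i(t/q) \<alpha>\<^sub>i\<^sup>\<or>(q) x\<^sub>i(s/q)\<close>,
  \<open>q = 1 + s t\<close>, and these hold in \<open>G\<close> as well as in the vector representation of dimension \<open>2 n + 1\<close>. By
  the identity theorem for holomorphic functions, \<open>\<Delta>\<^sub>k\<close> therefore takes the same value on such a product as the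
  leading \<open>k \<times> k\<close> minor of the corresponding matrix; here \<open>k < n\<close> is used.

  The lift of \<open>w\<^sub>0 s\<^sub>k\<close> acts on the vector representation by a signed permutation, which turns the leading
  minor into the minor with rows \<open>2 n + 1 - k, 2 n + 3 - k, \<dots>, 2 n + 1\<close>. Let \<open>R(s, q)\<close> be row \<open>2 n + 2 - q\<close> of
  the product of the blocks \<open>s, \<dots>, n\<close>. Then
  \<open>R(s, q + 1) = c\<^sup>(\<^sup>s\<^sup>)\<^sub>q\<^sub>-\<^sub>1 / c\<^sup>(\<^sup>s\<^sup>)\<^sub>q R(s, q) - R(s + 1, q)\<close>, where \<open>c\<^sup>(\<^sup>s\<^sup>)\<^sub>0 = 1\<close>, which expresses all rows of the minor
  through the rows \<open>R(s, 1)\<close>. The latter form a unitriangular matrix, and the coefficient of \<open>R(k, 1)\<close> in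
  \<open>R(1, k + 1)\<close> satisfies, up to sign, a recursion whose solution is the asserted sum.\<close>


section \<open>The matrix exponential\<close>

text \<open>No homomorphism from G to an orthogonal group is constructed. A word in the generators
  is evaluated twice, in G and on vectors, and only relations checked on both sides are applied to
  it. The obstacle is the relation for x_i(s) y_i(t): it breaks down at q = 0, where a word may
  leave the big cell, and in G it is proved for q in the right half plane, because the coroot is
  defined through \<open>Ln\<close>. Hence the restriction to small parameters, followed by analytic
  continuation in one parameter at a time. The condition k < n enters because the k-th exterior
  power of the vector representation then has highest weight \<Lambda>_k, whereas for k = n it is 2
  \<Lambda>_n. The asserted sum has k terms because the reflection s_k moves the top row of the
  minor up by one. The coefficients of that row are met one step off their extreme term, so exactly
  one step of the recursion contributes a quotient of the c's, and it may be any of k steps. Both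
  triangular determinants carry the sign of the order reversal, and these signs cancel.\<close>

definition has_mat_derivative ::
    "nat \<Rightarrow> (complex \<Rightarrow> complex mat) \<Rightarrow> complex mat \<Rightarrow> complex \<Rightarrow> bool" where
  "has_mat_derivative N R D z \<longleftrightarrow> (\<forall>z. R z \<in> carrier_mat N N) \<and> D \<in> carrier_mat N N \<and>
     (\<forall>i<N. \<forall>j<N. ((\<lambda>z. R z $$ (i, j)) has_field_derivative D $$ (i, j)) (at z))"

lemma index_mat_mult_sum:
  assumes "A \<in> carrier_mat N N" "B \<in> carrier_mat N N" "i < N" "j < N"
  shows "(A * B) $$ (i, j) = (\<Sum>l<N. A $$ (i, l) * B $$ (l, j))"
  using assms by (auto simp: scalar_prod_def lessThan_atLeast0 intro!: sum.cong)

lemma has_mat_derivative_mult: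
  assumes "has_mat_derivative N R D z" "has_mat_derivative N S E z"
  shows "has_mat_derivative N (\<lambda>z. R z * S z) (D * S z + R z * E) z"
  unfolding has_mat_derivative_def
proof (intro conjI allI impI)
  have c: "R z \<in> carrier_mat N N" "S z \<in> carrier_mat N N" "D \<in> carrier_mat N N"
    "E \<in> carrier_mat N N" for z
    using assms by (auto simp: has_mat_derivative_def)
  then show "R z * S z \<in> carrier_mat N N" for z
    by (metis mult_carrier_mat)
  show "D * S z + R z * E \<in> carrier_mat N N"
    using c by (metis add_carrier_mat mult_carrier_mat)
  fix i j assume ij: "i < N" "j < N"
  have eq: "(\<lambda>z. (R z * S z) $$ (i, j)) = (\<lambda>z. \<Sum>l<N. R z $$ (i, l) * S z $$ (l, j))"
    using c ij by (auto simp: index_mat_mult_sum simp del: index_mult_mat)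
  have "((\<lambda>z. \<Sum>l<N. R z $$ (i, l) * S z $$ (l, j)) has_field_derivative
      (\<Sum>l<N. D $$ (i, l) * S z $$ (l, j) + R z $$ (i, l) * E $$ (l, j))) (at z)"
    using assms ij unfolding has_mat_derivative_def
    by (auto intro!: DERIV_sum derivative_eq_intros)
  also have "(\<Sum>l<N. D $$ (i, l) * S z $$ (l, j) + R z $$ (i, l) * E $$ (l, j))
      = (D * S z + R z * E) $$ (i, j)"
  proof -
    have "(D * S z + R z * E) $$ (i, j) = (D * S z) $$ (i, j) + (R z * E) $$ (i, j)"
      using c(1)[of z] c(2)[of z] c(3,4) ij by (auto simp del: index_mult_mat(1))
    then show ?thesis
      using c(1)[of z] c(2)[of z] c(3,4) ij by (auto simp: index_mat_mult_sum sum.distrib simp del: index_mult_mat(1))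
  qed
  finally show "((\<lambda>z. (R z * S z) $$ (i, j)) has_field_derivative
      (D * S z + R z * E) $$ (i, j)) (at z)"
    unfolding eq .
qed

lemma has_mat_derivative_const:
  "A \<in> carrier_mat N N \<Longrightarrow> has_mat_derivative N (\<lambda>z. A) (0\<^sub>m N N) z"
  by (auto simp: has_mat_derivative_def)

lemma has_mat_derivative_add:
  assumes "has_mat_derivative N R D z" "has_mat_derivative N S E z"
  shows "has_mat_derivative N (\<lambda>z. R z + S z) (D + E) z"
proof -
  have c: "dim_row (R z) = N" "dim_col (R z) = N" "dim_row (S z) = N" "dim_col (S z) = N" for z
    using assms unfolding has_mat_derivative_def by blast+
  show ?thesis
    using assms c by (auto simp: has_mat_derivative_def intro!: derivative_eq_intros)
qed

lemma has_mat_derivative_smult: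
  assumes "(g has_field_derivative g') (at z)" "has_mat_derivative N R D z"
  shows "has_mat_derivative N (\<lambda>z. g z \<cdot>\<^sub>m R z) (g' \<cdot>\<^sub>m R z + g z \<cdot>\<^sub>m D) z"
proof -
  have c: "dim_row (R z) = N" "dim_col (R z) = N" for z
    using assms unfolding has_mat_derivative_def by blast+
  show ?thesis
    using assms c by (auto simp: has_mat_derivative_def intro!: derivative_eq_intros)
qed

lemma has_mat_derivative_eq:
  "has_mat_derivative N R D z \<Longrightarrow> D = E \<Longrightarrow> has_mat_derivative N R E z"
  by simp

lemma pow_mat_smult:
  fixes A :: "complex mat"
  assumes "A \<in> carrier_mat N N"
  shows "(t \<cdot>\<^sub>m A) ^\<^sub>m m = t ^ m \<cdot>\<^sub>m (A ^\<^sub>m m)"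
proof (induction m)
  case 0
  then show ?case using assms by auto
next
  case (Suc m)
  have "A ^\<^sub>m m \<in> carrier_mat N N"
    using assms by simp
  then show ?case
    using assms Suc by (intro eq_matI)
      (simp_all add: mult_smult_assoc_mat[of _ N N] mult_smult_distrib[of _ N N])
qed

lemma pow_mat_entry_bound:
  fixes A :: "complex mat"
  assumes A: "A \<in> carrier_mat N N"
  obtains K where "K \<ge> 0" "\<And>m i j. i < N \<Longrightarrow> j < N \<Longrightarrow> norm ((A ^\<^sub>m m) $$ (i, j)) \<le> K ^ m"
proof
  \<comment> \<open>Every entry is at most \<open>a\<close>, and an entry of a product is a sum of N
    products; hence the base \<open>N * a\<close>.\<close>
  define a where "a = (\<Sum>i<N. \<Sum>j<N. norm (A $$ (i, j)))"
  have a: "norm (A $$ (i, j)) \<le> a" if "i < N" "j < N" for i j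
  proof -
    have "norm (A $$ (i, j)) \<le> (\<Sum>j<N. norm (A $$ (i, j)))"
      using that by (intro member_le_sum) auto
    also have "\<dots> \<le> a"
      unfolding a_def using that by (intro member_le_sum) (auto intro: sum_nonneg)
    finally show ?thesis .
  qed
  have a0: "a \<ge> 0" unfolding a_def by (auto intro!: sum_nonneg)
  then show "real N * a \<ge> 0" by simp
  show "norm ((A ^\<^sub>m m) $$ (i, j)) \<le> (real N * a) ^ m" if "i < N" "j < N" for m i j
    using that
  proof (induction m arbitrary: i j)
    case 0
    then show ?case using A by auto
  next
    case (Suc m)
    have "norm ((A ^\<^sub>m Suc m) $$ (i, j)) = norm (\<Sum>l<N. (A ^\<^sub>m m) $$ (i, l) * A $$ (l, j))"
      using A Suc.prems by (simp add: index_mat_mult_sum[of _ N] del: index_mult_mat(1))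
    also have "\<dots> \<le> (\<Sum>l<N. (real N * a) ^ m * a)"
      using Suc by (intro norm_sum[THEN order_trans] sum_mono)
        (auto simp: norm_mult intro!: mult_mono a a0 zero_le_power mult_nonneg_nonneg)
    also have "\<dots> = (real N * a) ^ Suc m" by simp
    finally show ?case .
  qed
qed

lemma mat_exp_carrier [simp]:
  "A \<in> carrier_mat N N \<Longrightarrow> mat_exp A \<in> carrier_mat N N"
  unfolding mat_exp_def by auto

lemma mat_exp_dim [simp]: "dim_row (mat_exp A) = dim_row A" "dim_col (mat_exp A) = dim_row A"
  unfolding mat_exp_def by auto

lemma summable_mat_exp:
  fixes A :: "complex mat"
  assumes A: "A \<in> carrier_mat N N" and "i < N" "j < N"
  shows "summable (\<lambda>m. (A ^\<^sub>m m) $$ (i, j) / fact m * t ^ m)"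
proof -
  obtain K where K: "K \<ge> 0" "\<And>m. norm ((A ^\<^sub>m m) $$ (i, j)) \<le> K ^ m"
    using pow_mat_entry_bound[OF A] assms by metis
  have "summable (\<lambda>m. inverse (fact m) * (K * norm t) ^ m)"
    by (rule summable_exp)
  then show ?thesis
  proof (rule summable_comparison_test'[where N = 0])
    fix m :: nat
    show "norm ((A ^\<^sub>m m) $$ (i, j) / fact m * t ^ m) \<le> inverse (fact m) * (K * norm t) ^ m"
      using mult_right_mono[OF K(2)[of m], of "norm t ^ m / fact m"]
      by (simp add: norm_mult norm_divide norm_power power_mult_distrib field_simps)
  qed
qed

lemma mat_exp_smult_entry:
  fixes A :: "complex mat"
  assumes A: "A \<in> carrier_mat N N" and "i < N" "j < N"
  shows "mat_exp (t \<cdot>\<^sub>m A) $$ (i, j) = (\<Sum>m. (A ^\<^sub>m m) $$ (i, j) / fact m * t ^ m)"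
proof -
  have "((t \<cdot>\<^sub>m A) ^\<^sub>m m) $$ (i, j) = t ^ m * (A ^\<^sub>m m) $$ (i, j)" for m
    using assms pow_carrier_mat[OF A, of m] by (simp add: pow_mat_smult[OF A])
  then show ?thesis
    using assms unfolding mat_exp_def by (simp add: mult.commute)
qed

lemma pow_mat_Suc_left:
  fixes A :: "complex mat"
  assumes A: "A \<in> carrier_mat N N"
  shows "A ^\<^sub>m Suc m = A * A ^\<^sub>m m"
proof (induction m)
  case 0
  then show ?case using A by simp
next
  case (Suc m)
  have "A ^\<^sub>m Suc (Suc m) = A * A ^\<^sub>m m * A"
    using Suc by simp
  also have "\<dots> = A * (A ^\<^sub>m m * A)"
    using A by (intro assoc_mult_mat[of _ N N _ N _ N]) auto
  finally show ?case by simp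
qed

text \<open>The entries are everywhere convergent power series and may be differentiated termwise.
  \<open>diffs\<close> turns the coefficients into those of A^(m+1)/m!, and splitting off the left
  factor A leaves the original series.\<close>

lemma has_mat_derivative_mat_exp:
  fixes A :: "complex mat"
  assumes A: "A \<in> carrier_mat N N"
  shows "has_mat_derivative N (\<lambda>t. mat_exp (t \<cdot>\<^sub>m A)) (A * mat_exp (z \<cdot>\<^sub>m A)) z"
  unfolding has_mat_derivative_def
proof (intro conjI allI impI)
  show "mat_exp (z \<cdot>\<^sub>m A) \<in> carrier_mat N N" for z using A by auto
  show "A * mat_exp (z \<cdot>\<^sub>m A) \<in> carrier_mat N N" using A by auto
  fix i j assume ij: "i < N" "j < N"
  let ?c = "\<lambda>i m. (A ^\<^sub>m m) $$ (i, j) / fact m"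
  have "((\<lambda>t. \<Sum>m. ?c i m * t ^ m) has_field_derivative (\<Sum>m. diffs (?c i) m * z ^ m)) (at z)"
    using summable_mat_exp[OF A ij] by (rule termdiffs_strong_converges_everywhere)
  also have "(\<Sum>m. diffs (?c i) m * z ^ m) = (\<Sum>m. \<Sum>l<N. A $$ (i, l) * (?c l m * z ^ m))"
  proof (rule suminf_cong)
    fix m
    have "diffs (?c i) m = (A ^\<^sub>m Suc m) $$ (i, j) / fact m"
      by (simp add: diffs_def field_simps del: pow_mat.simps of_nat_Suc)
    also have "\<dots> = (\<Sum>l<N. A $$ (i, l) * ?c l m)"
      unfolding pow_mat_Suc_left[OF A]
      using A ij by (simp add: index_mat_mult_sum[of _ N] sum_divide_distrib del: index_mult_mat(1))
    finally show "diffs (?c i) m * z ^ m = (\<Sum>l<N. A $$ (i, l) * (?c l m * z ^ m))"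
      by (simp add: sum_distrib_right mult.assoc)
  qed
  also have "\<dots> = (\<Sum>l<N. \<Sum>m. A $$ (i, l) * (?c l m * z ^ m))"
    using ij by (intro suminf_sum summable_mult summable_mat_exp[OF A]) auto
  also have "\<dots> = (\<Sum>l<N. A $$ (i, l) * mat_exp (z \<cdot>\<^sub>m A) $$ (l, j))"
    using ij by (intro sum.cong refl)
      (simp add: mat_exp_smult_entry[OF A] suminf_mult[OF summable_mat_exp[OF A]] del: times_divide_eq_left)
  also have "\<dots> = (A * mat_exp (z \<cdot>\<^sub>m A)) $$ (i, j)"
    using A ij by (intro index_mat_mult_sum[symmetric]) auto
  finally show "((\<lambda>t. mat_exp (t \<cdot>\<^sub>m A) $$ (i, j)) has_field_derivative
      (A * mat_exp (z \<cdot>\<^sub>m A)) $$ (i, j)) (at z)"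
    using ij A by (simp add: mat_exp_smult_entry)
qed

lemma mat_exp_zero [simp]:
  fixes A :: "complex mat"
  assumes "A \<in> carrier_mat N N"
  shows "mat_exp (0 \<cdot>\<^sub>m A) = 1\<^sub>m N"
proof (rule eq_matI)
  fix i j assume "i < dim_row (1\<^sub>m N :: complex mat)" "j < dim_col (1\<^sub>m N :: complex mat)"
  then show "mat_exp (0 \<cdot>\<^sub>m A) $$ (i, j) = 1\<^sub>m N $$ (i, j)"
    using assms powser_zero[of "\<lambda>m. (A ^\<^sub>m m) $$ (i, j) / fact m"]
    by (simp add: mat_exp_smult_entry[OF assms])
qed (use assms in auto)

text \<open>A commutes with its powers. In the derivative A stands on the left, but in the
  integrating factor exp(-zA) it must stand on the right, next to the solution.\<close>

lemma mat_exp_commutes: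
  fixes A :: "complex mat"
  assumes A: "A \<in> carrier_mat N N"
  shows "A * mat_exp (t \<cdot>\<^sub>m A) = mat_exp (t \<cdot>\<^sub>m A) * A"
proof (rule eq_matI)
  fix i j assume "i < dim_row (mat_exp (t \<cdot>\<^sub>m A) * A)" "j < dim_col (mat_exp (t \<cdot>\<^sub>m A) * A)"
  then have ij: "i < N" "j < N" using A by auto
  have pow: "(\<Sum>l<N. A $$ (i, l) * (A ^\<^sub>m m) $$ (l, j)) = (\<Sum>l<N. (A ^\<^sub>m m) $$ (i, l) * A $$ (l, j))" for m
    using arg_cong[OF pow_mat_Suc_left[OF A, of m], of "\<lambda>M. M $$ (i, j)"] A ij
    by (simp add: index_mat_mult_sum[of _ N] del: index_mult_mat(1))
  have "(A * mat_exp (t \<cdot>\<^sub>m A)) $$ (i, j)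
      = (\<Sum>l<N. \<Sum>m. A $$ (i, l) * ((A ^\<^sub>m m) $$ (l, j) / fact m * t ^ m))"
    using A ij by (subst index_mat_mult_sum[of _ N])
      (auto simp: mat_exp_smult_entry[OF A] suminf_mult[OF summable_mat_exp[OF A]]
        simp del: times_divide_eq_left intro!: sum.cong)
  also have "\<dots> = (\<Sum>m. \<Sum>l<N. A $$ (i, l) * ((A ^\<^sub>m m) $$ (l, j) / fact m * t ^ m))"
    using ij by (intro suminf_sum[symmetric] summable_mult summable_mat_exp[OF A]) auto
  also have "\<dots> = (\<Sum>m. (\<Sum>l<N. A $$ (i, l) * (A ^\<^sub>m m) $$ (l, j)) * (t ^ m / fact m))"
    by (simp add: sum_distrib_left sum_divide_distrib mult_ac)
  also have "\<dots> = (\<Sum>m. \<Sum>l<N. ((A ^\<^sub>m m) $$ (i, l) / fact m * t ^ m) * A $$ (l, j))"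
    unfolding pow by (simp add: sum_distrib_left sum_divide_distrib mult_ac)
  also have "\<dots> = (\<Sum>l<N. \<Sum>m. ((A ^\<^sub>m m) $$ (i, l) / fact m * t ^ m) * A $$ (l, j))"
    using ij by (intro suminf_sum summable_mult2 summable_mat_exp[OF A]) auto
  also have "\<dots> = (mat_exp (t \<cdot>\<^sub>m A) * A) $$ (i, j)"
    using A ij by (subst index_mat_mult_sum[of _ N])
      (auto simp: mat_exp_smult_entry[OF A] suminf_mult2[OF summable_mat_exp[OF A]]
        simp del: times_divide_eq_left intro!: sum.cong)
  finally show "(A * mat_exp (t \<cdot>\<^sub>m A)) $$ (i, j) = (mat_exp (t \<cdot>\<^sub>m A) * A) $$ (i, j)" .
qed (use A in auto)

section \<open>Uniqueness for the differential equation X' = A X\<close>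

lemma has_mat_derivative_zero_const:
  assumes "convex S" "open S" "\<And>z. z \<in> S \<Longrightarrow> has_mat_derivative N R (0\<^sub>m N N) z" "a \<in> S" "b \<in> S"
  shows "R a = R b"
proof (rule eq_matI)
  have c: "R z \<in> carrier_mat N N" for z
    using assms(3)[OF assms(4)] by (auto simp: has_mat_derivative_def)
  show "dim_row (R a) = dim_row (R b)" "dim_col (R a) = dim_col (R b)"
    using c[of a] c[of b] by auto
  fix i j assume "i < dim_row (R b)" "j < dim_col (R b)"
  then have ij: "i < N" "j < N" using c[of b] by auto
  have "\<exists>k. \<forall>z\<in>S. R z $$ (i, j) = k"
    using assms(1,3) ij
    by (intro has_field_derivative_zero_constant)
      (auto simp: has_mat_derivative_def intro: has_field_derivative_at_within)
  then show "R a $$ (i, j) = R b $$ (i, j)"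
    using assms(4,5) by auto
qed

lemma has_mat_derivative_mat_exp_minus:
  fixes A :: "complex mat"
  assumes A: "A \<in> carrier_mat N N"
  shows "has_mat_derivative N (\<lambda>t. mat_exp (- t \<cdot>\<^sub>m A)) (- (mat_exp (- z \<cdot>\<^sub>m A) * A)) z"
  unfolding has_mat_derivative_def
proof (intro conjI allI impI)
  show "mat_exp (- z \<cdot>\<^sub>m A) \<in> carrier_mat N N" for z using A by auto
  show "- (mat_exp (- z \<cdot>\<^sub>m A) * A) \<in> carrier_mat N N" using A by auto
  fix i j assume ij: "i < N" "j < N"
  have "((\<lambda>t. mat_exp (t \<cdot>\<^sub>m A) $$ (i, j)) has_field_derivative
      (mat_exp (- z \<cdot>\<^sub>m A) * A) $$ (i, j)) (at (- z))"
    using has_mat_derivative_mat_exp[OF A, of "- z"] ij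
    unfolding has_mat_derivative_def mat_exp_commutes[OF A] by blast
  then have "((\<lambda>t. mat_exp (- t \<cdot>\<^sub>m A) $$ (i, j)) has_field_derivative
      (mat_exp (- z \<cdot>\<^sub>m A) * A) $$ (i, j) * - 1) (at z)"
    by (rule DERIV_chain2) (auto intro!: derivative_eq_intros)
  moreover have "(- (mat_exp (- z \<cdot>\<^sub>m A) * A)) $$ (i, j) = (mat_exp (- z \<cdot>\<^sub>m A) * A) $$ (i, j) * - 1"
    using A ij by (simp del: index_mult_mat(1))
  ultimately show "((\<lambda>t. mat_exp (- t \<cdot>\<^sub>m A) $$ (i, j)) has_field_derivative
      (- (mat_exp (- z \<cdot>\<^sub>m A) * A)) $$ (i, j)) (at z)"
    by simp
qed

text \<open>Integrating factor: the derivative of exp(-zA) R(z) is - exp(-zA) A R(z) + exp(-zA) A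
  R(z) = 0.\<close>

lemma mat_exp_minus_const:
  assumes A: "A \<in> carrier_mat N N" and S: "convex S" "open S" "0 \<in> S" "z \<in> S"
    and R: "\<And>z. z \<in> S \<Longrightarrow> has_mat_derivative N R (A * R z) z"
  shows "mat_exp (- z \<cdot>\<^sub>m A) * R z = R 0"
proof -
  have c: "R z \<in> carrier_mat N N" for z
    using R[OF S(3)] by (auto simp: has_mat_derivative_def)
  have "mat_exp (- z \<cdot>\<^sub>m A) * R z = mat_exp (- 0 \<cdot>\<^sub>m A) * R 0"
  proof (rule has_mat_derivative_zero_const[OF S(1,2) _ S(4,3)])
    fix z assume z: "z \<in> S"
    show "has_mat_derivative N (\<lambda>a. mat_exp (- a \<cdot>\<^sub>m A) * R a) (0\<^sub>m N N) z"
    proof (rule has_mat_derivative_eq[OF has_mat_derivative_mult])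
      show "has_mat_derivative N (\<lambda>t. mat_exp (- t \<cdot>\<^sub>m A)) (- (mat_exp (- z \<cdot>\<^sub>m A) * A)) z"
        by (rule has_mat_derivative_mat_exp_minus[OF A])
      show "has_mat_derivative N R (A * R z) z" using R[OF z] .
      have E: "mat_exp (- z \<cdot>\<^sub>m A) \<in> carrier_mat N N" using A by auto
      have "mat_exp (- z \<cdot>\<^sub>m A) * (A * R z) = mat_exp (- z \<cdot>\<^sub>m A) * A * R z"
        using A E c[of z] by (intro assoc_mult_mat[symmetric]) auto
      moreover have "mat_exp (- z \<cdot>\<^sub>m A) * A * R z \<in> carrier_mat N N"
        using A E c[of z] by (meson mult_carrier_mat)
      moreover have "- (mat_exp (- z \<cdot>\<^sub>m A) * A) * R z = - (mat_exp (- z \<cdot>\<^sub>m A) * A * R z)"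
        using A E c[of z] by (intro uminus_mult_left_mat) simp
      ultimately show "- (mat_exp (- z \<cdot>\<^sub>m A) * A) * R z + mat_exp (- z \<cdot>\<^sub>m A) * (A * R z) = 0\<^sub>m N N"
        by simp
    qed
  qed
  also have "\<dots> = R 0" using A c[of 0] by simp
  finally show ?thesis .
qed

lemma mat_exp_minus_mult:
  assumes A: "A \<in> carrier_mat N N"
  shows "mat_exp (- z \<cdot>\<^sub>m A) * mat_exp (z \<cdot>\<^sub>m A) = 1\<^sub>m N"
  using mat_exp_minus_const[OF A convex_UNIV open_UNIV UNIV_I UNIV_I has_mat_derivative_mat_exp[OF A]] A
  by simp

text \<open>The identities between exponentials below come from checking that one side solves X' = A
  X. A convex open domain replaces the plane because a solution containing a logarithm is
  differentiable only on part of it.\<close>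

lemma mat_exp_ode_unique:
  assumes A: "A \<in> carrier_mat N N" and S: "convex S" "open S" "0 \<in> S" "z \<in> S"
    and R: "\<And>z. z \<in> S \<Longrightarrow> has_mat_derivative N R (A * R z) z"
  shows "R z = mat_exp (z \<cdot>\<^sub>m A) * R 0"
proof -
  have c: "R z \<in> carrier_mat N N"
    using R[OF S(3)] by (auto simp: has_mat_derivative_def)
  have "mat_exp (z \<cdot>\<^sub>m A) * (mat_exp (- z \<cdot>\<^sub>m A) * R z)
      = mat_exp (z \<cdot>\<^sub>m A) * mat_exp (- z \<cdot>\<^sub>m A) * R z"
    using A c by (intro assoc_mult_mat[symmetric]) auto
  then show ?thesis
    using mat_exp_minus_mult[OF A, of "- z"] mat_exp_minus_const[OF A S R] c by simp
qed

lemma mat_exp_ode_unique_UNIV: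
  assumes "A \<in> carrier_mat N N" and "\<And>z. has_mat_derivative N R (A * R z) z"
  shows "R z = mat_exp (z \<cdot>\<^sub>m A) * R 0"
  using mat_exp_ode_unique[OF assms(1) convex_UNIV open_UNIV UNIV_I UNIV_I assms(2)] .

lemma mat_mult_closed: "A \<in> carrier_mat N N \<Longrightarrow> B \<in> carrier_mat N N \<Longrightarrow> A * B \<in> carrier_mat N N"
  by auto

lemmas mat_ring_simps = assoc_mult_mat[of _ N N _ N _ N] add_mult_distrib_mat[of _ N N _ _ N]
  mult_add_distrib_mat[of _ N N _ N] minus_mult_distrib_mat[of _ N N _ _ N]
  mult_minus_distrib_mat[of _ N N _ N] mult_smult_distrib[of _ N N _ N]
  mult_smult_assoc_mat[of _ N N _ N] mat_mult_closed for N

lemma has_mat_derivative_mat_exp_comp: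
  assumes A: "A \<in> carrier_mat N N" and g: "(g has_field_derivative g') (at z)"
  shows "has_mat_derivative N (\<lambda>z. mat_exp (g z \<cdot>\<^sub>m A)) (g' \<cdot>\<^sub>m (A * mat_exp (g z \<cdot>\<^sub>m A))) z"
  unfolding has_mat_derivative_def
proof (intro conjI allI impI)
  show "mat_exp (g z \<cdot>\<^sub>m A) \<in> carrier_mat N N" for z using A by auto
  show "g' \<cdot>\<^sub>m (A * mat_exp (g z \<cdot>\<^sub>m A)) \<in> carrier_mat N N" using A by auto
  fix i j assume ij: "i < N" "j < N"
  have "((\<lambda>t. mat_exp (t \<cdot>\<^sub>m A) $$ (i, j)) has_field_derivative
      (A * mat_exp (g z \<cdot>\<^sub>m A)) $$ (i, j)) (at (g z))"
    using has_mat_derivative_mat_exp[OF A, of "g z"] ij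
    unfolding has_mat_derivative_def by blast
  then have "((\<lambda>t. mat_exp (g t \<cdot>\<^sub>m A) $$ (i, j)) has_field_derivative
      (A * mat_exp (g z \<cdot>\<^sub>m A)) $$ (i, j) * g') (at z)"
    by (rule DERIV_chain2[OF _ g])
  then show "((\<lambda>t. mat_exp (g t \<cdot>\<^sub>m A) $$ (i, j)) has_field_derivative
      (g' \<cdot>\<^sub>m (A * mat_exp (g z \<cdot>\<^sub>m A))) $$ (i, j)) (at z)"
    using A ij by (simp add: mult.commute del: index_mult_mat(1))
qed

lemma has_mat_derivative_const_mult:
  assumes "A \<in> carrier_mat N N" "has_mat_derivative N R D z"
  shows "has_mat_derivative N (\<lambda>z. A * R z) (A * D) z"
proof (rule has_mat_derivative_eq[OF has_mat_derivative_mult[OF has_mat_derivative_const[OF assms(1)] assms(2)]])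
  have "R z \<in> carrier_mat N N" "D \<in> carrier_mat N N"
    using assms(2) by (auto simp: has_mat_derivative_def)
  then show "0\<^sub>m N N * R z + A * D = A * D"
    using assms(1) by (simp add: mat_mult_closed[of _ N])
qed

text \<open>B is an eigenvector of ad A, so conjugation by exp(zA) multiplies it by exp(az). In this
  form, without an inverse, the right side solves X' = A X with value B at 0.\<close>

lemma mat_exp_mult_eigenvector:
  assumes A: "A \<in> carrier_mat N N" and B: "B \<in> carrier_mat N N" and br: "lie_bracket A B = a \<cdot>\<^sub>m B"
  shows "mat_exp (z \<cdot>\<^sub>m A) * B = exp (a * z) \<cdot>\<^sub>m (B * mat_exp (z \<cdot>\<^sub>m A))"
proof -
  have AB: "A * B = B * A + a \<cdot>\<^sub>m B"
    using br[symmetric] A B unfolding lie_bracket_def by auto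
  have AB': "A * (B * Z) = B * (A * Z) + a \<cdot>\<^sub>m (B * Z)" if "Z \<in> carrier_mat N N" for Z
  proof -
    have "A * (B * Z) = A * B * Z"
      using A B that by (simp add: mat_ring_simps[where N = N])
    also have "\<dots> = B * (A * Z) + a \<cdot>\<^sub>m (B * Z)"
      unfolding AB using A B that by (simp add: mat_ring_simps[where N = N])
    finally show ?thesis .
  qed
  have "exp (a * z) \<cdot>\<^sub>m (B * mat_exp (z \<cdot>\<^sub>m A)) = mat_exp (z \<cdot>\<^sub>m A) * (exp (a * 0) \<cdot>\<^sub>m (B * mat_exp (0 \<cdot>\<^sub>m A)))"
  proof (rule mat_exp_ode_unique_UNIV[OF A, of "\<lambda>z. exp (a * z) \<cdot>\<^sub>m (B * mat_exp (z \<cdot>\<^sub>m A))"])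
    fix z
    show "has_mat_derivative N (\<lambda>z. exp (a * z) \<cdot>\<^sub>m (B * mat_exp (z \<cdot>\<^sub>m A)))
      (A * (exp (a * z) \<cdot>\<^sub>m (B * mat_exp (z \<cdot>\<^sub>m A)))) z"
    proof (rule has_mat_derivative_eq[OF has_mat_derivative_smult[OF _
            has_mat_derivative_const_mult[OF B has_mat_derivative_mat_exp[OF A]]]])
      show "((\<lambda>z. exp (a * z)) has_field_derivative a * exp (a * z)) (at z)"
        by (auto intro!: derivative_eq_intros)
      have "mat_exp (z \<cdot>\<^sub>m A) \<in> carrier_mat N N" using A by simp
      then show "(a * exp (a * z)) \<cdot>\<^sub>m (B * mat_exp (z \<cdot>\<^sub>m A)) + exp (a * z) \<cdot>\<^sub>m (B * (A * mat_exp (z \<cdot>\<^sub>m A)))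
         = A * (exp (a * z) \<cdot>\<^sub>m (B * mat_exp (z \<cdot>\<^sub>m A)))"
        using A B by (simp add: mat_ring_simps[where N = N] AB')
          (rule eq_matI, auto simp: algebra_simps simp del: index_mult_mat(1))
    qed
  qed
  moreover have "1 \<cdot>\<^sub>m B = B" by (rule eq_matI) auto
  ultimately show ?thesis using A B by simp
qed

text \<open>As a function of t the left side solves X' = (exp(az) B) X. For A = h_i this is the
  action of the torus on the root subgroups, and a = 0 is the case of commuting subgroups.\<close>

lemma mat_exp_conjugate:
  assumes A: "A \<in> carrier_mat N N" and B: "B \<in> carrier_mat N N" and br: "lie_bracket A B = a \<cdot>\<^sub>m B"
  shows "mat_exp (z \<cdot>\<^sub>m A) * mat_exp (t \<cdot>\<^sub>m B) = mat_exp ((exp (a * z) * t) \<cdot>\<^sub>m B) * mat_exp (z \<cdot>\<^sub>m A)"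
proof -
  have E: "mat_exp (t \<cdot>\<^sub>m B) \<in> carrier_mat N N" "mat_exp (z \<cdot>\<^sub>m A) \<in> carrier_mat N N" for t z
    using A B by auto
  have "mat_exp (z \<cdot>\<^sub>m A) * mat_exp (t \<cdot>\<^sub>m B)
      = mat_exp (t \<cdot>\<^sub>m (exp (a * z) \<cdot>\<^sub>m B)) * (mat_exp (z \<cdot>\<^sub>m A) * mat_exp (0 \<cdot>\<^sub>m B))"
  proof (rule mat_exp_ode_unique_UNIV[of "exp (a * z) \<cdot>\<^sub>m B" N])
    show "exp (a * z) \<cdot>\<^sub>m B \<in> carrier_mat N N" using B by simp
    fix t
    show "has_mat_derivative N (\<lambda>t. mat_exp (z \<cdot>\<^sub>m A) * mat_exp (t \<cdot>\<^sub>m B))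
        (exp (a * z) \<cdot>\<^sub>m B * (mat_exp (z \<cdot>\<^sub>m A) * mat_exp (t \<cdot>\<^sub>m B))) t"
    proof (rule has_mat_derivative_eq[OF has_mat_derivative_const_mult[OF E(2) has_mat_derivative_mat_exp[OF B]]])
      have "mat_exp (z \<cdot>\<^sub>m A) * (B * mat_exp (t \<cdot>\<^sub>m B)) = (mat_exp (z \<cdot>\<^sub>m A) * B) * mat_exp (t \<cdot>\<^sub>m B)"
        using B E by (simp add: mat_ring_simps[where N = N])
      also have "\<dots> = exp (a * z) \<cdot>\<^sub>m B * (mat_exp (z \<cdot>\<^sub>m A) * mat_exp (t \<cdot>\<^sub>m B))"
        unfolding mat_exp_mult_eigenvector[OF A B br] using B E by (simp add: mat_ring_simps[where N = N])
      finally show "mat_exp (z \<cdot>\<^sub>m A) * (B * mat_exp (t \<cdot>\<^sub>m B))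
        = exp (a * z) \<cdot>\<^sub>m B * (mat_exp (z \<cdot>\<^sub>m A) * mat_exp (t \<cdot>\<^sub>m B))" .
    qed
  qed
  moreover have "t \<cdot>\<^sub>m (exp (a * z) \<cdot>\<^sub>m B) = (exp (a * z) * t) \<cdot>\<^sub>m B"
    using B by (intro eq_matI) auto
  moreover have "mat_exp (z \<cdot>\<^sub>m A) * mat_exp (0 \<cdot>\<^sub>m B) = mat_exp (z \<cdot>\<^sub>m A)"
    using B E(2)[of z] right_mult_one_mat[of _ N N] by simp
  ultimately show ?thesis by simp
qed

lemma mat_exp_commute:
  assumes A: "A \<in> carrier_mat N N" and B: "B \<in> carrier_mat N N" and br: "lie_bracket A B = 0\<^sub>m N N"
  shows "mat_exp (s \<cdot>\<^sub>m A) * mat_exp (t \<cdot>\<^sub>m B) = mat_exp (t \<cdot>\<^sub>m B) * mat_exp (s \<cdot>\<^sub>m A)"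
proof -
  have "lie_bracket A B = 0 \<cdot>\<^sub>m B"
    using B unfolding br by (intro eq_matI) auto
  from mat_exp_conjugate[OF A B this, of s t] show ?thesis by simp
qed

section \<open>Gauss decomposition in rank one\<close>

locale sl2_triple =
  fixes N :: nat and E F H :: "complex mat"
  assumes E: "E \<in> carrier_mat N N" and F: "F \<in> carrier_mat N N" and H: "H \<in> carrier_mat N N"
    and EF: "lie_bracket E F = H" and HE: "lie_bracket H E = 2 \<cdot>\<^sub>m E" and HF: "lie_bracket H F = - 2 \<cdot>\<^sub>m F"
begin

lemma EF': "Z \<in> carrier_mat N N \<Longrightarrow> E * (F * Z) = F * (E * Z) + H * Z"
proof -
  assume Z: "Z \<in> carrier_mat N N"
  have "E * F = F * E + H"
    using EF[symmetric] E F unfolding lie_bracket_def by auto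
  moreover have "E * (F * Z) = E * F * Z"
    using E F Z by (simp add: mat_ring_simps[where N = N])
  ultimately show ?thesis
    using E F H Z by (simp add: mat_ring_simps[where N = N])
qed

lemma HF': "Z \<in> carrier_mat N N \<Longrightarrow> H * (F * Z) = F * (H * Z) + - 2 \<cdot>\<^sub>m (F * Z)"
proof -
  assume Z: "Z \<in> carrier_mat N N"
  have "H * F = F * H + - 2 \<cdot>\<^sub>m F"
    using HF[symmetric] H F unfolding lie_bracket_def by auto
  moreover have "H * (F * Z) = H * F * Z"
    using H F Z by (simp add: mat_ring_simps[where N = N])
  ultimately show ?thesis
    using F H Z by (simp add: mat_ring_simps[where N = N])
qed

text \<open>Conjugating H by exp(\<tau> F) gives the exponential series of ad F at H, which stops
  after the linear term because [F, H] = 2 F.\<close>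

lemma mat_exp_F_H: "mat_exp (\<tau> \<cdot>\<^sub>m F) * H = (H + (2 * \<tau>) \<cdot>\<^sub>m F) * mat_exp (\<tau> \<cdot>\<^sub>m F)"
proof -
  have "(H + (2 * \<tau>) \<cdot>\<^sub>m F) * mat_exp (\<tau> \<cdot>\<^sub>m F) = mat_exp (\<tau> \<cdot>\<^sub>m F) * ((H + (2 * 0) \<cdot>\<^sub>m F) * mat_exp (0 \<cdot>\<^sub>m F))"
  proof (rule mat_exp_ode_unique_UNIV[OF F, of "\<lambda>\<tau>. (H + (2 * \<tau>) \<cdot>\<^sub>m F) * mat_exp (\<tau> \<cdot>\<^sub>m F)"])
    fix \<tau> :: complex
    let ?X = "mat_exp (\<tau> \<cdot>\<^sub>m F)"
    have X: "?X \<in> carrier_mat N N" using F by simp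
    show "has_mat_derivative N (\<lambda>\<tau>. (H + (2 * \<tau>) \<cdot>\<^sub>m F) * mat_exp (\<tau> \<cdot>\<^sub>m F))
        (F * ((H + (2 * \<tau>) \<cdot>\<^sub>m F) * ?X)) \<tau>"
    proof (rule has_mat_derivative_eq[OF has_mat_derivative_mult[OF has_mat_derivative_add[OF
        has_mat_derivative_const[OF H] has_mat_derivative_smult[OF _ has_mat_derivative_const[OF F]]]
        has_mat_derivative_mat_exp[OF F]]])
      show "((\<lambda>\<tau>. 2 * \<tau>) has_field_derivative 2) (at \<tau>)" by (auto intro!: derivative_eq_intros)
      show "(0\<^sub>m N N + (2 \<cdot>\<^sub>m F + (2 * \<tau>) \<cdot>\<^sub>m 0\<^sub>m N N)) * ?X + (H + (2 * \<tau>) \<cdot>\<^sub>m F) * (F * ?X)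
          = F * ((H + (2 * \<tau>) \<cdot>\<^sub>m F) * ?X)"
        using F H X by (simp add: mat_ring_simps[where N = N] HF')
          (rule eq_matI, auto simp: algebra_simps simp del: index_mult_mat(1))
    qed
  qed
  moreover have "H + (2 * 0) \<cdot>\<^sub>m F = H" using H F by (intro eq_matI) auto
  ultimately show ?thesis using F H by simp
qed

text \<open>Here the series of ad F stops after the quadratic term: [F, E] = - H and [F, [F, E]] = -
  2 F.\<close>

lemma mat_exp_F_E:
  "mat_exp (\<tau> \<cdot>\<^sub>m F) * E = (E + - \<tau> \<cdot>\<^sub>m H + - (\<tau>\<^sup>2) \<cdot>\<^sub>m F) * mat_exp (\<tau> \<cdot>\<^sub>m F)"
proof -
  have "(E + - \<tau> \<cdot>\<^sub>m H + - (\<tau>\<^sup>2) \<cdot>\<^sub>m F) * mat_exp (\<tau> \<cdot>\<^sub>m F)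
      = mat_exp (\<tau> \<cdot>\<^sub>m F) * ((E + - 0 \<cdot>\<^sub>m H + - (0\<^sup>2) \<cdot>\<^sub>m F) * mat_exp (0 \<cdot>\<^sub>m F))"
  proof (rule mat_exp_ode_unique_UNIV[OF F, of "\<lambda>\<tau>. (E + - \<tau> \<cdot>\<^sub>m H + - (\<tau>\<^sup>2) \<cdot>\<^sub>m F) * mat_exp (\<tau> \<cdot>\<^sub>m F)"])
    fix \<tau> :: complex
    let ?X = "mat_exp (\<tau> \<cdot>\<^sub>m F)"
    have X: "?X \<in> carrier_mat N N" using F by simp
    show "has_mat_derivative N (\<lambda>\<tau>. (E + - \<tau> \<cdot>\<^sub>m H + - (\<tau>\<^sup>2) \<cdot>\<^sub>m F) * mat_exp (\<tau> \<cdot>\<^sub>m F))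
        (F * ((E + - \<tau> \<cdot>\<^sub>m H + - (\<tau>\<^sup>2) \<cdot>\<^sub>m F) * ?X)) \<tau>"
    proof (rule has_mat_derivative_eq[OF has_mat_derivative_mult[OF has_mat_derivative_add[OF has_mat_derivative_add[OF
        has_mat_derivative_const[OF E] has_mat_derivative_smult[OF _ has_mat_derivative_const[OF H]]]
        has_mat_derivative_smult[OF _ has_mat_derivative_const[OF F]]]
        has_mat_derivative_mat_exp[OF F]]])
      show "((\<lambda>\<tau>. - \<tau>) has_field_derivative - 1) (at \<tau>)" by (auto intro!: derivative_eq_intros)
      show "((\<lambda>\<tau>. - (\<tau>\<^sup>2)) has_field_derivative - 2 * \<tau>) (at \<tau>)" by (auto intro!: derivative_eq_intros)
      show "(0\<^sub>m N N + (- 1 \<cdot>\<^sub>m H + - \<tau> \<cdot>\<^sub>m 0\<^sub>m N N) + ((- 2 * \<tau>) \<cdot>\<^sub>m F + - \<tau>\<^sup>2 \<cdot>\<^sub>m 0\<^sub>m N N)) * ?X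
          + (E + - \<tau> \<cdot>\<^sub>m H + - \<tau>\<^sup>2 \<cdot>\<^sub>m F) * (F * ?X)
          = F * ((E + - \<tau> \<cdot>\<^sub>m H + - \<tau>\<^sup>2 \<cdot>\<^sub>m F) * ?X)"
        using E F H X by (simp add: mat_ring_simps[where N = N] HF' EF')
          (rule eq_matI, auto simp: algebra_simps power2_eq_square simp del: index_mult_mat(1))
    qed
  qed
  moreover have "E + - 0 \<cdot>\<^sub>m H + - (0\<^sup>2) \<cdot>\<^sub>m F = E" using E H F by (intro eq_matI) auto
  ultimately show ?thesis using F E by simp
qed

text \<open>The right side, as a function of s, solves X' = E X and equals exp(tF) at s = 0. The
  condition on the real part keeps 1 + s t off the branch cut of \<open>Ln\<close>, and the
  admissible s form a convex open set that contains 0.\<close>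

lemma mat_exp_E_F:
  assumes st: "Re (1 + s * t) > 0"
  shows "mat_exp (s \<cdot>\<^sub>m E) * mat_exp (t \<cdot>\<^sub>m F)
    = mat_exp ((t / (1 + s * t)) \<cdot>\<^sub>m F) * (mat_exp (Ln (1 + s * t) \<cdot>\<^sub>m H) * mat_exp ((s / (1 + s * t)) \<cdot>\<^sub>m E))"
proof -
  define S where "S = {s. Re (s * t) > - 1}"
  have "S = (\<lambda>s. s * t) -` {z. Re z > - 1}" by (auto simp: S_def)
  moreover have "convex ((\<lambda>s. s * t) -` {z. Re z > - 1})"
    by (intro convex_linear_vimage convex_halfspace_Re_gt bounded_linear.linear bounded_linear_mult_left)
  ultimately have convex: "convex S" by simp
  have "open S" unfolding S_def by (intro open_Collect_less continuous_intros)
  define R where "R s = mat_exp ((t / (1 + s * t)) \<cdot>\<^sub>m F)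
      * (mat_exp (Ln (1 + s * t) \<cdot>\<^sub>m H) * mat_exp ((s / (1 + s * t)) \<cdot>\<^sub>m E))" for s
  have "R s = mat_exp (s \<cdot>\<^sub>m E) * R 0"
  proof (rule mat_exp_ode_unique[OF E convex \<open>open S\<close>])
    fix s assume "s \<in> S"
    then have pos: "Re (1 + s * t) > 0" by (simp add: S_def)
    then have nz: "1 + s * t \<noteq> 0" by (metis less_irrefl zero_complex.simps(1))
    have nle: "1 + s * t \<notin> \<real>\<^sub>\<le>\<^sub>0" using pos by (auto simp: complex_nonpos_Reals_iff)
    \<comment> \<open>The three parameters t / (1 + s t), Ln (1 + s t) and s / (1 + s t) have the
      derivatives - \<tau>^2, \<tau> and 1 / q in s.\<close>
    define \<tau> where "\<tau> = t / (1 + s * t)"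
    define q where "q = (1 + s * t)\<^sup>2"
    have q: "q \<noteq> 0" using nz by (simp add: q_def)
    let ?A = "mat_exp ((t / (1 + s * t)) \<cdot>\<^sub>m F)" and ?B = "mat_exp (Ln (1 + s * t) \<cdot>\<^sub>m H)"
      and ?C = "mat_exp ((s / (1 + s * t)) \<cdot>\<^sub>m E)"
    have c: "?A \<in> carrier_mat N N" "?B \<in> carrier_mat N N" "?C \<in> carrier_mat N N"
      using E F H by auto
    show "has_mat_derivative N R (E * R s) s"
      unfolding R_def
    proof (rule has_mat_derivative_eq[OF has_mat_derivative_mult[OF has_mat_derivative_mat_exp_comp[OF F]
          has_mat_derivative_mult[OF has_mat_derivative_mat_exp_comp[OF H] has_mat_derivative_mat_exp_comp[OF E]]]])
      show "((\<lambda>s. t / (1 + s * t)) has_field_derivative - \<tau>\<^sup>2) (at s)"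
        using nz by (auto intro!: derivative_eq_intros simp: \<tau>_def power2_eq_square divide_simps)
      show "((\<lambda>s. Ln (1 + s * t)) has_field_derivative \<tau>) (at s)"
        using nz nle by (auto intro!: derivative_eq_intros simp: \<tau>_def divide_inverse mult.commute)
      show "((\<lambda>s. s / (1 + s * t)) has_field_derivative inverse q) (at s)"
        using nz by (auto intro!: derivative_eq_intros simp: q_def power2_eq_square divide_simps)
      have AH: "?A * (H * Z) = H * (?A * Z) + (2 * \<tau>) \<cdot>\<^sub>m (F * (?A * Z))" if "Z \<in> carrier_mat N N" for Z
      proof -
        have "?A * (H * Z) = ?A * H * Z" using c H that by (simp add: mat_ring_simps[where N = N])
        then show ?thesis
          using c F H that unfolding mat_exp_F_H \<tau>_def by (simp add: mat_ring_simps[where N = N])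
      qed
      have AE: "?A * (E * Z) = E * (?A * Z) + - \<tau> \<cdot>\<^sub>m (H * (?A * Z)) + - (\<tau>\<^sup>2) \<cdot>\<^sub>m (F * (?A * Z))"
        if "Z \<in> carrier_mat N N" for Z
      proof -
        have "?A * (E * Z) = ?A * E * Z" using c E that by (simp add: mat_ring_simps[where N = N])
        then show ?thesis
          using c E F H that unfolding mat_exp_F_E \<tau>_def
            by (simp add: mat_ring_simps[where N = N] assoc_add_mat[of _ N N])
      qed
      have BE: "?B * (E * Z) = q \<cdot>\<^sub>m (E * (?B * Z))" if "Z \<in> carrier_mat N N" for Z
      proof -
        have "exp (2 * Ln (1 + s * t)) = q"
          using nz by (simp add: q_def exp_double)
        moreover have "?B * (E * Z) = ?B * E * Z" using c E that by (simp add: mat_ring_simps[where N = N])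
        ultimately show ?thesis
          using c E that mat_exp_mult_eigenvector[OF H E HE, of "Ln (1 + s * t)"]
          by (simp add: mat_ring_simps[where N = N])
      qed
      \<comment> \<open>Once H and E are moved to the far left, only E survives: the factor q from
        the torus cancels 1 / q, the H terms are \<tau> - \<tau>, and the F terms are - \<tau>^2 + 2
        \<tau>^2 - \<tau>^2.\<close>
      show "- \<tau>\<^sup>2 \<cdot>\<^sub>m (F * ?A) * (?B * ?C) + ?A * (\<tau> \<cdot>\<^sub>m (H * ?B) * ?C + ?B * (inverse q \<cdot>\<^sub>m (E * ?C)))
          = E * (?A * (?B * ?C))"
        using c E F H by (simp only: mat_ring_simps[where N = N] BE smult_carrier_mat AH AE)
          (rule eq_matI, auto simp: algebra_simps power2_eq_square field_simps q simp del: index_mult_mat(1))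
    qed
  qed (use st in \<open>auto simp: S_def\<close>)
  moreover have "R 0 = mat_exp (t \<cdot>\<^sub>m F)"
    using E F H mat_exp_carrier[of "t \<cdot>\<^sub>m F" N] by (simp add: R_def)
  ultimately show ?thesis by (simp add: R_def)
qed

end

section \<open>The Weyl group as signed permutations\<close>

text \<open>Up to a factor of two, \<open>eps_coord n \<mu> j\<close> is the coefficient of \<open>\<mu>\<close> at \<open>\<epsilon>\<^sub>j\<close>, where
  \<open>\<alpha>\<^sub>j = \<epsilon>\<^sub>j - \<epsilon>\<^sub>j\<^sub>+\<^sub>1\<close> for \<open>j < n\<close> and \<open>\<alpha>\<^sub>n = \<epsilon>\<^sub>n\<close>.\<close>

definition eps_coord :: "nat \<Rightarrow> weight \<Rightarrow> nat \<Rightarrow> int" where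
  "eps_coord n \<mu> j = 2 * (\<Sum>l\<in>{j..<n}. \<mu> l) + \<mu> n"

definition adj_swap :: "nat \<Rightarrow> nat \<Rightarrow> nat" where
  "adj_swap i j = (if j = i then Suc i else if j = Suc i then i else j)"

lemma adj_swap_involution [simp]: "adj_swap i (adj_swap i j) = j"
  by (auto simp: adj_swap_def)

lemma adj_swap_mem: "1 \<le> i \<Longrightarrow> i < n \<Longrightarrow> j \<in> {1..n} \<Longrightarrow> adj_swap i j \<in> {1..n}"
  by (auto simp: adj_swap_def)

lemma eps_coord_last: "eps_coord n \<mu> n = \<mu> n"
  by (simp add: eps_coord_def)

lemma eps_coord_Suc: "j < n \<Longrightarrow> eps_coord n \<mu> j = eps_coord n \<mu> (Suc j) + 2 * \<mu> j"
  by (simp add: eps_coord_def sum.atLeast_Suc_lessThan)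

lemma eps_coord_eqD:
  assumes "\<And>j. j \<in> {1..n} \<Longrightarrow> eps_coord n \<mu> j = eps_coord n \<nu> j" "j \<in> {1..n}"
  shows "\<mu> j = \<nu> j"
proof (cases "j = n")
  case True
  then show ?thesis using assms by (metis eps_coord_last)
next
  case False
  then show ?thesis
    using assms(1)[of j] assms(1)[of "Suc j"] assms(2) eps_coord_Suc[of j n \<mu>] eps_coord_Suc[of j n \<nu>]
    by simp
qed

text \<open>Coordinates are tail sums of \<mu>, so the induction descends from j = n; consecutive
  coordinates differ by 2 \<mu>(h_j), to which one Cartan entry contributes.\<close>

lemma eps_coord_simple_reflection:
  assumes i: "i \<in> {1..n}" and j: "j \<in> {1..n}"
  shows "eps_coord n (simple_reflection n i \<mu>) j =
    (if i < n then eps_coord n \<mu> (adj_swap i j) else if j = n then - eps_coord n \<mu> n else eps_coord n \<mu> j)"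
proof -
  have "j \<le> n" using j by simp
  then have "1 \<le> j \<longrightarrow> ?thesis"
  proof (induction rule: inc_induct)
    case base
    show ?case
      using i j eps_coord_Suc[of "n - 1" n \<mu>]
      by (auto simp: eps_coord_last simple_reflection_def cartan_B_def adj_swap_def)
  next
    case (step m)
    show ?case
    proof
      assume m: "1 \<le> m"
      have "eps_coord n (simple_reflection n i \<mu>) m
        = eps_coord n (simple_reflection n i \<mu>) (Suc m) + 2 * (\<mu> m - \<mu> i * cartan_B n m i)"
        using step by (simp add: eps_coord_Suc[of m] simple_reflection_def)
      then show "eps_coord n (simple_reflection n i \<mu>) m = (if i < n then eps_coord n \<mu> (adj_swap i m)
          else if m = n then - eps_coord n \<mu> n else eps_coord n \<mu> m)"
        using step m i eps_coord_Suc[of m n \<mu>] eps_coord_Suc[of "Suc m" n \<mu>] eps_coord_Suc[of "m - 1" n \<mu>]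
          eps_coord_last[of n \<mu>]
        by (auto simp: cartan_B_def adj_swap_def split: if_splits)
    qed
  qed
  then show ?thesis using j by simp
qed

lemma simple_reflection_outside: "j \<notin> {1..n} \<Longrightarrow> simple_reflection n i \<mu> j = \<mu> j"
  by (auto simp: simple_reflection_def cartan_B_def)

lemma simple_reflection_involution:
  "i \<in> {1..n} \<Longrightarrow> simple_reflection n i (simple_reflection n i \<mu>) = \<mu>"
  by (auto simp: simple_reflection_def fun_eq_iff algebra_simps cartan_B_def)

lemma word_elt_Nil [simp]: "word_elt n [] = id"
  by (simp add: word_elt_def)

lemma word_elt_Cons [simp]: "word_elt n (i # is) = simple_reflection n i \<circ> word_elt n is"
  by (simp add: word_elt_def)

lemma word_elt_outside: "j \<notin> {1..n} \<Longrightarrow> word_elt n is \<mu> j = \<mu> j"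
  by (induction "is") (auto simp: simple_reflection_outside)

lemma word_elt_append: "word_elt n (is @ js) = word_elt n is \<circ> word_elt n js"
  by (induction "is") (auto simp: comp_assoc)

text \<open>The action permutes and negates the coordinates, so it commutes with every odd function
  applied to all of them. Every weight is the image of the regular weight \<open>\<rho>\<close> under such a
  function.\<close>

lemma eps_coord_word_elt_odd:
  assumes "\<And>z. \<phi> (- z) = - \<phi> z" "is \<in> lists {1..n}"
    "\<And>a. a \<in> {1..n} \<Longrightarrow> eps_coord n \<mu> a = \<phi> (eps_coord n \<nu> a)" "a \<in> {1..n}"
  shows "eps_coord n (word_elt n is \<mu>) a = \<phi> (eps_coord n (word_elt n is \<nu>) a)"
  using assms(2,4)
proof (induction "is" arbitrary: a)
  case Nil
  then show ?case using assms by simp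
next
  case (Cons i "is")
  then have "i \<in> {1..n}" "is \<in> lists {1..n}" by auto
  then show ?case
    using Cons.IH[of a] Cons.IH[of "adj_swap i a"] Cons.prems adj_swap_mem[of i n a] assms(1)
    by (auto simp: eps_coord_simple_reflection)
qed

section \<open>The orbit of \<rho>, inversions and length\<close>

abbreviation rho :: weight where
  "rho \<equiv> \<lambda>j. 1"

lemma eps_coord_rho: "j \<le> n \<Longrightarrow> eps_coord n rho j = 2 * int (n - j) + 1"
  by (simp add: eps_coord_def)

text \<open>The preceding lemma carries agreement at \<rho> over to every weight; outside 1, ..., n
  words do not change a weight.\<close>

lemma word_elt_eqI:
  assumes "is \<in> lists {1..n}" "js \<in> lists {1..n}"
    "\<And>a. a \<in> {1..n} \<Longrightarrow> eps_coord n (word_elt n is rho) a = eps_coord n (word_elt n js rho) a"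
  shows "word_elt n is = word_elt n js"
proof (intro ext)
  fix \<mu> :: weight and j
  \<comment> \<open>The j-th coordinate of \<rho> is z = 2 (n - j) + 1, so (2 n + 1 - |z|) / 2
    recovers j, and \<open>sgn\<close> makes the function odd.\<close>
  define \<phi> where "\<phi> z = sgn z * eps_coord n \<mu> (nat ((2 * int n + 1 - \<bar>z\<bar>) div 2))" for z :: int
  have odd: "\<phi> (- z) = - \<phi> z" for z by (simp add: \<phi>_def sgn_minus)
  have "eps_coord n \<mu> a = \<phi> (eps_coord n rho a)" if "a \<in> {1..n}" for a
    using that by (simp add: \<phi>_def eps_coord_rho of_nat_diff)
  then have "eps_coord n (word_elt n is \<mu>) a = eps_coord n (word_elt n js \<mu>) a" if "a \<in> {1..n}" for a
    using that assms eps_coord_word_elt_odd[of \<phi> _ n \<mu> rho a, OF odd] by auto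
  then show "word_elt n is \<mu> j = word_elt n js \<mu> j"
    using eps_coord_eqD[of n "word_elt n is \<mu>" "word_elt n js \<mu>" j]
    by (cases "j \<in> {1..n}") (simp_all add: word_elt_outside)
qed

text \<open>By counting, n distinct odd numbers up to 2 n - 1 are exactly 1, 3, ..., 2 n - 1. So x
  arises from the coordinates of \<rho> by a signed permutation, which need not be named.\<close>

definition signed_perm_of_rho :: "nat \<Rightarrow> (nat \<Rightarrow> int) \<Rightarrow> bool" where
  "signed_perm_of_rho n x \<longleftrightarrow> (\<forall>a\<in>{1..n}. odd (x a) \<and> \<bar>x a\<bar> \<le> 2 * int n - 1) \<and>
     (\<forall>a\<in>{1..n}. \<forall>b\<in>{1..n}. a \<noteq> b \<longrightarrow> \<bar>x a\<bar> \<noteq> \<bar>x b\<bar>)"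

lemma signed_perm_of_rho_word_elt:
  "is \<in> lists {1..n} \<Longrightarrow> signed_perm_of_rho n (eps_coord n (word_elt n is rho))"
proof (induction "is")
  case Nil
  then show ?case by (auto simp: signed_perm_of_rho_def eps_coord_rho)
next
  case (Cons i "is")
  then have i: "i \<in> {1..n}" and IH: "signed_perm_of_rho n (eps_coord n (word_elt n is rho))" by auto
  let ?x = "eps_coord n (word_elt n is rho)"
  have inj: "adj_swap i a \<noteq> adj_swap i b" if "a \<noteq> b" for a b
    using that by (metis adj_swap_involution)
  show ?case
  proof (cases "i < n")
    case True
    then show ?thesis
      using IH i adj_swap_mem[of i n] inj unfolding signed_perm_of_rho_def
      by (auto simp: eps_coord_simple_reflection)
  next
    case False
    then show ?thesis
      using IH i unfolding signed_perm_of_rho_def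
      by (auto simp: eps_coord_simple_reflection)
  qed
qed

text \<open>The number of positive roots \<epsilon>_a - \<epsilon>_b, \<epsilon>_a + \<epsilon>_b
  and \<epsilon>_a whose pairing with x is negative.\<close>

definition inversions :: "nat \<Rightarrow> (nat \<Rightarrow> int) \<Rightarrow> nat" where
  "inversions n x = (\<Sum>(a, b)\<in>{(a, b). 1 \<le> a \<and> a < b \<and> b \<le> n}. of_bool (x a < x b) + of_bool (x a + x b < 0))
     + (\<Sum>a\<in>{1..n}. of_bool (x a < 0))"

lemma finite_inversion_pairs: "finite {(a, b). 1 \<le> a \<and> a < b \<and> b \<le> (n::nat)}"
  by (rule finite_subset[of _ "{1..n} \<times> {1..n}"]) auto

lemma inversions_cong:
  assumes "\<And>a. a \<in> {1..n} \<Longrightarrow> x a = y a"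
  shows "inversions n x = inversions n y"
  unfolding inversions_def by (intro arg_cong2[where f = "(+)"] sum.cong) (auto simp: assms)

text \<open>The reflection s_i permutes the positive roots other than \<alpha>_i, so only the root
  \<epsilon>_i - \<epsilon>_(i+1) changes its contribution. The equation is written with sums to
  avoid subtraction of natural numbers.\<close>

lemma inversions_swap:
  assumes i: "1 \<le> i" "i < n"
  shows "inversions n (\<lambda>j. x (adj_swap i j)) + of_bool (x i < x (Suc i))
    = inversions n x + of_bool (x (Suc i) < x i)"
proof -
  define T where "T = {(a, b). 1 \<le> a \<and> a < b \<and> b \<le> n}"
  define g :: "int \<Rightarrow> int \<Rightarrow> nat" where "g u v = of_bool (u < v) + of_bool (u + v < 0)" for u v
  let ?s = "adj_swap i"
  have fin: "finite T" unfolding T_def by (rule finite_inversion_pairs)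
  have mem: "(i, Suc i) \<in> T" using i by (auto simp: T_def)
  have "(\<Sum>(a, b)\<in>T - {(i, Suc i)}. g (x (?s a)) (x (?s b))) = (\<Sum>(a, b)\<in>T - {(i, Suc i)}. g (x a) (x b))"
    by (rule sum.reindex_bij_witness[where i = "\<lambda>(a, b). (?s a, ?s b)" and j = "\<lambda>(a, b). (?s a, ?s b)"])
      (use i in \<open>auto simp: T_def adj_swap_def split: if_splits\<close>)
  moreover have "(\<Sum>(a, b)\<in>T. g (x (?s a)) (x (?s b))) = g (x (Suc i)) (x i) + (\<Sum>(a, b)\<in>T - {(i, Suc i)}. g (x (?s a)) (x (?s b)))"
    using sum.remove[OF fin mem, of "\<lambda>(a, b). g (x (?s a)) (x (?s b))"] by (simp add: adj_swap_def)
  moreover have "(\<Sum>(a, b)\<in>T. g (x a) (x b)) = g (x i) (x (Suc i)) + (\<Sum>(a, b)\<in>T - {(i, Suc i)}. g (x a) (x b))"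
    using sum.remove[OF fin mem, of "\<lambda>(a, b). g (x a) (x b)"] by simp
  moreover have "(\<Sum>a\<in>{1..n}. of_bool (x (?s a) < 0)) = (\<Sum>a\<in>{1..n}. of_bool (x a < 0) :: nat)"
    by (rule sum.reindex_bij_witness[where i = ?s and j = ?s]) (use i adj_swap_mem in auto)
  moreover have "inversions n y = (\<Sum>(a, b)\<in>T. g (y a) (y b)) + (\<Sum>a\<in>{1..n}. of_bool (y a < 0))" for y
    by (simp add: inversions_def T_def g_def)
  moreover have "g (x (Suc i)) (x i) + of_bool (x i < x (Suc i)) = g (x i) (x (Suc i)) + of_bool (x (Suc i) < x i)"
    by (simp add: g_def add.commute)
  ultimately show ?thesis by simp
qed

text \<open>Negating the last coordinate exchanges the conditions for \<epsilon>_a - \<epsilon>_n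
  and \<epsilon>_a + \<epsilon>_n, so only the root \<epsilon>_n matters.\<close>

lemma inversions_negate_last:
  assumes "1 \<le> n"
  shows "inversions n (\<lambda>j. if j = n then - x n else x j) + of_bool (x n < 0)
    = inversions n x + of_bool (0 < x n)"
proof -
  let ?y = "\<lambda>j. if j = n then - x n else x j"
  have "(\<Sum>(a, b)\<in>{(a, b). 1 \<le> a \<and> a < b \<and> b \<le> n}. of_bool (?y a < ?y b) + of_bool (?y a + ?y b < 0))
    = (\<Sum>(a, b)\<in>{(a, b). 1 \<le> a \<and> a < b \<and> b \<le> n}. of_bool (x a < x b) + of_bool (x a + x b < 0) :: nat)"
    by (intro sum.cong) auto
  moreover have "(\<Sum>a\<in>{1..n}. of_bool (?y a < 0)) = of_bool (- x n < 0) + (\<Sum>a\<in>{1..n} - {n}. of_bool (x a < 0) :: nat)"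
    using assms by (subst sum.remove[of _ n]) (auto intro!: sum.cong)
  moreover have "(\<Sum>a\<in>{1..n}. of_bool (x a < 0)) = of_bool (x n < 0) + (\<Sum>a\<in>{1..n} - {n}. of_bool (x a < 0) :: nat)"
    using assms by (subst sum.remove[of _ n]) auto
  ultimately show ?thesis unfolding inversions_def by simp
qed

definition inversions_at_rho :: "nat \<Rightarrow> (weight \<Rightarrow> weight) \<Rightarrow> nat" where
  "inversions_at_rho n w = inversions n (eps_coord n (w rho))"

lemma inversions_simple_reflection:
  assumes i: "i \<in> {1..n}"
  shows "inversions n (eps_coord n (simple_reflection n i \<mu>)) + of_bool (\<mu> i < 0)
    = inversions n (eps_coord n \<mu>) + of_bool (0 < \<mu> i)"
proof (cases "i < n")
  case True
  have "inversions n (eps_coord n (simple_reflection n i \<mu>)) = inversions n (\<lambda>j. eps_coord n \<mu> (adj_swap i j))"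
    using i True by (intro inversions_cong) (simp add: eps_coord_simple_reflection)
  then show ?thesis
    using inversions_swap[of i n "eps_coord n \<mu>"] True i by (simp add: eps_coord_Suc[of i])
next
  case False
  then have [simp]: "i = n" using i by simp
  have "inversions n (eps_coord n (simple_reflection n i \<mu>))
      = inversions n (\<lambda>j. if j = n then - eps_coord n \<mu> n else eps_coord n \<mu> j)"
    using i by (intro inversions_cong) (simp add: eps_coord_simple_reflection)
  then show ?thesis
    using inversions_negate_last[of n "eps_coord n \<mu>"] i by (simp add: eps_coord_last)
qed

lemma word_elt_rho_nonzero:
  assumes "is \<in> lists {1..n}" "i \<in> {1..n}"
  shows "word_elt n is rho i \<noteq> 0"
proof -
  let ?x = "eps_coord n (word_elt n is rho)"
  have s: "signed_perm_of_rho n ?x" by (rule signed_perm_of_rho_word_elt[OF assms(1)])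
  show ?thesis
  proof (cases "i < n")
    case True
    then have "?x i \<noteq> ?x (Suc i)"
      using s assms(2) unfolding signed_perm_of_rho_def
      by (metis Suc_leI atLeastAtMost_iff le_SucI n_not_Suc_n)
    then show ?thesis using True by (simp add: eps_coord_Suc[of i])
  next
    case False
    then have "i = n" using assms(2) by simp
    then show ?thesis
      using s assms(2) eps_coord_last[of n "word_elt n is rho"] unfolding signed_perm_of_rho_def
      by (metis even_zero)
  qed
qed

text \<open>Consecutive coordinates drop by at least 2. Starting from the last one, which is at
  least 1, this bounds them below; starting from the first one, which is at most 2 n - 1, it bounds
  them above by the same values.\<close>

lemma signed_perm_of_rho_dominant:
  assumes s: "signed_perm_of_rho n (eps_coord n \<mu>)" and pos: "\<And>i. i \<in> {1..n} \<Longrightarrow> \<mu> i > 0" and j: "j \<in> {1..n}"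
  shows "eps_coord n \<mu> j = eps_coord n rho j"
proof -
  have step: "eps_coord n \<mu> a \<ge> eps_coord n \<mu> (Suc a) + 2" if "1 \<le> a" "a < n" for a
    using pos[of a] that by (simp add: eps_coord_Suc[of a])
  have "j \<le> n" using j by simp
  then have lower: "1 \<le> j \<longrightarrow> eps_coord n \<mu> j \<ge> 2 * int (n - j) + 1"
  proof (induction rule: inc_induct)
    case base
    then show ?case using pos[of n] by (auto simp: eps_coord_last)
  next
    case (step m)
    then show ?case using \<open>\<And>a. 1 \<le> a \<Longrightarrow> a < n \<Longrightarrow> _\<close>[of m] by (auto simp: of_nat_diff)
  qed
  have "1 \<le> j" using j by simp
  then have "j \<le> n \<longrightarrow> eps_coord n \<mu> j \<le> 2 * int (n - j) + 1"
  proof (induction rule: dec_induct)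
    case base
    have "n \<ge> 1" using j by auto
    then have "\<bar>eps_coord n \<mu> 1\<bar> \<le> 2 * int n - 1"
      using s unfolding signed_perm_of_rho_def by auto
    then show ?case using \<open>n \<ge> 1\<close> by (simp add: of_nat_diff)
  next
    case (step m)
    then show ?case using \<open>\<And>a. 1 \<le> a \<Longrightarrow> a < n \<Longrightarrow> _\<close>[of m] by (auto simp: of_nat_diff)
  qed
  then show ?thesis using lower j by (simp add: eps_coord_rho)
qed

lemma weyl_groupE:
  assumes "w \<in> weyl_group n"
  obtains "is" where "is \<in> lists {1..n}" "w = word_elt n is"
  using assms unfolding weyl_group_def by auto

lemma word_elt_mem_weyl_group: "is \<in> lists {1..n} \<Longrightarrow> word_elt n is \<in> weyl_group n"
  unfolding weyl_group_def by (rule imageI)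

lemma simple_reflection_comp_weyl_group:
  assumes "w \<in> weyl_group n" "i \<in> {1..n}"
  shows "simple_reflection n i \<circ> w \<in> weyl_group n"
proof -
  obtain "is" where "is \<in> lists {1..n}" "w = word_elt n is" using assms(1) by (rule weyl_groupE)
  then show ?thesis
    unfolding weyl_group_def using assms(2) by (intro image_eqI[of _ _ "i # is"]) auto
qed

text \<open>\<rho> has no inversions, and each letter adds at most one.\<close>

lemma inversions_at_rho_le_length:
  "is \<in> lists {1..n} \<Longrightarrow> inversions_at_rho n (word_elt n is) \<le> length is"
proof (induction "is")
  case Nil
  have "(\<Sum>(a, b)\<in>{(a, b). 1 \<le> a \<and> a < b \<and> b \<le> n}. of_bool (eps_coord n rho a < eps_coord n rho b)
      + of_bool (eps_coord n rho a + eps_coord n rho b < 0)) = (0 :: nat)"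
    by (intro sum.neutral) (auto simp: eps_coord_rho)
  moreover have "(\<Sum>a\<in>{1..n}. of_bool (eps_coord n rho a < 0)) = (0 :: nat)"
    by (intro sum.neutral) (auto simp: eps_coord_rho)
  ultimately show ?case by (simp add: inversions_at_rho_def inversions_def)
next
  case (Cons i "is")
  then show ?case
    using inversions_simple_reflection[of i n "word_elt n is rho"]
    by (auto simp: inversions_at_rho_def of_bool_def split: if_splits)
qed

text \<open>If w \<rho> has a negative coordinate, the corresponding reflection removes an
  inversion. Otherwise w \<rho> is dominant, hence equal to \<rho>, and w is the identity.\<close>

lemma exists_word_of_length_inversions:
  assumes "w \<in> weyl_group n"
  shows "\<exists>is \<in> lists {1..n}. word_elt n is = w \<and> length is = inversions_at_rho n w"
  using assms
proof (induction "inversions_at_rho n w" arbitrary: w rule: less_induct)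
  case (less w)
  obtain js where js: "js \<in> lists {1..n}" "w = word_elt n js" using less.prems by (rule weyl_groupE)
  show ?case
  proof (cases "\<exists>i\<in>{1..n}. w rho i < 0")
    case True
    then obtain i where i: "i \<in> {1..n}" "w rho i < 0" by blast
    let ?v = "simple_reflection n i \<circ> w"
    have len: "Suc (inversions_at_rho n ?v) = inversions_at_rho n w"
      using inversions_simple_reflection[OF i(1), of "w rho"] i(2) by (simp add: inversions_at_rho_def)
    then obtain "is" where "is": "is \<in> lists {1..n}" "word_elt n is = ?v" "length is = inversions_at_rho n ?v"
      using less.hyps[of ?v] simple_reflection_comp_weyl_group[OF less.prems i(1)] by auto
    have "word_elt n (i # is) = w"
      by (rule ext) (simp add: "is"(2) simple_reflection_involution[OF i(1)])
    then show ?thesis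
      using "is" i len by (intro bexI[of _ "i # is"]) auto
  next
    case False
    have "w rho i > 0" if "i \<in> {1..n}" for i
      using False that word_elt_rho_nonzero[OF js(1) that] js(2) by (metis linorder_neqE)
    then have "eps_coord n (word_elt n js rho) a = eps_coord n (word_elt n [] rho) a" if "a \<in> {1..n}" for a
      using signed_perm_of_rho_dominant[OF signed_perm_of_rho_word_elt[OF js(1)] _ that] js(2) by simp
    then have w: "w = word_elt n []"
      unfolding js(2) by (intro word_elt_eqI js(1)) auto
    show ?thesis
      using inversions_at_rho_le_length[of "[]" n] by (intro bexI[of _ "[]"]) (auto simp: w simp del: word_elt_Nil)
  qed
qed

lemma weyl_length_eq_inversions:
  assumes "w \<in> weyl_group n"
  shows "weyl_length n w = inversions_at_rho n w"
  unfolding weyl_length_def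
proof (rule Least_equality)
  show "\<exists>is\<in>lists {1..n}. word_elt n is = w \<and> length is = inversions_at_rho n w"
    by (rule exists_word_of_length_inversions[OF assms])
  show "inversions_at_rho n w \<le> l" if "\<exists>is\<in>lists {1..n}. word_elt n is = w \<and> length is = l" for l
    using that inversions_at_rho_le_length by blast
qed

lemma reduced_word_exists:
  assumes "w \<in> weyl_group n"
  shows "reduced_word n w (SOME is. reduced_word n w is)"
  using exists_word_of_length_inversions[OF assms] weyl_length_eq_inversions[OF assms]
  by (intro someI_ex[of "reduced_word n w"]) (auto simp: reduced_word_def)

text \<open>The lift of the identity in the minor is also defined by a choice of word; length zero
  leaves only the empty one.\<close>

lemma reduced_word_id: "(SOME is. reduced_word n id is) = []"
proof -
  have id: "id \<in> weyl_group n"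
    unfolding weyl_group_def by (intro image_eqI[of _ _ "[]"]) auto
  have "inversions_at_rho n id = 0"
    using inversions_at_rho_le_length[of "[]" n] by simp
  then show ?thesis
    using reduced_word_exists[OF id] by (simp add: reduced_word_def weyl_length_eq_inversions[OF id])
qed

text \<open>Along a reduced word, every letter has to create an inversion.\<close>

lemma reduced_word_Cons:
  assumes "reduced_word n w (i # is)"
  shows "reduced_word n (word_elt n is) is" "word_elt n is rho i > 0" "i \<in> {1..n}"
proof -
  have l: "is \<in> lists {1..n}" "i \<in> {1..n}" and w: "w = word_elt n (i # is)"
    and len: "Suc (length is) = weyl_length n w"
    using assms by (auto simp: reduced_word_def)
  have W: "word_elt n is \<in> weyl_group n" "w \<in> weyl_group n"
    unfolding w using l by (simp_all only: word_elt_mem_weyl_group lists.Cons)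
  have "inversions_at_rho n w + of_bool (word_elt n is rho i < 0)
      = inversions_at_rho n (word_elt n is) + of_bool (word_elt n is rho i > 0)"
    using inversions_simple_reflection[OF l(2), of "word_elt n is rho"] by (simp add: inversions_at_rho_def w)
  moreover have "inversions_at_rho n (word_elt n is) \<le> length is"
    by (rule inversions_at_rho_le_length[OF l(1)])
  moreover have "Suc (length is) = inversions_at_rho n w"
    using len weyl_length_eq_inversions[OF W(2)] by simp
  ultimately show "reduced_word n (word_elt n is) is" "word_elt n is rho i > 0"
    using l weyl_length_eq_inversions[OF W(1)] by (auto simp: reduced_word_def of_bool_def split: if_splits)
  show "i \<in> {1..n}" by fact
qed

section \<open>The longest element\<close>

lemma inversions_at_rho_bounded:
  "inversions_at_rho n w \<le> 2 * card {(a, b). 1 \<le> a \<and> a < b \<and> b \<le> n} + n"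
proof -
  let ?T = "{(a, b). 1 \<le> a \<and> a < b \<and> b \<le> n}"
  have "(\<Sum>(a, b)\<in>?T. of_bool (x a < x b) + of_bool (x a + x b < 0) :: nat) \<le> (\<Sum>p\<in>?T. 2)" for x :: "nat \<Rightarrow> int"
    by (intro sum_mono) (auto simp: of_bool_def)
  moreover have "(\<Sum>a\<in>{1..n}. of_bool (x a < 0) :: nat) \<le> (\<Sum>a\<in>{1..n}. 1)" for x :: "nat \<Rightarrow> int"
    by (intro sum_mono) (auto simp: of_bool_def)
  ultimately show ?thesis
    unfolding inversions_at_rho_def inversions_def by (intro add_mono) (force simp: mult.commute)+
qed

text \<open>At maximal length no reflection adds an inversion, so w \<rho> is negative at every h_i.
  Then - w \<rho> is dominant and still a signed permutation of \<rho>, so it is \<rho>.\<close>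

lemma maximal_length_eps_coord:
  assumes "w \<in> weyl_group n" "\<And>v. v \<in> weyl_group n \<Longrightarrow> weyl_length n v \<le> weyl_length n w" "j \<in> {1..n}"
  shows "eps_coord n (w rho) j = - eps_coord n rho j"
proof -
  obtain js where js: "js \<in> lists {1..n}" "w = word_elt n js" using assms(1) by (rule weyl_groupE)
  have neg: "w rho i < 0" if i: "i \<in> {1..n}" for i
  proof (rule ccontr)
    assume "\<not> ?thesis"
    then have "w rho i > 0" using word_elt_rho_nonzero[OF js(1) i] js(2) by (metis linorder_neqE)
    then have "inversions_at_rho n (simple_reflection n i \<circ> w) = Suc (inversions_at_rho n w)"
      using inversions_simple_reflection[OF i, of "w rho"] by (simp add: inversions_at_rho_def)
    then show False
      using assms(2)[of "simple_reflection n i \<circ> w"] simple_reflection_comp_weyl_group[OF assms(1) i]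
        weyl_length_eq_inversions assms(1) by (metis Suc_n_not_le_n)
  qed
  have eq: "eps_coord n (\<lambda>j. - w rho j) a = - eps_coord n (w rho) a" for a
    by (simp add: eps_coord_def sum_negf)
  have "signed_perm_of_rho n (eps_coord n (\<lambda>j. - w rho j))"
    using signed_perm_of_rho_word_elt[OF js(1)] unfolding js(2)[symmetric] signed_perm_of_rho_def eq by simp
  from signed_perm_of_rho_dominant[OF this _ assms(3)] neg show ?thesis by (simp add: eq)
qed

lemma longest_elt:
  "longest_elt n \<in> weyl_group n"
  "\<forall>j \<in> {1..n}. eps_coord n (longest_elt n rho) j = - eps_coord n rho j"
proof -
  let ?P = "\<lambda>w. w \<in> weyl_group n \<and> (\<forall>v \<in> weyl_group n. weyl_length n v \<le> weyl_length n w)"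
  have "word_elt n [] \<in> weyl_group n" unfolding weyl_group_def by blast
  \<comment> \<open>A bound on the lengths yields a maximal one without an enumeration of the Weyl
    group.\<close>
  moreover have "weyl_length n v < Suc (2 * card {(a, b). 1 \<le> a \<and> a < b \<and> b \<le> n} + n)"
    if "v \<in> weyl_group n" for v
    using inversions_at_rho_bounded[of n v] that by (simp add: weyl_length_eq_inversions)
  ultimately have "\<exists>w. w \<in> weyl_group n \<and> (\<forall>v. v \<in> weyl_group n \<longrightarrow> weyl_length n v \<le> weyl_length n w)"
    by (intro Lattices_Big.ex_has_greatest_nat[of "\<lambda>w. w \<in> weyl_group n"]) auto
  then obtain w where w: "?P w" by blast
  have "v = w" if "?P v" for v
  proof -
    have "v \<in> weyl_group n" using that by simp
    then obtain "is" where "is": "is \<in> lists {1..n}" "v = word_elt n is"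
      by (rule weyl_groupE)
    have "w \<in> weyl_group n" using w by simp
    then obtain js where js: "js \<in> lists {1..n}" "w = word_elt n js"
      by (rule weyl_groupE)
    have "eps_coord n (v rho) a = eps_coord n (w rho) a" if "a \<in> {1..n}" for a
      using maximal_length_eps_coord[of v n a] maximal_length_eps_coord[of w n a] w \<open>?P v\<close> that by simp
    then show ?thesis
      unfolding "is"(2) js(2) using "is"(1) js(1) by (intro word_elt_eqI) auto
  qed
  with w have P: "?P (longest_elt n)"
    unfolding longest_elt_def by (rule theI)
  then show "longest_elt n \<in> weyl_group n" by simp
  from P show "\<forall>j \<in> {1..n}. eps_coord n (longest_elt n rho) j = - eps_coord n rho j"
    using maximal_length_eps_coord by simp
qed

text \<open>In type B the longest element is - 1: it is so at \<rho>, and the odd function of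
  \<open>word_elt_eqI\<close> carries this to every weight.\<close>

lemma eps_coord_longest_elt:
  assumes j: "j \<in> {1..n}"
  shows "eps_coord n (longest_elt n \<mu>) j = - eps_coord n \<mu> j"
proof -
  obtain "is" where "is": "is \<in> lists {1..n}" "longest_elt n = word_elt n is"
    using longest_elt(1) by (rule weyl_groupE)
  define \<phi> where "\<phi> z = sgn z * eps_coord n \<mu> (nat ((2 * int n + 1 - \<bar>z\<bar>) div 2))" for z :: int
  have odd: "\<phi> (- z) = - \<phi> z" for z by (simp add: \<phi>_def sgn_minus)
  have \<phi>: "eps_coord n \<mu> a = \<phi> (eps_coord n rho a)" if "a \<in> {1..n}" for a
    using that by (simp add: \<phi>_def eps_coord_rho of_nat_diff)
  have "eps_coord n (longest_elt n \<mu>) j = \<phi> (eps_coord n (longest_elt n rho) j)"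
    unfolding "is"(2) using eps_coord_word_elt_odd[of \<phi>, OF odd "is"(1) \<phi> j] .
  also have "\<dots> = - eps_coord n \<mu> j"
    using bspec[OF longest_elt(2) j] \<phi>[OF j] odd by simp
  finally show ?thesis .
qed

section \<open>The vector representation\<close>

text \<open>Generators are kept as syntax, so that one word can be evaluated both in G and on the
  vector representation.\<close>

datatype letter = Pos nat complex | Neg nat complex | Tor nat complex

text \<open>The action of \<open>x\<^sub>i(t)\<close>, \<open>y\<^sub>i(t)\<close> and \<open>\<alpha>\<^sub>i\<^sup>\<or>(t)\<close> on the vector representation, of dimension
  \<open>2 n + 1\<close>. Vectors are functions on the indices \<open>1, \<dots>, 2 n + 1\<close>; the index \<open>2 n + 2 - j\<close> has
  the weight opposite to that of \<open>j\<close>.\<close>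

fun vec_op :: "nat \<Rightarrow> letter \<Rightarrow> (nat \<Rightarrow> complex) \<Rightarrow> nat \<Rightarrow> complex" where
  "vec_op n (Pos i t) \<phi> =
     (if i < n then (\<lambda>j. if j = i then \<phi> j + t * \<phi> (i + 1)
        else if j = 2 * n + 1 - i then \<phi> j + t * \<phi> (2 * n + 2 - i) else \<phi> j)
      else (\<lambda>j. if j = n then \<phi> j + 2 * t * \<phi> (n + 1) + t\<^sup>2 * \<phi> (n + 2)
        else if j = n + 1 then \<phi> j + t * \<phi> (n + 2) else \<phi> j))"
| "vec_op n (Neg i t) \<phi> =
     (if i < n then (\<lambda>j. if j = i + 1 then \<phi> j + t * \<phi> i
        else if j = 2 * n + 2 - i then \<phi> j + t * \<phi> (2 * n + 1 - i) else \<phi> j)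
      else (\<lambda>j. if j = n + 1 then \<phi> j + t * \<phi> n
        else if j = n + 2 then \<phi> j + 2 * t * \<phi> (n + 1) + t\<^sup>2 * \<phi> n else \<phi> j))"
| "vec_op n (Tor i t) \<phi> =
     (if i < n then (\<lambda>j. if j = i \<or> j = 2 * n + 1 - i then t * \<phi> j
        else if j = i + 1 \<or> j = 2 * n + 2 - i then \<phi> j / t else \<phi> j)
      else (\<lambda>j. if j = n then t\<^sup>2 * \<phi> j else if j = n + 2 then \<phi> j / t\<^sup>2 else \<phi> j))"

text \<open>These are the coordinates of x(s) y(t) = y(t/q) \<alpha>(q) x(s/q) on the
  representations of dimension two (the first two identities) and three (the last three); r stands
  for 1 / q.\<close>

lemma sl2_vector_identities:
  fixes a b d s t q r :: complex
  assumes "q = 1 + s * t" "q * r = 1"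
  shows "a + s * (b + t * a) = q * (a + s * r * b)"
    "b + t * a = b * r + t * r * (q * (a + s * r * b))"
    "a + 2 * s * (b + t * a) + s\<^sup>2 * (d + 2 * t * b + t\<^sup>2 * a)
      = q\<^sup>2 * (a + 2 * (s * r) * b + (s * r)\<^sup>2 * d)"
    "b + t * a + s * (d + 2 * t * b + t\<^sup>2 * a)
      = b + s * r * d + t * r * (q\<^sup>2 * (a + 2 * (s * r) * b + (s * r)\<^sup>2 * d))"
    "d + 2 * t * b + t\<^sup>2 * a = d * r\<^sup>2 + 2 * (t * r) * (b + s * r * d)
      + (t * r)\<^sup>2 * (q\<^sup>2 * (a + 2 * (s * r) * b + (s * r)\<^sup>2 * d))"
proof -
  have q: "q \<noteq> 0" and r: "r = inverse q"
    using assms(2) by (auto simp: inverse_unique)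
  \<comment> \<open>Writing b = q B and d = q^2 D clears the denominators and leaves polynomial
    identities in s and t.\<close>
  define B D where "B = r * b" and "D = r\<^sup>2 * d"
  have b: "b = q * B" and d: "d = q * (q * D)"
    using q by (simp_all add: B_def D_def r power2_eq_square field_simps)
  have r: "x * r * (q * y) = x * y" "2 * (x * r) * (q * y) = 2 * x * y" "q * y * r = y"
    "(x * r)\<^sup>2 * (q * (q * y)) = x\<^sup>2 * y" "x * r * (q\<^sup>2 * y) = x * (q * y)"
    "q * (q * y) * r\<^sup>2 = y" "(x * r)\<^sup>2 * (q\<^sup>2 * y) = x\<^sup>2 * y"
    "2 * (x * r) * (q * y + z * (q * w)) = 2 * x * (y + z * w)" for x y z w
    using q by (simp_all add: r power2_eq_square field_simps)
  show "a + s * (b + t * a) = q * (a + s * r * b)"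
    "b + t * a = b * r + t * r * (q * (a + s * r * b))"
    "a + 2 * s * (b + t * a) + s\<^sup>2 * (d + 2 * t * b + t\<^sup>2 * a)
      = q\<^sup>2 * (a + 2 * (s * r) * b + (s * r)\<^sup>2 * d)"
    "b + t * a + s * (d + 2 * t * b + t\<^sup>2 * a)
      = b + s * r * d + t * r * (q\<^sup>2 * (a + 2 * (s * r) * b + (s * r)\<^sup>2 * d))"
    "d + 2 * t * b + t\<^sup>2 * a = d * r\<^sup>2 + 2 * (t * r) * (b + s * r * d)
      + (t * r)\<^sup>2 * (q\<^sup>2 * (a + 2 * (s * r) * b + (s * r)\<^sup>2 * d))"
    unfolding b d unfolding r unfolding assms(1) by (simp_all add: algebra_simps power2_eq_square)
qed

lemma vec_op_Pos_Neg_same: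
  assumes i: "i \<in> {1..n}" and nz: "1 + s * t \<noteq> 0"
  shows "vec_op n (Pos i s) (vec_op n (Neg i t) \<phi>)
    = vec_op n (Neg i (t / (1 + s * t))) (vec_op n (Tor i (1 + s * t)) (vec_op n (Pos i (s / (1 + s * t))) \<phi>))"
proof -
  define q r where "q = 1 + s * t" and "r = inverse q"
  have q: "q = 1 + s * t" "q * r = 1" using nz by (auto simp: q_def r_def)
  note ids = sl2_vector_identities[OF q]
  have div: "x / (1 + s * t) = x * r" "x / (1 + s * t)\<^sup>2 = x * r\<^sup>2" for x
    by (simp_all add: r_def q_def field_simps)
  show ?thesis
  proof (cases "i < n")
    case True
    define j j' where "j = 2 * n + 1 - i" and "j' = 2 * n + 2 - i"
    have d: "i \<noteq> j" "i \<noteq> j'" "Suc i \<noteq> j" "Suc i \<noteq> j'" "j \<noteq> j'"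
      using True by (auto simp: j_def j'_def)
    have s: "vec_op n (Pos i s) \<phi> = \<phi>(i := \<phi> i + s * \<phi> (Suc i), j := \<phi> j + s * \<phi> j')"
      "vec_op n (Neg i s) \<phi> = \<phi>(Suc i := \<phi> (Suc i) + s * \<phi> i, j' := \<phi> j' + s * \<phi> j)"
      "vec_op n (Tor i s) \<phi> = \<phi>(i := s * \<phi> i, Suc i := \<phi> (Suc i) / s, j := s * \<phi> j, j' := \<phi> j' / s)" for \<phi> s
      using True d by (auto simp: fun_eq_iff j_def j'_def)
    show ?thesis
      unfolding s unfolding div unfolding q_def[symmetric]
      using d d[symmetric] ids(1,2) by (auto simp: fun_eq_iff)
  next
    case False
    then have [simp]: "i = n" using i by simp
    have s: "vec_op n (Pos n s) \<phi> = \<phi>(n := \<phi> n + 2 * s * \<phi> (n + 1) + s\<^sup>2 * \<phi> (n + 2), n + 1 := \<phi> (n + 1) + s * \<phi> (n + 2))"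
      "vec_op n (Neg n s) \<phi> = \<phi>(n + 1 := \<phi> (n + 1) + s * \<phi> n, n + 2 := \<phi> (n + 2) + 2 * s * \<phi> (n + 1) + s\<^sup>2 * \<phi> n)"
      "vec_op n (Tor n s) \<phi> = \<phi>(n := s\<^sup>2 * \<phi> n, n + 2 := \<phi> (n + 2) / s\<^sup>2)" for \<phi> s
      by (auto simp: fun_eq_iff)
    show ?thesis
      unfolding \<open>i = n\<close> unfolding s unfolding div unfolding q_def[symmetric]
      using ids(3-5) by (auto simp: fun_eq_iff)
  qed
qed

text \<open>For i < n the two planes with indices i, i + 1 and p, p + 1 are disjoint. With p as a
  variable, index comparisons become linear arithmetic without subtraction.\<close>

lemma vec_op_less:
  assumes "i < n"
  obtains p where "p + i = 2 * n + 1"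
    "\<And>s \<phi>. vec_op n (Pos i s) \<phi> = \<phi>(i := \<phi> i + s * \<phi> (Suc i), p := \<phi> p + s * \<phi> (Suc p))"
    "\<And>s \<phi>. vec_op n (Neg i s) \<phi> = \<phi>(Suc i := \<phi> (Suc i) + s * \<phi> i, Suc p := \<phi> (Suc p) + s * \<phi> p)"
proof
  define p where "p = 2 * n + 1 - i"
  show "p + i = 2 * n + 1" using assms by (simp add: p_def)
  have d: "i \<noteq> p" "Suc i \<noteq> Suc p" "2 * n + 2 - i = Suc p" using assms by (auto simp: p_def)
  show "vec_op n (Pos i s) \<phi> = \<phi>(i := \<phi> i + s * \<phi> (Suc i), p := \<phi> p + s * \<phi> (Suc p))" for s \<phi>
    using assms d unfolding vec_op.simps p_def[symmetric] by (auto simp: fun_eq_iff)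
  show "vec_op n (Neg i s) \<phi> = \<phi>(Suc i := \<phi> (Suc i) + s * \<phi> i, Suc p := \<phi> (Suc p) + s * \<phi> p)" for s \<phi>
    using assms d unfolding vec_op.simps p_def[symmetric] by (auto simp: fun_eq_iff)
qed

text \<open>The indices n, n + 1, n + 2 carry the three-dimensional representation of the short root
  subgroup, hence the quadratic terms; the basis is scaled so that no square roots occur.\<close>

lemma vec_op_last:
  "vec_op n (Pos n s) \<phi> = \<phi>(n := \<phi> n + 2 * s * \<phi> (n + 1) + s\<^sup>2 * \<phi> (n + 2), n + 1 := \<phi> (n + 1) + s * \<phi> (n + 2))"
  "vec_op n (Neg n s) \<phi> = \<phi>(n + 1 := \<phi> (n + 1) + s * \<phi> n, n + 2 := \<phi> (n + 2) + 2 * s * \<phi> (n + 1) + s\<^sup>2 * \<phi> n)"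
  by (auto simp: fun_eq_iff)

text \<open>Each operator adds multiples of some entries to others, and neither changes an entry
  whose value the other one adds.\<close>

lemma vec_op_Pos_Neg_distinct:
  assumes "i \<in> {1..n}" "j \<in> {1..n}" "i \<noteq> j"
  shows "vec_op n (Pos i s) (vec_op n (Neg j t) \<phi>) = vec_op n (Neg j t) (vec_op n (Pos i s) \<phi>)"
proof -
  consider "i < n" "j < n" | "i < n" "j = n" | "i = n" "j < n" using assms by fastforce
  then show ?thesis
  proof cases
    case 1
    obtain p where p: "p + i = 2 * n + 1"
      "\<And>s \<phi>. vec_op n (Pos i s) \<phi> = \<phi>(i := \<phi> i + s * \<phi> (Suc i), p := \<phi> p + s * \<phi> (Suc p))"
      using vec_op_less[OF 1(1)] by metis
    obtain r where r: "r + j = 2 * n + 1"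
      "\<And>s \<phi>. vec_op n (Neg j s) \<phi> = \<phi>(Suc j := \<phi> (Suc j) + s * \<phi> j, Suc r := \<phi> (Suc r) + s * \<phi> r)"
      using vec_op_less[OF 1(2)] by metis
    have "i \<noteq> p" "i \<noteq> r" "i \<noteq> Suc r" "Suc i \<noteq> p" "Suc i \<noteq> r" "j \<noteq> p" "j \<noteq> Suc p" "Suc j \<noteq> p" "Suc j \<noteq> r" "j \<noteq> r"
      "p \<noteq> r" "i \<noteq> j"
      using 1 p(1) r(1) assms(3) by linarith+
    note d = this this[symmetric]
    show ?thesis unfolding p(2) r(2) by (auto simp: fun_eq_iff d)
  next
    case 2
    obtain p where p: "p + i = 2 * n + 1"
      "\<And>s \<phi>. vec_op n (Pos i s) \<phi> = \<phi>(i := \<phi> i + s * \<phi> (Suc i), p := \<phi> p + s * \<phi> (Suc p))"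
      using vec_op_less[OF 2(1)] by metis
    have "i \<noteq> p" "Suc i \<noteq> p" "i \<noteq> n" "i \<noteq> Suc n" "i \<noteq> Suc (Suc n)" "Suc i \<noteq> Suc n" "Suc i \<noteq> Suc (Suc n)" "p \<noteq> n" "p \<noteq> Suc n"
      "Suc p \<noteq> Suc n" "Suc p \<noteq> Suc (Suc n)" "Suc p \<noteq> n"
      using 2 p(1) by linarith+
    note d = this this[symmetric]
    show ?thesis unfolding p(2) 2(2) vec_op_last by (auto simp: fun_eq_iff d)
  next
    case 3
    obtain r where r: "r + j = 2 * n + 1"
      "\<And>s \<phi>. vec_op n (Neg j s) \<phi> = \<phi>(Suc j := \<phi> (Suc j) + s * \<phi> j, Suc r := \<phi> (Suc r) + s * \<phi> r)"
      using vec_op_less[OF 3(2)] by metis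
    have "j \<noteq> r" "Suc j \<noteq> r" "j \<noteq> n" "j \<noteq> Suc n" "j \<noteq> Suc (Suc n)" "Suc j \<noteq> Suc n" "Suc j \<noteq> Suc (Suc n)" "r \<noteq> n" "r \<noteq> Suc n"
      "Suc r \<noteq> n" "Suc r \<noteq> Suc n" "Suc r \<noteq> Suc (Suc n)" "j \<noteq> Suc r"
      using 3 r(1) by linarith+
    note d = this this[symmetric]
    show ?thesis unfolding r(2) 3(1) vec_op_last by (auto simp: fun_eq_iff d)
  qed
qed

lemma cartan_B_cases:
  assumes "i \<in> {1..n}" "j \<in> {1..n}"
  obtains "i = j" "cartan_B n i j = 2" | "i = n" "n = Suc j" "cartan_B n i j = - 2"
    | "i < n" "i = Suc j" "cartan_B n i j = - 1" | "j = Suc i" "cartan_B n i j = - 1"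
    | "i \<noteq> j" "i \<noteq> Suc j" "j \<noteq> Suc i" "cartan_B n i j = 0"
proof -
  have "cartan_B n i j = (if i = j then 2 else if i = n \<and> n = Suc j then - 2
      else if i = Suc j \<or> j = Suc i then - 1 else 0)"
    using assms unfolding cartan_B_def by auto
  then show ?thesis
    using that assms by (cases "i = n") (auto split: if_splits)
qed

definition torus_weight :: "nat \<Rightarrow> nat \<Rightarrow> complex \<Rightarrow> nat \<Rightarrow> complex" where
  "torus_weight n i c j =
     (if i < n then if j = i \<or> j = 2 * n + 1 - i then c else if j = i + 1 \<or> j = 2 * n + 2 - i then 1 / c else 1
      else if j = n then c\<^sup>2 else if j = n + 2 then 1 / c\<^sup>2 else 1)"

lemma vec_op_Tor: "vec_op n (Tor i c) \<phi> = (\<lambda>j. torus_weight n i c j * \<phi> j)"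
  by (auto simp: fun_eq_iff torus_weight_def)

text \<open>The weights at j and j + 1 differ by \<alpha>_j, and so do those at p and p + 1. The
  eigenvalues of the coroot therefore differ by the factor c^(-a_ij), which yields the relations
  with y_j and with x_j alike.\<close>

lemma torus_weight_ratio:
  assumes "i \<in> {1..n}" "j \<in> {1..n}" "c \<noteq> 0"
  shows "torus_weight n i c (Suc j) = c powi (- cartan_B n i j) * torus_weight n i c j"
    "p + j = 2 * n + 1 \<Longrightarrow> torus_weight n i c (Suc p) = c powi (- cartan_B n i j) * torus_weight n i c p"
proof -
  have bounds: "1 \<le> i" "i \<le> n" "1 \<le> j" "j \<le> n" using assms by auto
  define u where "u = c powi (- cartan_B n i j)"
  have "torus_weight n i c (Suc j) = u * torus_weight n i c j \<and>
    (p + j = 2 * n + 1 \<longrightarrow> torus_weight n i c (Suc p) = u * torus_weight n i c p)"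
  proof (cases "i < n")
    case True
    define r where "r = 2 * n + 1 - i"
    have r: "r + i = 2 * n + 1" using True by (simp add: r_def)
    have w: "torus_weight n i c m = (if m = i \<or> m = r then c else if m = Suc i \<or> m = Suc r then 1 / c else 1)" for m
      using True by (simp add: torus_weight_def r_def Suc_diff_le)
    show ?thesis
    proof (cases rule: cartan_B_cases[OF assms(1,2)])
      case 1
      have u: "u = 1 / c\<^sup>2" unfolding u_def 1(2) by (simp add: power_int_minus inverse_eq_divide)
      have "i < r" "Suc i < r" "p + j = 2 * n + 1 \<Longrightarrow> p = r" using r 1 True by linarith+
      then show ?thesis using assms(3) u 1(1)[symmetric] by (auto simp: w field_simps power2_eq_square)
    next
      case 2
      then show ?thesis using True by simp
    next
      case 3
      have u: "u = c" unfolding u_def 3(3) by simp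
      have "j < r" "i < r" "j < i" "p + j = 2 * n + 1 \<Longrightarrow> p = Suc r" using r 3 True bounds by linarith+
      then show ?thesis using assms(3) 3(2)[symmetric] u by (auto simp: w)
    next
      case 4
      have u: "u = c" unfolding u_def 4(2) by simp
      have "i < r" "j < r" "Suc j < Suc r" "Suc j \<noteq> r" "p + j = 2 * n + 1 \<Longrightarrow> r = Suc p"
        "p + j = 2 * n + 1 \<Longrightarrow> p \<noteq> i" "p + j = 2 * n + 1 \<Longrightarrow> p \<noteq> Suc i"
        using r 4 True bounds by linarith+
      then show ?thesis using assms(3) r 4(1) u by (auto simp: w)
    next
      case 5
      have "j \<noteq> r" "j \<noteq> Suc r" "Suc j \<noteq> r" "p + j = 2 * n + 1 \<Longrightarrow> p \<noteq> r"
        "p + j = 2 * n + 1 \<Longrightarrow> p \<noteq> Suc r" "p + j = 2 * n + 1 \<Longrightarrow> Suc p \<noteq> r"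
        "p + j = 2 * n + 1 \<Longrightarrow> p \<noteq> i" "p + j = 2 * n + 1 \<Longrightarrow> p \<noteq> Suc i" "p + j = 2 * n + 1 \<Longrightarrow> Suc p \<noteq> i"
        using r 5(1-3) True bounds by linarith+
      then show ?thesis using 5(1-3) by (simp add: u_def 5(4) w)
    qed
  next
    case False
    then have [simp]: "i = n" using bounds by simp
    have w: "torus_weight n n c m = (if m = n then c\<^sup>2 else if m = Suc (Suc n) then 1 / c\<^sup>2 else 1)" for m
      by (simp add: torus_weight_def)
    show ?thesis
    proof (cases rule: cartan_B_cases[OF assms(1,2)])
      case 1
      have u: "u = 1 / c\<^sup>2" unfolding u_def 1(2) by (simp add: power_int_minus inverse_eq_divide)
      have "p + j = 2 * n + 1 \<Longrightarrow> p = Suc n" using 1 by simp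
      then show ?thesis using assms(3) 1(1)[symmetric] u by (auto simp: w)
    next
      case 2
      have u: "u = c\<^sup>2" unfolding u_def 2(3) by simp
      have "p + j = 2 * n + 1 \<Longrightarrow> p = Suc (Suc n)" "j \<noteq> n" "Suc j = n" "j \<noteq> Suc (Suc n)"
        using 2(1,2) by simp_all
      then show ?thesis using assms(3) u by (auto simp: w)
    next
      case 3
      then show ?thesis by simp
    next
      case 4
      then show ?thesis using bounds by simp
    next
      case 5
      then have "j + 1 < n" using bounds by simp
      then have "j \<noteq> n" "Suc j \<noteq> n" "p + j = 2 * n + 1 \<Longrightarrow> p > Suc (Suc n)" by linarith+
      moreover have u: "u = 1" unfolding u_def 5(4) by simp
      ultimately show ?thesis using bounds by (auto simp: w)
    qed
  qed
  then show "torus_weight n i c (Suc j) = c powi (- cartan_B n i j) * torus_weight n i c j"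
    "p + j = 2 * n + 1 \<Longrightarrow> torus_weight n i c (Suc p) = c powi (- cartan_B n i j) * torus_weight n i c p"
    unfolding u_def by blast+
qed

lemma vec_op_Tor_Neg:
  assumes "i \<in> {1..n}" "j \<in> {1..n}" "c \<noteq> 0"
  shows "vec_op n (Tor i c) (vec_op n (Neg j t) \<phi>)
    = vec_op n (Neg j (c powi (- cartan_B n i j) * t)) (vec_op n (Tor i c) \<phi>)"
proof -
  let ?w = "torus_weight n i c"
  note ratio = torus_weight_ratio[OF assms]
  show ?thesis
  proof (cases "j < n")
    case True
    obtain p where p: "p + j = 2 * n + 1"
      "\<And>s \<phi>. vec_op n (Neg j s) \<phi> = \<phi>(Suc j := \<phi> (Suc j) + s * \<phi> j, Suc p := \<phi> (Suc p) + s * \<phi> p)"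
      using vec_op_less[OF True] by metis
    show ?thesis
      unfolding vec_op_Tor p(2) by (auto simp: fun_eq_iff ratio(1) ratio(2)[OF p(1)] algebra_simps)
  next
    case False
    then have [simp]: "j = n" using assms by simp
    have "?w (n + 1) = c powi (- cartan_B n i n) * ?w n" "?w (n + 2) = c powi (- cartan_B n i n) * ?w (n + 1)"
      using ratio(1) ratio(2)[of "n + 1"] by simp_all
    then show ?thesis
      unfolding vec_op_Tor \<open>j = n\<close> vec_op_last by (auto simp: fun_eq_iff algebra_simps power2_eq_square)
  qed
qed

lemma vec_op_Pos_Tor:
  assumes "i \<in> {1..n}" "j \<in> {1..n}" "c \<noteq> 0"
  shows "vec_op n (Pos j t) (vec_op n (Tor i c) \<phi>)
    = vec_op n (Tor i c) (vec_op n (Pos j (c powi (- cartan_B n i j) * t)) \<phi>)"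
proof -
  let ?w = "torus_weight n i c"
  note ratio = torus_weight_ratio[OF assms]
  show ?thesis
  proof (cases "j < n")
    case True
    obtain p where p: "p + j = 2 * n + 1"
      "\<And>s \<phi>. vec_op n (Pos j s) \<phi> = \<phi>(j := \<phi> j + s * \<phi> (Suc j), p := \<phi> p + s * \<phi> (Suc p))"
      using vec_op_less[OF True] by metis
    show ?thesis
      unfolding vec_op_Tor p(2) by (auto simp: fun_eq_iff ratio(1) ratio(2)[OF p(1)] algebra_simps)
  next
    case False
    then have [simp]: "j = n" using assms by simp
    have "?w (n + 1) = c powi (- cartan_B n i n) * ?w n" "?w (n + 2) = c powi (- cartan_B n i n) * ?w (n + 1)"
      using ratio(1) ratio(2)[of "n + 1"] by simp_all
    then show ?thesis
      unfolding vec_op_Tor \<open>j = n\<close> vec_op_last by (auto simp: fun_eq_iff algebra_simps power2_eq_square)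
  qed
qed

section \<open>Minors and operators that act on the columns\<close>

abbreviation vec_word :: "nat \<Rightarrow> letter list \<Rightarrow> (nat \<Rightarrow> complex) \<Rightarrow> nat \<Rightarrow> complex" where
  "vec_word n \<equiv> foldr (vec_op n)"

text \<open>The columns are vectors \<Phi> 0, \<Phi> 1, ..., so a group element acts on all of them
  by one operator, while r selects the rows.\<close>

definition row_minor :: "nat \<Rightarrow> (nat \<Rightarrow> nat) \<Rightarrow> (nat \<Rightarrow> nat \<Rightarrow> complex) \<Rightarrow> complex" where
  "row_minor k r \<Phi> = Determinant.det (Matrix.mat k k (\<lambda>(a, b). \<Phi> b (r a)))"

lemma row_minor_cong:
  assumes "\<And>a b. a < k \<Longrightarrow> b < k \<Longrightarrow> \<Phi> b (r a) = \<Psi> b (s a)"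
  shows "row_minor k r \<Phi> = row_minor k s \<Psi>"
  unfolding row_minor_def by (rule arg_cong[of _ _ Determinant.det]) (auto intro!: eq_matI simp: assms)

lemma row_minor_add_row:
  assumes "p < k" "q < k" "p \<noteq> q"
    "\<And>a b. a < k \<Longrightarrow> b < k \<Longrightarrow> \<Psi> b (r a) = \<Phi> b (r a) + (if a = p then t * \<Phi> b (r q) else 0)"
  shows "row_minor k r \<Psi> = row_minor k r \<Phi>"
proof -
  let ?A = "Matrix.mat k k (\<lambda>(a, b). \<Phi> b (r a))"
  have "Matrix.mat k k (\<lambda>(a, b). \<Psi> b (r a)) = addrow t p q ?A"
    using assms by (intro eq_matI) auto
  moreover have "Determinant.det (addrow t p q ?A) = Determinant.det ?A"
    using assms by (intro det_addrow) auto
  ultimately show ?thesis by (simp add: row_minor_def)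
qed

lemma row_minor_mult_row:
  assumes "p < k"
    "\<And>a b. a < k \<Longrightarrow> b < k \<Longrightarrow> \<Psi> b (r a) = (if a = p then t * \<Phi> b (r a) else \<Phi> b (r a))"
  shows "row_minor k r \<Psi> = t * row_minor k r \<Phi>"
proof -
  let ?A = "Matrix.mat k k (\<lambda>(a, b). \<Phi> b (r a))"
  have "Matrix.mat k k (\<lambda>(a, b). \<Psi> b (r a)) = multrow p t ?A"
    using assms by (intro eq_matI) auto
  moreover have "Determinant.det (multrow p t ?A) = t * Determinant.det ?A"
    using assms by (intro det_multrow) auto
  ultimately show ?thesis by (simp add: row_minor_def)
qed

text \<open>Invariance under U^- from the left: within the first k rows y_i is a row operation or
  does nothing. As k < n, the lower plane of y_i is out of reach.\<close>

lemma row_minor_Neg: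
  assumes "k < n" "i \<in> {1..n}"
  shows "row_minor k Suc (\<lambda>b. vec_op n (Neg i t) (\<Phi> b)) = row_minor k Suc \<Phi>"
proof (cases "i < k")
  case True
  \<comment> \<open>Positions start at 0 and rows at 1: row i + 1, to which row i is added, has
    position i.\<close>
  show ?thesis
    by (rule row_minor_add_row[of i k "i - 1" _ _ _ t]) (use assms True in auto)
next
  case False
  then show ?thesis using assms by (intro row_minor_cong) auto
qed

text \<open>For i < k the factors c and 1 / c of rows i and i + 1 cancel; for i = k only the first
  of these rows is present. This is the character \<Lambda>_k; the square in the formula for the
  short coroot does not occur, as k < n.\<close>

lemma row_minor_Tor:
  assumes "k < n" "i \<in> {1..n}" "c \<noteq> 0"
  shows "row_minor k Suc (\<lambda>b. vec_op n (Tor i c) (\<Phi> b)) = (if i = k then c else 1) * row_minor k Suc \<Phi>"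
proof -
  consider "i < k" | "i = k" | "k < i" by linarith
  then show ?thesis
  proof cases
    case 1
    have "row_minor k Suc (\<lambda>b. vec_op n (Tor i c) (\<Phi> b))
        = c * row_minor k Suc (\<lambda>b j. if j = i + 1 then \<Phi> b j / c else \<Phi> b j)"
      using 1 assms by (intro row_minor_mult_row[of "i - 1"]) auto
    also have "row_minor k Suc (\<lambda>b j. if j = i + 1 then \<Phi> b j / c else \<Phi> b j) = 1 / c * row_minor k Suc \<Phi>"
      using 1 assms by (intro row_minor_mult_row[of i]) auto
    finally show ?thesis using 1 assms by simp
  next
    case 2
    then show ?thesis
      using assms by (subst row_minor_mult_row[of "i - 1" k _ _ c \<Phi>]) auto
  next
    case 3
    then show ?thesis using assms by (simp, intro row_minor_cong) auto
  qed
qed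

text \<open>x_i only adds entries of larger index to entries of smaller index.\<close>

lemma vec_op_Pos_vanishing_above:
  assumes "i \<in> {1..n}" "\<And>j. j > m \<Longrightarrow> \<phi> j = 0"
  shows "vec_op n (Pos i t) \<phi> m = \<phi> m"
proof (cases "i < n")
  case True
  then show ?thesis using assms(2)[of "i + 1"] assms(2)[of "2 * n + 2 - i"] by simp
next
  case False
  then show ?thesis using assms(2)[of "n + 1"] assms(2)[of "n + 2"] by simp
qed

lemma vec_word_Pos_unitriangular:
  assumes "\<And>l. l \<in> set v \<Longrightarrow> \<exists>i t. l = Pos i t \<and> i \<in> {1..n}"
    "\<And>j. j > s \<Longrightarrow> \<phi> j = 0" "\<phi> s = 1"
  shows "(\<forall>j>s. vec_word n v \<phi> j = 0) \<and> vec_word n v \<phi> s = 1"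
  using assms(1)
proof (induction v)
  case Nil
  then show ?case using assms by simp
next
  case (Cons l v)
  obtain i t where l: "l = Pos i t" "i \<in> {1..n}" using Cons.prems[of l] by auto
  let ?\<psi> = "vec_word n v \<phi>"
  have IH: "\<forall>j>s. ?\<psi> j = 0" "?\<psi> s = 1" using Cons by simp_all
  have "vec_op n (Pos i t) ?\<psi> m = ?\<psi> m" if "m \<ge> s" for m
    by (rule vec_op_Pos_vanishing_above[OF l(2)]) (use IH(1) that in simp)
  then show ?case using IH by (simp add: l(1) del: vec_op.simps)
qed

definition unit_fun :: "nat \<Rightarrow> nat \<Rightarrow> complex" where
  "unit_fun b = (\<lambda>j. if j = b then 1 else 0)"

definition lead_minor :: "nat \<Rightarrow> nat \<Rightarrow> letter list \<Rightarrow> complex" where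
  "lead_minor n k w = row_minor k Suc (\<lambda>b. vec_word n w (unit_fun (Suc b)))"

lemma lead_minor_Pos:
  assumes "\<And>l. l \<in> set v \<Longrightarrow> \<exists>i t. l = Pos i t \<and> i \<in> {1..n}"
  shows "lead_minor n k v = 1"
proof -
  let ?A = "Matrix.mat k k (\<lambda>(a, b). vec_word n v (unit_fun (Suc b)) (Suc a))"
  have "(\<forall>j>Suc b. vec_word n v (unit_fun (Suc b)) j = 0) \<and> vec_word n v (unit_fun (Suc b)) (Suc b) = 1" for b
    by (rule vec_word_Pos_unitriangular[OF assms]) (auto simp: unit_fun_def)
  then have "upper_triangular ?A" and "prod_list (diag_mat ?A) = 1"
    by (auto simp: upper_triangular_def prod_list_diag_prod)
  then show ?thesis
    unfolding lead_minor_def row_minor_def using det_upper_triangular[of ?A k] by simp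
qed

section \<open>Holomorphy in a single parameter\<close>

lemma holomorphic_vec_op:
  assumes "\<And>j. (\<lambda>s. \<Phi> s j) holomorphic_on A"
  shows "(\<lambda>s. vec_op n l (\<Phi> s) j) holomorphic_on A"
proof (cases l)
  case (Pos i t)
  show ?thesis
    unfolding Pos
    by (cases "i < n"; cases "j = i"; cases "j = 2 * n + 1 - i"; cases "j = n"; cases "j = n + 1"; simp;
        intro holomorphic_intros assms)
next
  case (Neg i t)
  show ?thesis
    unfolding Neg
    by (cases "i < n"; cases "j = i + 1"; cases "j = 2 * n + 2 - i"; cases "j = n + 1"; cases "j = n + 2"; simp;
        intro holomorphic_intros assms)
next
  case (Tor i t)
  show ?thesis unfolding Tor vec_op_Tor by (intro holomorphic_intros assms)
qed

lemma holomorphic_vec_op_Pos: "(\<lambda>s. vec_op n (Pos i s) \<phi> j) holomorphic_on A"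
  by (cases "i < n"; cases "j = i"; cases "j = 2 * n + 1 - i"; cases "j = n"; cases "j = n + 1"; simp;
      intro holomorphic_intros)

lemma holomorphic_vec_word:
  "(\<lambda>s. vec_word n (a @ Pos i s # b) \<phi> j) holomorphic_on A"
  by (induction a arbitrary: j) (auto intro!: holomorphic_vec_op holomorphic_vec_op_Pos simp del: vec_op.simps)

lemma holomorphic_lead_minor: "(\<lambda>s. lead_minor n k (a @ Pos i s # b)) holomorphic_on A"
proof -
  have "(\<lambda>s. lead_minor n k (a @ Pos i s # b)) = (\<lambda>s. \<Sum>p\<in>{p. p permutes {0..<k}}. signof p *
      (\<Prod>c = 0..<k. vec_word n (a @ Pos i s # b) (unit_fun (Suc (p c))) (Suc c)))"
    unfolding lead_minor_def row_minor_def
    by (intro ext, subst det_def'[of _ k]) (auto intro!: sum.cong prod.cong simp: permutes_in_image simp del: foldr_append foldr.simps)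
  then show ?thesis
    by (auto intro!: holomorphic_intros holomorphic_vec_word simp del: foldr_append foldr.simps)
qed

section \<open>Inverse lifts of simple reflections on vectors\<close>

definition inv_word :: "nat list \<Rightarrow> letter list" where
  "inv_word is = concat (map (\<lambda>i. [Pos i 1, Neg i (- 1), Pos i 1]) (rev is))"

abbreviation vec_inv_s_bar :: "nat \<Rightarrow> nat \<Rightarrow> (nat \<Rightarrow> complex) \<Rightarrow> nat \<Rightarrow> complex" where
  "vec_inv_s_bar n i \<phi> \<equiv> vec_op n (Pos i 1) (vec_op n (Neg i (- 1)) (vec_op n (Pos i 1) \<phi>))"

lemma vec_inv_s_bar_less:
  assumes "i < n" "p + i = 2 * n + 1"
  shows "vec_inv_s_bar n i \<phi> = \<phi>(i := \<phi> (Suc i), Suc i := - \<phi> i, p := \<phi> (Suc p), Suc p := - \<phi> p)"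
proof -
  obtain p' where p': "p' + i = 2 * n + 1"
    and r: "\<And>s \<phi>. vec_op n (Pos i s) \<phi> = \<phi>(i := \<phi> i + s * \<phi> (Suc i), p' := \<phi> p' + s * \<phi> (Suc p'))"
    "\<And>s \<phi>. vec_op n (Neg i s) \<phi> = \<phi>(Suc i := \<phi> (Suc i) + s * \<phi> i, Suc p' := \<phi> (Suc p') + s * \<phi> p')"
    using vec_op_less[OF assms(1)] by metis
  have [simp]: "p' = p" using p' assms(2) by linarith
  have "i \<noteq> p" "Suc i \<noteq> p" "i \<noteq> Suc p" using assms by linarith+
  note d = this this[symmetric]
  show ?thesis unfolding r by (auto simp: fun_eq_iff d)
qed

lemma vec_inv_s_bar_last:
  "vec_inv_s_bar n n \<phi> = \<phi>(n := \<phi> (n + 2), n + 1 := - \<phi> (n + 1), n + 2 := \<phi> n)"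
proof (rule ext)
  fix m
  consider "m = n" | "m = n + 1" | "m = n + 2" | "m \<noteq> n" "m \<noteq> n + 1" "m \<noteq> n + 2" by blast
  then show "vec_inv_s_bar n n \<phi> m = (\<phi>(n := \<phi> (n + 2), n + 1 := - \<phi> (n + 1), n + 2 := \<phi> n)) m"
    by cases (simp_all add: vec_op_last)
qed

section \<open>Minors of lifts of Weyl group elements\<close>

definition signed_coord :: "nat \<Rightarrow> (nat \<Rightarrow> int) \<Rightarrow> nat \<Rightarrow> int" where
  "signed_coord n x j = (if j \<le> n then x j else if j = Suc n then 0 else - x (2 * n + 2 - j))"

text \<open>The rows \<open>r\<close> are those of the weight vectors that occur in the extremal vector of weight
  \<open>x\<close> in the \<open>k\<close>-th exterior power; recall that \<open>eps_coord\<close> doubles the coordinates.\<close>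

definition selects_rows :: "nat \<Rightarrow> nat \<Rightarrow> (nat \<Rightarrow> int) \<Rightarrow> (nat \<Rightarrow> nat) \<Rightarrow> bool" where
  "selects_rows n k x r \<longleftrightarrow> (\<forall>a b. a < b \<longrightarrow> b < k \<longrightarrow> r a < r b) \<and> (\<forall>a<k. r a \<in> {1..2 * n + 1}) \<and>
     (\<forall>j\<in>{1..2 * n + 1}. (\<exists>a<k. r a = j) \<longleftrightarrow> signed_coord n x j = 2)"

lemma selects_rows_inj:
  assumes "selects_rows n k x r" "a < k" "b < k" "r a = r b"
  shows "a = b"
  using assms unfolding selects_rows_def by (metis less_irrefl linorder_neqE_nat)

lemma selects_rows_unique:
  assumes "selects_rows n k x r" "selects_rows n k x s" "a < k"
  shows "r a = s a"
  using assms(3)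
proof (induction a rule: less_induct)
  case (less a)
  have no_less: False if sr: "selects_rows n k x s" "selects_rows n k x r" "r a < s a"
    "\<And>b. b < a \<Longrightarrow> r b = s b" for r s
  proof -
    have "\<exists>b<k. s b = r a"
      using sr less.prems unfolding selects_rows_def by metis
    then obtain b where b: "b < k" "s b = r a" by blast
    have "b < a"
      using b sr(3) less.prems sr(1) unfolding selects_rows_def
      by (metis less_asym linorder_neqE_nat)
    then show False using selects_rows_inj[OF sr(2) b(1) less.prems] sr(4) b by simp
  qed
  show ?case
    using no_less[OF assms(2,1)] no_less[OF assms(1,2)] less by (metis linorder_neqE_nat less_trans)
qed

text \<open>If rows q and q + 1 both occur and the second plane does not, then each of the three
  factors is a row operation inside the minor. The signed exchange of the two rows thus has
  determinant 1.\<close>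

lemma row_minor_adjacent_rows:
  assumes a: "a1 < k" "a2 < k" "r a1 = q" "r a2 = Suc q" and inj: "\<And>a b. a < k \<Longrightarrow> b < k \<Longrightarrow> r a = r b \<Longrightarrow> a = b"
    and q': "\<And>a. a < k \<Longrightarrow> r a \<noteq> q' \<and> r a \<noteq> Suc q'"
    and P: "\<And>t \<phi>. P t \<phi> q = \<phi> q + t * \<phi> (Suc q)" "\<And>t \<phi> m. m \<noteq> q \<Longrightarrow> m \<noteq> q' \<Longrightarrow> P t \<phi> m = \<phi> m"
    and N: "\<And>t \<phi>. N t \<phi> (Suc q) = \<phi> (Suc q) + t * \<phi> q" "\<And>t \<phi> m. m \<noteq> Suc q \<Longrightarrow> m \<noteq> Suc q' \<Longrightarrow> N t \<phi> m = \<phi> m"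
  shows "row_minor k r (\<lambda>b. P 1 (N (- 1) (P 1 (\<Phi> b)))) = row_minor k r \<Phi>"
proof -
  have ne: "a1 \<noteq> a2" using a by auto
  have Pstep: "row_minor k r (\<lambda>b. P t (\<Psi> b)) = row_minor k r \<Psi>" for t \<Psi>
  proof (rule row_minor_add_row[OF a(1,2) ne, of _ _ _ t])
    fix c b assume "c < k"
    then show "P t (\<Psi> b) (r c) = \<Psi> b (r c) + (if c = a1 then t * \<Psi> b (r a2) else 0)"
    proof (cases "c = a1")
      case True
      then show ?thesis by (simp add: a P(1))
    next
      case False
      then have "r c \<noteq> q" using inj[OF \<open>c < k\<close> a(1)] unfolding a(3) by blast
      then show ?thesis using q'[OF \<open>c < k\<close>] False by (simp add: P(2))
    qed
  qed
  have Nstep: "row_minor k r (\<lambda>b. N t (\<Psi> b)) = row_minor k r \<Psi>" for t \<Psi>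
  proof (rule row_minor_add_row[OF a(2,1) ne[symmetric], of _ _ _ t])
    fix c b assume "c < k"
    then show "N t (\<Psi> b) (r c) = \<Psi> b (r c) + (if c = a2 then t * \<Psi> b (r a1) else 0)"
    proof (cases "c = a2")
      case True
      then show ?thesis by (simp add: a N(1))
    next
      case False
      then have "r c \<noteq> Suc q" using inj[OF \<open>c < k\<close> a(2)] unfolding a(4) by blast
      then show ?thesis using q'[OF \<open>c < k\<close>] False by (simp add: N(2))
    qed
  qed
  show ?thesis unfolding Pstep Nstep ..
qed

text \<open>A sign could come only from the entries of the lift in rows i + 1 and p + 1. Since x (i
  + 1) does not exceed x i, such a row is selected only together with its partner i or p, and then
  the previous lemma applies.\<close>

lemma selects_rows_reflect_less:
  assumes i: "1 \<le> i" "i < n" and sel: "selects_rows n k x r"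
    and x: "x (Suc i) \<le> x i" "\<bar>x i\<bar> \<le> 2" "\<bar>x (Suc i)\<bar> \<le> 2"
    and x': "\<And>j. j \<in> {1..n} \<Longrightarrow> x' j = x (adj_swap i j)"
  shows "\<exists>r'. selects_rows n k x' r' \<and> (\<forall>\<Phi>. row_minor k r (\<lambda>b. vec_inv_s_bar n i (\<Phi> b)) = row_minor k r' \<Phi>)"
proof -
  define p where "p = 2 * n + 1 - i"
  have p: "p + i = 2 * n + 1" using i by (simp add: p_def)
  have mono: "\<And>a b. a < b \<Longrightarrow> b < k \<Longrightarrow> r a < r b"
    and range: "\<And>a. a < k \<Longrightarrow> r a \<in> {1..2 * n + 1}"
    and mem: "\<And>j. j \<in> {1..2 * n + 1} \<Longrightarrow> (\<exists>a<k. r a = j) \<longleftrightarrow> signed_coord n x j = 2"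
    using sel unfolding selects_rows_def by blast+
  have bars: "p > Suc n" "2 * n + 2 - p = Suc i" "2 * n + 2 - Suc p = i" using p i by linarith+
  have sc: "signed_coord n y i = y i" "signed_coord n y (Suc i) = y (Suc i)"
    "signed_coord n y p = - y (Suc i)" "signed_coord n y (Suc p) = - y i" for y
    using i bars by (simp_all add: signed_coord_def)
  have ind: "i \<in> {1..2 * n + 1}" "Suc i \<in> {1..2 * n + 1}" "p \<in> {1..2 * n + 1}" "Suc p \<in> {1..2 * n + 1}"
    using i p by auto
  have x'i: "x' i = x (Suc i)" "x' (Suc i) = x i"
    using x'[of i] x'[of "Suc i"] i by (auto simp: adj_swap_def)
  have other: "signed_coord n x' j = signed_coord n x j"
    if "j \<in> {1..2 * n + 1}" "j \<notin> {i, Suc i, p, Suc p}" for j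
  proof (cases "j \<le> n")
    case True
    then show ?thesis using that x'[of j] by (simp add: signed_coord_def adj_swap_def)
  next
    case False
    have "2 * n + 2 - j \<noteq> i" "2 * n + 2 - j \<noteq> Suc i" using that p i by auto
    moreover have "j = Suc n \<or> 2 * n + 2 - j \<in> {1..n}" using that False by auto
    ultimately show ?thesis using False x'[of "2 * n + 2 - j"] by (auto simp: signed_coord_def adj_swap_def)
  qed
  obtain p' where p': "p' + i = 2 * n + 1"
    and P: "\<And>s \<phi>. vec_op n (Pos i s) \<phi> = \<phi>(i := \<phi> i + s * \<phi> (Suc i), p' := \<phi> p' + s * \<phi> (Suc p'))"
    and N: "\<And>s \<phi>. vec_op n (Neg i s) \<phi> = \<phi>(Suc i := \<phi> (Suc i) + s * \<phi> i, Suc p' := \<phi> (Suc p') + s * \<phi> p')"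
    using vec_op_less[OF i(2)] by metis
  have [simp]: "p' = p" using p' p by linarith
  have ip: "i \<noteq> p" "Suc i \<noteq> p" "i \<noteq> Suc p" using bars i by linarith+
  have same: "selects_rows n k x' r" if eq: "x i = x (Suc i)"
  proof -
    have "signed_coord n x' j = signed_coord n x j" if "j \<in> {1..2 * n + 1}" for j
    proof (cases "j \<in> {i, Suc i, p, Suc p}")
      case True
      then show ?thesis using sc[of x] sc[of x'] x'i eq by auto
    next
      case False
      then show ?thesis by (rule other[OF that])
    qed
    then show ?thesis using sel by (simp add: selects_rows_def)
  qed
  \<comment> \<open>If x (i + 1) = 2 then x i = 2, and if x i = -2 then x (i + 1) = -2. In the
    remaining case rows i + 1 and p + 1 are free, and rows i and p move there without a
    sign.\<close>
  consider "x i = 2" "x (Suc i) = 2" | "x i = - 2" "x (Suc i) = - 2" | "x (Suc i) \<noteq> 2" "x i \<noteq> - 2"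
    using x by linarith
  then show ?thesis
  proof cases
    case 1
    have "\<exists>a<k. r a = i" "\<exists>a<k. r a = Suc i" using mem ind sc 1 by auto
    then obtain a1 a2 where a: "a1 < k" "r a1 = i" "a2 < k" "r a2 = Suc i" by blast
    have "row_minor k r (\<lambda>b. vec_inv_s_bar n i (\<Phi> b)) = row_minor k r \<Phi>" for \<Phi>
    proof (rule row_minor_adjacent_rows[of a1 k a2 r i p "\<lambda>t. vec_op n (Pos i t)" "\<lambda>t. vec_op n (Neg i t)"])
      show "r c \<noteq> p \<and> r c \<noteq> Suc p" if "c < k" for c
        using mem[of p] mem[of "Suc p"] ind sc 1 that by auto
      show "c = d" if "c < k" "d < k" "r c = r d" for c d
        using selects_rows_inj[OF sel that] .
    qed (use a in \<open>simp_all add: P N ip ip[symmetric] del: vec_op.simps\<close>)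
    moreover have "selects_rows n k x' r"
      using 1 by (intro same) simp
    ultimately show ?thesis by blast
  next
    case 2
    have "\<exists>a<k. r a = p" "\<exists>a<k. r a = Suc p" using mem ind sc 2 by auto
    then obtain a1 a2 where a: "a1 < k" "r a1 = p" "a2 < k" "r a2 = Suc p" by blast
    have "row_minor k r (\<lambda>b. vec_inv_s_bar n i (\<Phi> b)) = row_minor k r \<Phi>" for \<Phi>
    proof (rule row_minor_adjacent_rows[of a1 k a2 r p i "\<lambda>t. vec_op n (Pos i t)" "\<lambda>t. vec_op n (Neg i t)"])
      show "r c \<noteq> i \<and> r c \<noteq> Suc i" if "c < k" for c
        using mem[of i] mem[of "Suc i"] ind sc 2 that by auto
      show "c = d" if "c < k" "d < k" "r c = r d" for c d
        using selects_rows_inj[OF sel that] .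
    qed (use a in \<open>simp_all add: P N ip ip[symmetric] del: vec_op.simps\<close>)
    moreover have "selects_rows n k x' r"
      using 2 by (intro same) simp
    ultimately show ?thesis by blast
  next
    case 3
    define \<sigma> where "\<sigma> j = (if j = i then Suc i else if j = p then Suc p else j)" for j
    have no: "r a \<noteq> Suc i" "r a \<noteq> Suc p" if "a < k" for a
      using mem[of "Suc i"] mem[of "Suc p"] ind sc 3 that by auto
    have "row_minor k r (\<lambda>b. vec_inv_s_bar n i (\<Phi> b)) = row_minor k (\<sigma> \<circ> r) \<Phi>" for \<Phi>
      by (rule row_minor_cong) (simp add: vec_inv_s_bar_less[OF i(2) p] \<sigma>_def no ip del: vec_op.simps)
    moreover have "selects_rows n k x' (\<sigma> \<circ> r)"
      unfolding selects_rows_def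
    proof (intro conjI allI impI ballI)
      fix a b assume ab: "a < b" "b < k"
      show "(\<sigma> \<circ> r) a < (\<sigma> \<circ> r) b"
        using mono[OF ab] no[of a] no[of b] ab by (auto simp: \<sigma>_def)
    next
      fix a assume "a < k"
      then show "(\<sigma> \<circ> r) a \<in> {1..2 * n + 1}" using range[of a] ind by (auto simp: \<sigma>_def)
    next
      fix j assume j: "j \<in> {1..2 * n + 1}"
      consider "j = i" | "j = Suc i" | "j = p" | "j = Suc p" | "j \<notin> {i, Suc i, p, Suc p}" by auto
      then show "(\<exists>a<k. (\<sigma> \<circ> r) a = j) \<longleftrightarrow> signed_coord n x' j = 2"
      proof cases
        case 1
        have "(\<sigma> \<circ> r) a \<noteq> j" if "a < k" for a using no[OF that] ip 1 by (auto simp: \<sigma>_def)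
        then show ?thesis using 1 3 sc x'i by auto
      next
        case 2
        have "(\<sigma> \<circ> r) a = j \<longleftrightarrow> r a = i" if "a < k" for a using no[OF that] ip 2 by (auto simp: \<sigma>_def)
        then show ?thesis using 2 mem[OF ind(1)] sc x'i by auto
      next
        case j: 3
        have "(\<sigma> \<circ> r) a \<noteq> j" if "a < k" for a using no[OF that] ip j by (auto simp: \<sigma>_def)
        then show ?thesis using j 3 sc x'i by auto
      next
        case 4
        have "(\<sigma> \<circ> r) a = j \<longleftrightarrow> r a = p" if "a < k" for a using no[OF that] ip 4 by (auto simp: \<sigma>_def)
        then show ?thesis using 4 mem[OF ind(3)] sc x'i by auto
      next
        case 5
        have "(\<sigma> \<circ> r) a = j \<longleftrightarrow> r a = j" if "a < k" for a using 5 by (auto simp: \<sigma>_def)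
        then show ?thesis using mem[OF j] other[OF j 5] by auto
      qed
    qed
    ultimately show ?thesis by blast
  qed
qed

text \<open>Row n + 1 has coordinate 0 and is never selected, and row n + 2 is free because x n is
  nonnegative. So at most row n moves, to row n + 2, and the lift has no sign there.\<close>

lemma selects_rows_reflect_last:
  assumes n: "1 \<le> n" and sel: "selects_rows n k x r" and x: "0 \<le> x n"
    and x': "\<And>j. j \<in> {1..n} \<Longrightarrow> x' j = (if j = n then - x n else x j)"
  shows "\<exists>r'. selects_rows n k x' r' \<and> (\<forall>\<Phi>. row_minor k r (\<lambda>b. vec_inv_s_bar n n (\<Phi> b)) = row_minor k r' \<Phi>)"
proof -
  have mono: "\<And>a b. a < b \<Longrightarrow> b < k \<Longrightarrow> r a < r b"
    and range: "\<And>a. a < k \<Longrightarrow> r a \<in> {1..2 * n + 1}"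
    and mem: "\<And>j. j \<in> {1..2 * n + 1} \<Longrightarrow> (\<exists>a<k. r a = j) \<longleftrightarrow> signed_coord n x j = 2"
    using sel unfolding selects_rows_def by blast+
  have sc: "signed_coord n y n = y n" "signed_coord n y (Suc n) = 0" "signed_coord n y (Suc (Suc n)) = - y n" for y
    by (simp_all add: signed_coord_def)
  have ind: "n \<in> {1..2 * n + 1}" "Suc n \<in> {1..2 * n + 1}" "Suc (Suc n) \<in> {1..2 * n + 1}"
    using n by auto
  have x'n: "x' n = - x n" using x'[of n] n by simp
  have other: "signed_coord n x' j = signed_coord n x j"
    if "j \<in> {1..2 * n + 1}" "j \<notin> {n, Suc n, Suc (Suc n)}" for j
  proof (cases "j \<le> n")
    case True
    then show ?thesis using that x'[of j] by (simp add: signed_coord_def)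
  next
    case False
    have "2 * n + 2 - j \<noteq> n" "2 * n + 2 - j \<in> {1..n}" using that False by auto
    then show ?thesis using False that x'[of "2 * n + 2 - j"] by (auto simp: signed_coord_def)
  qed
  define \<sigma> where "\<sigma> j = (if j = n then Suc (Suc n) else j)" for j
  have no: "r a \<noteq> Suc n" "r a \<noteq> Suc (Suc n)" if "a < k" for a
    using mem[of "Suc n"] mem[of "Suc (Suc n)"] ind sc x that by auto
  have "row_minor k r (\<lambda>b. vec_inv_s_bar n n (\<Phi> b)) = row_minor k (\<sigma> \<circ> r) \<Phi>" for \<Phi>
    by (rule row_minor_cong) (simp add: vec_inv_s_bar_last \<sigma>_def no del: vec_op.simps)
  moreover have "selects_rows n k x' (\<sigma> \<circ> r)"
    unfolding selects_rows_def
  proof (intro conjI allI impI ballI)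
    fix a b assume ab: "a < b" "b < k"
    show "(\<sigma> \<circ> r) a < (\<sigma> \<circ> r) b"
      using mono[OF ab] no[of a] no[of b] ab by (auto simp: \<sigma>_def)
  next
    fix a assume "a < k"
    then show "(\<sigma> \<circ> r) a \<in> {1..2 * n + 1}" using range[of a] ind by (auto simp: \<sigma>_def)
  next
    fix j assume j: "j \<in> {1..2 * n + 1}"
    consider "j = n" | "j = Suc n" | "j = Suc (Suc n)" | "j \<notin> {n, Suc n, Suc (Suc n)}" by auto
    then show "(\<exists>a<k. (\<sigma> \<circ> r) a = j) \<longleftrightarrow> signed_coord n x' j = 2"
    proof cases
      case 1
      have "(\<sigma> \<circ> r) a \<noteq> j" if "a < k" for a using no[OF that] 1 by (auto simp: \<sigma>_def)
      then show ?thesis using 1 x sc x'n by auto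
    next
      case 2
      have "(\<sigma> \<circ> r) a \<noteq> j" if "a < k" for a using no[OF that] 2 by (auto simp: \<sigma>_def)
      then show ?thesis using 2 sc by auto
    next
      case 3
      have "(\<sigma> \<circ> r) a = j \<longleftrightarrow> r a = n" if "a < k" for a using no[OF that] 3 by (auto simp: \<sigma>_def)
      then show ?thesis using 3 mem[OF ind(1)] sc x'n by auto
    next
      case 4
      have "(\<sigma> \<circ> r) a = j \<longleftrightarrow> r a = j" if "a < k" for a using 4 by (auto simp: \<sigma>_def)
      then show ?thesis using mem[OF j] other[OF j 4] by auto
    qed
  qed
  ultimately show ?thesis by blast
qed

text \<open>Inversion reverses the word, so its first letter acts first on vectors.\<close>

lemma vec_word_inv_word_Cons:
  "vec_word n (inv_word (i # is)) \<phi> = vec_word n (inv_word is) (vec_inv_s_bar n i \<phi>)"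
  by (simp add: inv_word_def del: vec_op.simps)

abbreviation fund_weight :: "nat \<Rightarrow> weight" where
  "fund_weight k \<equiv> \<lambda>j. if j = k then 1 else 0"

lemma eps_coord_fund_weight:
  assumes "k < n"
  shows "eps_coord n (fund_weight k) j = (if j \<le> k then 2 else 0)"
  using assms by (simp add: eps_coord_def)

text \<open>No sign appears: each letter of a reduced word pairs nonnegatively with the weight reached so
  far, so its lift acts on the extremal vector like a divided power of \<open>f\<^sub>i\<close>.\<close>

lemma row_minor_inv_word:
  assumes k: "1 \<le> k" "k < n" and red: "reduced_word n w is"
  shows "\<exists>r. selects_rows n k (eps_coord n (w (fund_weight k))) r \<and>
    (\<forall>\<Phi>. row_minor k Suc (\<lambda>b. vec_word n (inv_word is) (\<Phi> b)) = row_minor k r \<Phi>)"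
proof -
  have w: "w = word_elt n is" using red by (simp add: reduced_word_def)
  have "reduced_word n (word_elt n is) is" using red w by simp
  then have "\<exists>r. selects_rows n k (eps_coord n (word_elt n is (fund_weight k))) r \<and>
    (\<forall>\<Phi>. row_minor k Suc (\<lambda>b. vec_word n (inv_word is) (\<Phi> b)) = row_minor k r \<Phi>)"
  proof (induction "is")
    case Nil
    have "selects_rows n k (eps_coord n (fund_weight k)) Suc"
      unfolding selects_rows_def
    proof (intro conjI allI impI ballI)
      fix j assume "j \<in> {1..2 * n + 1}"
      then show "(\<exists>a<k. Suc a = j) \<longleftrightarrow> signed_coord n (eps_coord n (fund_weight k)) j = 2"
        using k by (auto simp: signed_coord_def eps_coord_fund_weight intro!: exI[of _ "j - 1"])
    qed (use k in auto)
    then show ?case by (auto simp: inv_word_def)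
  next
    case (Cons i "is")
    let ?\<mu> = "word_elt n is (fund_weight k)"
    let ?x = "eps_coord n ?\<mu>" and ?x' = "eps_coord n (word_elt n (i # is) (fund_weight k))"
      and ?y = "eps_coord n (word_elt n is rho)"
    note red = reduced_word_Cons[OF Cons.prems]
    have iw: "is \<in> lists {1..n}" using red(1) by (simp add: reduced_word_def)
    \<comment> \<open>The a-th coordinate of \<rho> exceeds 2 (n - k) exactly for a up to k, so
      \<phi> sends \<rho> to \<Lambda>_k. As \<phi> is odd and monotone, the inequalities known for
      the image of \<rho> pass to the image of \<Lambda>_k.\<close>
    define \<phi> :: "int \<Rightarrow> int" where
      "\<phi> z = (if z > 2 * int (n - k) then 2 else if z < - 2 * int (n - k) then - 2 else 0)" for z
    have odd: "\<phi> (- z) = - \<phi> z" for z by (auto simp: \<phi>_def)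
    have mono: "\<phi> z \<le> \<phi> z'" if "z \<le> z'" for z z' using that by (auto simp: \<phi>_def)
    have x: "?x a = \<phi> (?y a)" if "a \<in> {1..n}" for a
    proof (rule eps_coord_word_elt_odd[where \<phi> = \<phi>, OF odd iw _ that])
      show "eps_coord n (fund_weight k) a = \<phi> (eps_coord n rho a)" if "a \<in> {1..n}" for a
        using that k by (auto simp: \<phi>_def eps_coord_fund_weight eps_coord_rho of_nat_diff)
    qed
    obtain r where r: "selects_rows n k ?x r"
      "\<And>\<Phi>. row_minor k Suc (\<lambda>b. vec_word n (inv_word is) (\<Phi> b)) = row_minor k r \<Phi>"
      using Cons.IH[OF red(1)] by blast
    have "\<exists>r'. selects_rows n k ?x' r' \<and> (\<forall>\<Phi>. row_minor k r (\<lambda>b. vec_inv_s_bar n i (\<Phi> b)) = row_minor k r' \<Phi>)"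
    proof (cases "i < n")
      case True
      then have i: "1 \<le> i" "i \<in> {1..n}" "Suc i \<in> {1..n}" using red(3) by auto
      have "?y (Suc i) \<le> ?y i" using red(2) True by (simp add: eps_coord_Suc[of i])
      then have "?x (Suc i) \<le> ?x i" using x i mono by simp
      moreover have "\<bar>?x i\<bar> \<le> 2" "\<bar>?x (Suc i)\<bar> \<le> 2" using x i by (auto simp: \<phi>_def)
      moreover have "?x' j = ?x (adj_swap i j)" if "j \<in> {1..n}" for j
        using that True i by (simp add: eps_coord_simple_reflection)
      ultimately show ?thesis using True i r(1) by (intro selects_rows_reflect_less) auto
    next
      case False
      then have [simp]: "i = n" using red(3) by simp
      have n: "n \<in> {1..n}" using red(3) by simp
      have "0 \<le> ?y n" using red(2) by (simp add: eps_coord_last)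
      then have "0 \<le> ?x n" using x[OF n] mono[of 0 "?y n"] odd[of 0] by (simp add: \<phi>_def)
      moreover have "?x' j = (if j = n then - ?x n else ?x j)" if "j \<in> {1..n}" for j
        using that n by (simp add: eps_coord_simple_reflection)
      ultimately show ?thesis using r(1) n unfolding \<open>i = n\<close> by (intro selects_rows_reflect_last) auto
    qed
    then show ?case unfolding vec_word_inv_word_Cons r(2)
      by (simp del: vec_op.simps)
  qed
  then show ?thesis unfolding w .
qed

text \<open>s_k replaces \<epsilon>_k by \<epsilon>_(k+1) in \<Lambda>_k and the longest element is
  - 1. The weights to be selected are thus - \<epsilon>_j for j < k and j = k + 1, and they sit at
  the indices 2 n + 2 - j.\<close>

lemma row_minor_longest_elt_simple_reflection:
  assumes k: "1 \<le> k" "k < n" and red: "reduced_word n (longest_elt n \<circ> simple_reflection n k) is"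
  shows "row_minor k Suc (\<lambda>b. vec_word n (inv_word is) (\<Phi> b))
    = row_minor k (\<lambda>a. if a = 0 then 2 * n + 1 - k else 2 * n + 2 - k + a) \<Phi>" (is "_ = row_minor k ?s \<Phi>")
proof -
  let ?x = "eps_coord n ((longest_elt n \<circ> simple_reflection n k) (fund_weight k))"
  obtain r where r: "selects_rows n k ?x r"
    "\<And>\<Phi>. row_minor k Suc (\<lambda>b. vec_word n (inv_word is) (\<Phi> b)) = row_minor k r \<Phi>"
    using row_minor_inv_word[OF k red] by blast
  have x: "?x j = (if j < k \<or> j = Suc k then - 2 else 0)" if "j \<in> {1..n}" for j
    using that k by (auto simp: eps_coord_longest_elt eps_coord_simple_reflection eps_coord_fund_weight adj_swap_def)
  have "selects_rows n k ?x ?s"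
    unfolding selects_rows_def
  proof (intro conjI allI impI ballI)
    fix j assume j: "j \<in> {1..2 * n + 1}"
    have "signed_coord n ?x j = 2 \<longleftrightarrow> j = 2 * n + 1 - k \<or> 2 * n + 2 - k < j"
    proof (cases "j \<le> n")
      case True
      then have "\<not> (j = 2 * n + 1 - k \<or> 2 * n + 2 - k < j)" using k by auto
      moreover have "signed_coord n ?x j \<noteq> 2" using True j x[of j] by (simp add: signed_coord_def)
      ultimately show ?thesis by blast
    next
      case False
      show ?thesis
      proof (cases "j = Suc n")
        case True
        then have "\<not> (j = 2 * n + 1 - k \<or> 2 * n + 2 - k < j)" using k by auto
        then show ?thesis using True by (simp add: signed_coord_def)
      next
        case F: False
        define q where "q = 2 * n + 2 - j"
        have q: "q + j = 2 * n + 2" "q \<in> {1..n}" using j False F by (auto simp: q_def)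
        have "signed_coord n ?x j = - ?x q" using False F by (simp add: signed_coord_def q_def)
        then have "signed_coord n ?x j = 2 \<longleftrightarrow> q < k \<or> q = Suc k" using x[OF q(2)] by simp
        also have "\<dots> \<longleftrightarrow> j = 2 * n + 1 - k \<or> 2 * n + 2 - k < j" using q(1) k by linarith
        finally show ?thesis .
      qed
    qed
    moreover have "(\<exists>a<k. ?s a = j) \<longleftrightarrow> j = 2 * n + 1 - k \<or> 2 * n + 2 - k < j"
    proof
      assume "j = 2 * n + 1 - k \<or> 2 * n + 2 - k < j"
      then show "\<exists>a<k. ?s a = j"
      proof
        assume "2 * n + 2 - k < j"
        then show ?thesis using j k by (intro exI[of _ "j - (2 * n + 2 - k)"]) auto
      qed (use k in auto)
    qed (use k in \<open>auto split: if_splits\<close>)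
    ultimately show "(\<exists>a<k. ?s a = j) \<longleftrightarrow> signed_coord n ?x j = 2" by simp
  qed (use k in auto)
  note eq = selects_rows_unique[OF r(1) this]
  have "row_minor k r \<Phi> = row_minor k ?s \<Phi>"
    by (rule row_minor_cong) (simp only: eq)
  then show ?thesis using r(2) by simp
qed

section \<open>The minor of \<open>\<Theta>\<^sup>-\<close> in the vector representation\<close>

definition y_op :: "nat \<Rightarrow> nat \<Rightarrow> complex \<Rightarrow> (nat \<Rightarrow> complex) \<Rightarrow> nat \<Rightarrow> complex" where
  "y_op n i c \<phi> = vec_op n (Neg i c) (vec_op n (Tor i (inverse c)) \<phi>)"

lemma y_op_less:
  assumes "i < n" "p + i = 2 * n + 1" "c \<noteq> 0"
  shows "y_op n i c \<phi> = \<phi>(i := \<phi> i / c, Suc i := c * \<phi> (Suc i) + \<phi> i, p := \<phi> p / c, Suc p := c * \<phi> (Suc p) + \<phi> p)"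
proof -
  obtain p' where p': "p' + i = 2 * n + 1"
    and N: "\<And>s \<phi>. vec_op n (Neg i s) \<phi> = \<phi>(Suc i := \<phi> (Suc i) + s * \<phi> i, Suc p' := \<phi> (Suc p') + s * \<phi> p')"
    using vec_op_less[OF assms(1)] by metis
  have [simp]: "p' = p" using p' assms(2) by linarith
  have "i \<noteq> p" "Suc i \<noteq> p" "i \<noteq> Suc p" using assms by linarith+
  note d = this this[symmetric]
  have "2 * n + 1 - i = p" "2 * n + 2 - i = Suc p" using assms by linarith+
  then have w: "torus_weight n i (inverse c) m = (if m = i \<or> m = p then inverse c else if m = Suc i \<or> m = Suc p then c else 1)" for m
    using assms by (simp add: torus_weight_def inverse_eq_divide)
  show ?thesis
    unfolding y_op_def N vec_op_Tor w using assms(3) by (auto simp: fun_eq_iff d inverse_eq_divide)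
qed

lemma y_op_last:
  assumes "c \<noteq> 0"
  shows "y_op n n c \<phi> n = \<phi> n / c\<^sup>2" "y_op n n c \<phi> (Suc n) = \<phi> (Suc n) + \<phi> n / c"
    "y_op n n c \<phi> (Suc (Suc n)) = c\<^sup>2 * \<phi> (Suc (Suc n)) + 2 * c * \<phi> (Suc n) + \<phi> n"
    "m \<noteq> n \<Longrightarrow> m \<noteq> Suc n \<Longrightarrow> m \<noteq> Suc (Suc n) \<Longrightarrow> y_op n n c \<phi> m = \<phi> m"
  using assms unfolding y_op_def vec_op_last
  by (simp_all add: inverse_eq_divide power_divide power2_eq_square)

text \<open>Row 2 n + 2 - q is the upper row of the lower plane for i = q - 1 and its lower row for
  i = q; no other factor of a block changes it.\<close>

lemma y_op_other:
  assumes "i \<in> {1..n}" "q \<in> {1..n}" "i \<noteq> q" "Suc i \<noteq> q" "c \<noteq> 0"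
  shows "y_op n i c \<phi> (2 * n + 2 - q) = \<phi> (2 * n + 2 - q)"
proof -
  define m where "m = 2 * n + 2 - q"
  have m: "m + q = 2 * n + 2" using assms(2) by (simp add: m_def)
  have "y_op n i c \<phi> m = \<phi> m"
  proof (cases "i < n")
    case True
    define p where "p = 2 * n + 1 - i"
    have p: "p + i = 2 * n + 1" using True by (simp add: p_def)
    have "m \<noteq> i" "m \<noteq> Suc i" using True m assms(2) by auto
    moreover have "m \<noteq> p" "m \<noteq> Suc p" using m p assms(3,4) by linarith+
    ultimately show ?thesis unfolding y_op_less[OF True p assms(5)] by simp
  next
    case False
    then have "i = n" using assms(1) by simp
    moreover have "m \<noteq> n" "m \<noteq> Suc n" "m \<noteq> Suc (Suc n)" using m assms(2,3) \<open>i = n\<close> by auto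
    ultimately show ?thesis using y_op_last(4)[OF assms(5)] by simp
  qed
  then show ?thesis by (simp add: m_def)
qed

section \<open>One block of the product\<close>

abbreviation y_ops :: "nat \<Rightarrow> (nat \<Rightarrow> complex) \<Rightarrow> nat list \<Rightarrow> (nat \<Rightarrow> complex) \<Rightarrow> nat \<Rightarrow> complex" where
  "y_ops n c is \<equiv> foldr (\<lambda>i. y_op n i (c i)) is"

lemma y_ops_other:
  assumes "q \<in> {1..n}" "\<And>i. i \<in> set is \<Longrightarrow> i \<in> {1..n} \<and> i \<noteq> q \<and> Suc i \<noteq> q \<and> c i \<noteq> 0"
  shows "y_ops n c is \<phi> (2 * n + 2 - q) = \<phi> (2 * n + 2 - q)"
  using assms(2)
proof (induction "is")
  case (Cons i "is")
  have "i \<in> {1..n}" "i \<noteq> q" "Suc i \<noteq> q" "c i \<noteq> 0" using Cons.prems[of i] by auto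
  then have "y_ops n c (i # is) \<phi> (2 * n + 2 - q) = y_ops n c is \<phi> (2 * n + 2 - q)"
    using y_op_other[OF _ assms(1)] by simp
  then show ?case using Cons by simp
qed simp

abbreviation block_op :: "nat \<Rightarrow> (nat \<Rightarrow> complex) \<Rightarrow> (nat \<Rightarrow> complex) \<Rightarrow> nat \<Rightarrow> complex" where
  "block_op n c \<equiv> y_ops n c [1..<Suc n]"

text \<open>Write p for 2 n + 1 - q. After the factors beyond q, row p + 1 still comes from \<phi>.
  Then y_q makes row p equal to \<psi> p / c_q and row p + 1 equal to c_q \<phi> (p + 1) + \<psi> p.
  Eliminating \<psi> p leaves the recurrence, once the division of row p + 1 by c_(q-1) in the next
  factor is taken into account.\<close>

lemma block_op_recurrence:
  assumes c: "\<And>i. i \<in> {1..n} \<Longrightarrow> c i \<noteq> 0" and q: "1 \<le> q" "q < n"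
  shows "block_op n c \<phi> (2 * n + 1 - q)
    = (if q = 1 then 1 else c (q - 1)) / c q * block_op n c \<phi> (2 * n + 2 - q) - \<phi> (2 * n + 2 - q)"
proof -
  define p where "p = 2 * n + 1 - q"
  have p: "p + q = 2 * n + 1" "p = 2 * n + 2 - Suc q" "Suc p = 2 * n + 2 - q" using q by (auto simp: p_def)
  define \<psi> where "\<psi> = y_ops n c [Suc q..<Suc n] \<phi>"
  define \<xi> where "\<xi> = y_op n q (c q) \<psi>"
  have cq: "c q \<noteq> 0" using c q by auto
  have "[1..<Suc n] = [1..<q] @ [q..<Suc n]"
    using upt_add_eq_append[of 1 q "Suc n - q"] q by simp
  then have split: "[1..<Suc n] = [1..<q] @ q # [Suc q..<Suc n]"
    using q upt_conv_Cons[of q "Suc n"] by simp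
  have B: "block_op n c \<phi> = y_ops n c [1..<q] \<xi>"
    unfolding split by (simp add: \<xi>_def \<psi>_def)
  have \<psi>: "\<psi> (Suc p) = \<phi> (Suc p)"
    unfolding \<psi>_def p(3) using q c by (intro y_ops_other) auto
  have \<xi>: "\<xi> p = \<psi> p / c q" "\<xi> (Suc p) = c q * \<phi> (Suc p) + \<psi> p"
    unfolding \<xi>_def y_op_less[OF q(2) p(1) cq] using \<psi> q p by auto
  have Bp: "block_op n c \<phi> p = \<xi> p"
    unfolding B p(2) using q c by (intro y_ops_other) auto
  \<comment> \<open>For q = 1 no further factor of the block follows, so there is nothing to divide
    by.\<close>
  define d where "d = (if q = 1 then 1 else c (q - 1))"
  have d: "d \<noteq> 0"
  proof (cases "q = 1")
    case False
    then have "q - 1 \<in> {1..n}" using q by auto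
    then show ?thesis using c False by (simp add: d_def)
  qed (simp add: d_def)
  have "block_op n c \<phi> (Suc p) = \<xi> (Suc p) / d"
  proof (cases "q = 1")
    case True
    then show ?thesis unfolding B by (simp add: d_def)
  next
    case False
    define q' where "q' = q - 1"
    have q': "q = Suc q'" "1 \<le> q'" "q' < n" using False q by (auto simp: q'_def)
    have sp: "Suc p + q' = 2 * n + 1" using p(1) q'(1) by simp
    have "[1..<q] = [1..<q'] @ [q']" using q' by simp
    then have "block_op n c \<phi> (Suc p) = y_ops n c [1..<q'] (y_op n q' (c q') \<xi>) (2 * n + 2 - q)"
      unfolding B p(3) by simp
    also have "\<dots> = y_op n q' (c q') \<xi> (Suc p)"
      unfolding p(3) using q' c by (intro y_ops_other) auto
    also have "\<dots> = \<xi> (Suc p) / c q'"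
      using sp q' c[of q'] by (simp add: y_op_less[OF q'(3) sp])
    finally show ?thesis using False by (simp add: q'_def d_def)
  qed
  then show ?thesis
    using cq d unfolding p_def[symmetric] p(3)[symmetric] Bp \<xi> d_def[symmetric]
    by (simp add: field_simps)
qed

lemma y_ops_vanishing_above:
  assumes "\<And>j. j > s \<Longrightarrow> \<phi> j = 0" "\<And>i. i \<in> set is \<Longrightarrow> i \<in> {1..n} \<and> s < i \<and> c i \<noteq> 0"
  shows "y_ops n c is \<phi> = \<phi>"
  using assms(2)
proof (induction "is")
  case (Cons i "is")
  then have i: "i \<in> {1..n}" "s < i" "c i \<noteq> 0" and IH: "y_ops n c is \<phi> = \<phi>" by auto
  have "y_op n i (c i) \<phi> = \<phi>"
  proof (cases "i < n")
    case True
    define p where "p = 2 * n + 1 - i"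
    have p: "p + i = 2 * n + 1" using True by (simp add: p_def)
    have "s < p" using p i True by linarith
    then show ?thesis
      unfolding y_op_less[OF True p i(3)] using assms(1) i(2) by (auto simp: fun_eq_iff)
  next
    case False
    then have [simp]: "i = n" using i by simp
    have z: "\<phi> n = 0" "\<phi> (Suc n) = 0" "\<phi> (Suc (Suc n)) = 0" using assms(1) i(2) by auto
    show ?thesis
    proof (rule ext)
      fix m
      show "y_op n i (c i) \<phi> m = \<phi> m"
        using y_op_last[where c = "c n" and n = n and \<phi> = \<phi>] i(3) z
        by (cases "m = n"; cases "m = Suc n"; cases "m = Suc (Suc n)") simp_all
    qed
  qed
  then show ?case using IH by simp
qed simp

text \<open>Factors beyond s fix a vector supported up to s. Then y_s carries its top entry to s + 1
  with coefficient c * (1 / c) = 1, and the factors before s do not touch index s + 1.\<close>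

lemma block_op_support:
  assumes c: "\<And>i. i \<in> {1..n} \<Longrightarrow> c i \<noteq> 0" and s: "1 \<le> s" "s < n" and \<phi>: "\<And>j. j > s \<Longrightarrow> \<phi> j = 0"
  shows "(\<forall>j>Suc s. block_op n c \<phi> j = 0) \<and> block_op n c \<phi> (Suc s) = \<phi> s"
proof -
  have "[1..<Suc n] = [1..<s] @ [s..<Suc n]"
    using upt_add_eq_append[of 1 s "Suc n - s"] s by simp
  then have split: "[1..<Suc n] = [1..<s] @ s # [Suc s..<Suc n]"
    using s upt_conv_Cons[of s "Suc n"] by simp
  have "y_ops n c [Suc s..<Suc n] \<phi> = \<phi>"
    using \<phi> c s by (intro y_ops_vanishing_above[of s]) auto
  then have B: "block_op n c \<phi> = y_ops n c [1..<s] (y_op n s (c s) \<phi>)"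
    unfolding split by simp
  have step: "(\<forall>j>Suc s. y_op n i (c i) \<xi> j = 0) \<and> y_op n i (c i) \<xi> (Suc s) = \<phi> s"
    if "1 \<le> i" "i < s" "\<forall>j>Suc s. \<xi> j = 0" "\<xi> (Suc s) = \<phi> s" for i \<xi>
  proof -
    have i: "i < n" using that s by simp
    define p where "p = 2 * n + 1 - i"
    have p: "p + i = 2 * n + 1" using i by (simp add: p_def)
    have "p > Suc s" using p that s by linarith
    then show ?thesis
      using that c[of i] s by (auto simp: y_op_less[OF i p])
  qed
  have "(\<forall>j>Suc s. y_ops n c is (y_op n s (c s) \<phi>) j = 0) \<and> y_ops n c is (y_op n s (c s) \<phi>) (Suc s) = \<phi> s"
    if "\<And>i. i \<in> set is \<Longrightarrow> 1 \<le> i \<and> i < s" for "is"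
    using that
  proof (induction "is")
    case Nil
    define p where "p = 2 * n + 1 - s"
    have p: "p + s = 2 * n + 1" using s by (simp add: p_def)
    have "p > Suc s" using p s by linarith
    then show ?case using \<phi> c[of s] s by (auto simp: y_op_less[OF s(2) p])
  next
    case (Cons i "is")
    then show ?case using step[of i] by auto
  qed
  from this[of "[1..<s]"] show ?thesis unfolding B by simp
qed

text \<open>y_n carries the entry n to n + 2, and y_(n-1), ..., y_1 carry it on to 2 n + 1, one
  index each. All coefficients are 1, so a single block suffices.\<close>

lemma block_op_bottom:
  assumes c: "\<And>i. i \<in> {1..n} \<Longrightarrow> c i \<noteq> 0" and n: "1 \<le> n" and \<phi>: "\<And>j. j > n \<Longrightarrow> \<phi> j = 0"
  shows "block_op n c \<phi> (2 * n + 1) = \<phi> n"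
proof -
  have "1 \<le> q \<longrightarrow> (\<forall>j>2 * n + 2 - q. y_ops n c [q..<Suc n] \<phi> j = 0) \<and> y_ops n c [q..<Suc n] \<phi> (2 * n + 2 - q) = \<phi> n"
    if "q \<le> n" for q
    using that
  proof (induction rule: inc_induct)
    case base
    have "y_op n n (c n) \<phi> j = 0" if "j > Suc (Suc n)" for j
      using that y_op_last(4)[of "c n" j n \<phi>] \<phi> c n by simp
    then show ?case using y_op_last(3)[of "c n" n \<phi>] \<phi> c n by simp
  next
    case (step q)
    show ?case
    proof
      assume q: "1 \<le> q"
      define p where "p = 2 * n + 1 - q"
      have p: "p + q = 2 * n + 1" "2 * n + 2 - q = Suc p" "2 * n + 2 - Suc q = p" using step by (auto simp: p_def)
      let ?\<xi> = "y_ops n c [Suc q..<Suc n] \<phi>"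
      have IH: "\<forall>j>p. ?\<xi> j = 0" "?\<xi> p = \<phi> n" using step q unfolding p(3) by simp_all
      have u: "[q..<Suc n] = q # [Suc q..<Suc n]" using step by (intro upt_conv_Cons) simp
      have "y_ops n c [q..<Suc n] \<phi> = y_op n q (c q) ?\<xi>" unfolding u by simp
      moreover have "q < p" using p step by linarith
      ultimately show "(\<forall>j>2 * n + 2 - q. y_ops n c [q..<Suc n] \<phi> j = 0) \<and> y_ops n c [q..<Suc n] \<phi> (2 * n + 2 - q) = \<phi> n"
        using IH c[of q] q step unfolding p(2) by (simp add: y_op_less[OF step(2) p(1)])
    qed
  qed
  from this[OF n] show ?thesis by simp
qed

section \<open>Partial products and the expansion of their rows\<close>

definition theta_op :: "nat \<Rightarrow> (nat \<Rightarrow> nat \<Rightarrow> complex) \<Rightarrow> nat \<Rightarrow> (nat \<Rightarrow> complex) \<Rightarrow> nat \<Rightarrow> complex" where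
  "theta_op n c s = foldr (\<lambda>m. block_op n (c m)) [s..<Suc n]"

lemma theta_op_Suc: "s \<le> n \<Longrightarrow> theta_op n c s \<phi> = block_op n (c s) (theta_op n c (Suc s) \<phi>)"
  unfolding theta_op_def by (subst upt_conv_Cons) simp_all

text \<open>Restricted to the first \<open>k\<close> columns, the rows near the bottom of the product are combinations of
  the bottom rows of its partial products, and these form a unitriangular matrix.\<close>

definition bottom_row :: "nat \<Rightarrow> (nat \<Rightarrow> nat \<Rightarrow> complex) \<Rightarrow> nat \<Rightarrow> nat \<Rightarrow> complex" where
  "bottom_row n c s b = theta_op n c s (unit_fun b) (2 * n + 1)"

text \<open>Each of the n + 1 - s blocks raises the top index by one. Because b < s, the top index
  stays at most n, where the description of a block applies.\<close>

lemma theta_op_support: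
  assumes c: "\<And>m i. m \<in> {1..n} \<Longrightarrow> i \<in> {1..n} \<Longrightarrow> c m i \<noteq> 0" and b: "1 \<le> b" and s: "b < s" "s \<le> Suc n"
  shows "(\<forall>j>b + (Suc n - s). theta_op n c s (unit_fun b) j = 0) \<and> theta_op n c s (unit_fun b) (b + (Suc n - s)) = 1"
proof -
  from s(2) have "b < s \<longrightarrow> ?thesis"
  proof (induction rule: inc_induct)
    case base
    then show ?case by (simp add: theta_op_def unit_fun_def)
  next
    case (step s)
    show ?case
    proof
      assume b: "b < s"
      let ?\<phi> = "theta_op n c (Suc s) (unit_fun b)"
      have IH: "\<forall>j>b + (n - s). ?\<phi> j = 0" "?\<phi> (b + (n - s)) = 1" using step b by simp_all
      have "(\<forall>j>Suc (b + (n - s)). block_op n (c s) ?\<phi> j = 0) \<and> block_op n (c s) ?\<phi> (Suc (b + (n - s))) = ?\<phi> (b + (n - s))"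
        using IH(1) b step assms(2) c by (intro block_op_support) auto
      then show "(\<forall>j>b + (Suc n - s). theta_op n c s (unit_fun b) j = 0) \<and> theta_op n c s (unit_fun b) (b + (Suc n - s)) = 1"
        using step IH(2) by (simp add: theta_op_Suc Suc_diff_le)
    qed
  qed
  then show ?thesis using s by simp
qed

text \<open>Before block s acts, the top index is b + n - s, and block s sends exactly the entry n
  to the bottom. That entry is 1 if b = s and 0 if b < s.\<close>

lemma bottom_row_unitriangular:
  assumes c: "\<And>m i. m \<in> {1..n} \<Longrightarrow> i \<in> {1..n} \<Longrightarrow> c m i \<noteq> 0" and b: "1 \<le> b" and s: "b \<le> s" "s \<le> n"
  shows "bottom_row n c s b = (if b = s then 1 else 0)"
proof -
  let ?\<phi> = "theta_op n c (Suc s) (unit_fun b)"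
  have supp: "(\<forall>j>b + (n - s). ?\<phi> j = 0) \<and> ?\<phi> (b + (n - s)) = 1"
    using theta_op_support[of n c b "Suc s", OF c b] s by simp
  have "bottom_row n c s b = ?\<phi> n"
    unfolding bottom_row_def theta_op_Suc[OF s(2)]
    using supp s b c by (intro block_op_bottom) auto
  then show ?thesis using supp s by (cases "b = s") auto
qed

definition c_ratio :: "(nat \<Rightarrow> nat \<Rightarrow> complex) \<Rightarrow> nat \<Rightarrow> nat \<Rightarrow> complex" where
  "c_ratio c s q = (if q = 0 then 1 else c s q) / c s (Suc q)"

text \<open>The coefficient of the bottom row of blocks m, ..., n in row 2 n + 1 - q of blocks s,
  ..., n. Each step lowers q by one; it either keeps s and contributes a ratio, or raises s and
  contributes a sign.\<close>

primrec row_coeff :: "(nat \<Rightarrow> nat \<Rightarrow> complex) \<Rightarrow> nat \<Rightarrow> nat \<Rightarrow> nat \<Rightarrow> complex" where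
  "row_coeff c 0 s m = (if m = s then 1 else 0)"
| "row_coeff c (Suc q) s m = c_ratio c s q * row_coeff c q s m - row_coeff c q (Suc s) m"

lemma theta_op_row:
  assumes c: "\<And>m i. m \<in> {1..n} \<Longrightarrow> i \<in> {1..n} \<Longrightarrow> c m i \<noteq> 0" and s: "1 \<le> s" "s + q \<le> n"
  shows "theta_op n c s (unit_fun b) (2 * n + 1 - q) = (\<Sum>m\<in>{1..n}. row_coeff c q s m * bottom_row n c m b)"
  using s
proof (induction q arbitrary: s)
  case 0
  have "(\<Sum>m\<in>{1..n}. row_coeff c 0 s m * bottom_row n c m b) = (\<Sum>m\<in>{1..n}. if m = s then bottom_row n c m b else 0)"
    by (intro sum.cong) auto
  also have "\<dots> = bottom_row n c s b" using 0 by (subst sum.delta) auto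
  finally show ?case by (simp add: bottom_row_def)
next
  case (Suc q)
  let ?\<phi> = "theta_op n c (Suc s) (unit_fun b)"
  have "theta_op n c s (unit_fun b) (2 * n + 1 - Suc q) = block_op n (c s) ?\<phi> (2 * n + 1 - Suc q)"
    using Suc.prems by (simp add: theta_op_Suc del: upt_Suc)
  also have "\<dots> = (if Suc q = 1 then 1 else c s (Suc q - 1)) / c s (Suc q)
      * block_op n (c s) ?\<phi> (2 * n + 2 - Suc q) - ?\<phi> (2 * n + 2 - Suc q)"
    using Suc.prems c by (intro block_op_recurrence) auto
  also have "\<dots> = c_ratio c s q * theta_op n c s (unit_fun b) (2 * n + 1 - q) - ?\<phi> (2 * n + 1 - q)"
    using Suc.prems by (simp add: c_ratio_def theta_op_Suc del: upt_Suc)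
  also have "\<dots> = (\<Sum>m\<in>{1..n}. row_coeff c (Suc q) s m * bottom_row n c m b)"
    using Suc.IH[of s] Suc.IH[of "Suc s"] Suc.prems
    by (simp add: sum_distrib_left sum_subtractf left_diff_distrib mult.assoc)
  finally show ?case .
qed

lemma row_coeff_zero: "s + q < m \<Longrightarrow> row_coeff c q s m = 0"
  by (induction q arbitrary: s) auto

lemma row_coeff_diag: "row_coeff c q s (s + q) = (- 1) ^ q"
proof (induction q arbitrary: s)
  case (Suc q)
  then show ?case using Suc.IH[of "Suc s"] by (simp add: row_coeff_zero)
qed simp

text \<open>To reach s + q in q + 1 steps, exactly one step keeps s. If i steps that raise s precede
  it, it contributes \<open>c_ratio c (s + i) (q - i)\<close>.\<close>

lemma row_coeff_subdiag:
  "row_coeff c (Suc q) s (s + q) = (- 1) ^ q * (\<Sum>i\<le>q. c_ratio c (s + i) (q - i))"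
proof (induction q arbitrary: s)
  case (Suc q)
  have "row_coeff c (Suc (Suc q)) s (s + Suc q) = c_ratio c s (Suc q) * row_coeff c (Suc q) s (s + Suc q)
      - row_coeff c (Suc q) (Suc s) (Suc s + q)"
    by (simp only: row_coeff.simps add_Suc_right add_Suc)
  also have "\<dots> = (- 1) ^ Suc q * (c_ratio c s (Suc q) + (\<Sum>i\<le>q. c_ratio c (Suc s + i) (q - i)))"
    unfolding Suc.IH row_coeff_diag by (simp add: algebra_simps)
  also have "c_ratio c s (Suc q) + (\<Sum>i\<le>q. c_ratio c (Suc s + i) (q - i)) = (\<Sum>i\<le>Suc q. c_ratio c (s + i) (Suc q - i))"
    by (subst sum.atMost_Suc_shift) simp
  finally show ?case .
qed simp

text \<open>Expansion along the first column, whose only nonzero entry is the last. The sign stays a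
  product because it will only be multiplied by itself.\<close>

lemma det_antitriangular:
  fixes A :: "'a :: comm_ring_1 mat"
  assumes "A \<in> carrier_mat k k"
    "\<And>i j. i < k \<Longrightarrow> j < k \<Longrightarrow> Suc (i + j) < k \<Longrightarrow> A $$ (i, j) = 0"
    "\<And>i j. i < k \<Longrightarrow> j < k \<Longrightarrow> Suc (i + j) = k \<Longrightarrow> A $$ (i, j) = 1"
  shows "Determinant.det A = (\<Prod>i<k. (- 1) ^ i)"
  using assms
proof (induction k arbitrary: A)
  case 0
  then show ?case by (simp add: det_dim_zero)
next
  case (Suc k)
  let ?B = "mat_delete A k 0"
  have B: "?B \<in> carrier_mat k k" using mat_delete_carrier[OF Suc.prems(1)] by simp
  have entry: "?B $$ (i, j) = A $$ (i, Suc j)" if "i < k" "j < k" for i j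
    using that Suc.prems(1) by (auto simp: mat_delete_def)
  have IH: "Determinant.det ?B = (\<Prod>i<k. (- 1) ^ i)"
    by (rule Suc.IH[OF B]) (use Suc.prems in \<open>auto simp: entry\<close>)
  have "Determinant.det A = (\<Sum>i<Suc k. A $$ (i, 0) * cofactor A i 0)"
    by (rule laplace_expansion_column[OF Suc.prems(1)]) simp
  also have "\<dots> = A $$ (k, 0) * cofactor A k 0"
    using Suc.prems(2) by simp
  also have "\<dots> = (- 1) ^ k * (\<Prod>i<k. (- 1) ^ i)"
    using Suc.prems(3)[of k 0] IH by (simp add: cofactor_def)
  finally show ?case by (simp add: mult.commute)
qed

lemma row_minor_theta:
  assumes c: "\<And>m i. m \<in> {1..n} \<Longrightarrow> i \<in> {1..n} \<Longrightarrow> c m i \<noteq> 0" and k: "1 \<le> k" "k < n"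
  shows "row_minor k (\<lambda>a. if a = 0 then 2 * n + 1 - k else 2 * n + 2 - k + a) (\<lambda>b. theta_op n c 1 (unit_fun (Suc b)))
    = 1 / c k 1 + (\<Sum>j = 1..k - 1. c j (k - j) / c j (k - j + 1))"
proof -
  have unitri: "bottom_row n c m b = (if b = m then 1 else 0)" if "1 \<le> b" "b \<le> m" "m \<le> n" for m b
    using bottom_row_unitriangular c that by blast
  \<comment> \<open>Row a of the minor is row 2 n + 1 - \<open>q a\<close>, so \<open>q\<close>
    takes the values k, k - 2, ..., 0; the value k - 1 is omitted because of s_k.\<close>
  define q where "q a = (if a = 0 then k else k - Suc a)" for a
  define t where "t = (\<Sum>i\<le>k - 1. c_ratio c (1 + i) (k - 1 - i))"
  \<comment> \<open>Listing the bottom rows as k - m, in decreasing order, makes ?T upper triangular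
    and ?Z antitriangular.\<close>
  let ?T = "Matrix.mat k k (\<lambda>(a, m). row_coeff c (q a) 1 (k - m))"
  let ?Z = "Matrix.mat k k (\<lambda>(m, b). bottom_row n c (k - m) (Suc b))"
  have entry: "theta_op n c 1 (unit_fun (Suc b)) (if a = 0 then 2 * n + 1 - k else 2 * n + 2 - k + a)
      = (\<Sum>m<k. row_coeff c (q a) 1 (k - m) * bottom_row n c (k - m) (Suc b))" if "a < k" "b < k" for a b
  proof -
    have r: "(if a = 0 then 2 * n + 1 - k else 2 * n + 2 - k + a) = 2 * n + 1 - q a"
      using that k by (auto simp: q_def)
    have "theta_op n c 1 (unit_fun (Suc b)) (2 * n + 1 - q a)
        = (\<Sum>m\<in>{1..n}. row_coeff c (q a) 1 m * bottom_row n c m (Suc b))"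
      using k by (intro theta_op_row[of n c, OF c]) (auto simp: q_def)
    \<comment> \<open>Bottom rows beyond k vanish in the first k columns. This removes the extreme
      coefficient, at m = k + 1, of the row with \<open>q\<close> = k, so that its diagonal entry in
      ?T is the subdiagonal coefficient.\<close>
    also have "\<dots> = (\<Sum>m\<in>{1..k}. row_coeff c (q a) 1 m * bottom_row n c m (Suc b))"
    proof (rule sum.mono_neutral_right)
      show "\<forall>m\<in>{1..n} - {1..k}. row_coeff c (q a) 1 m * bottom_row n c m (Suc b) = 0"
      proof
        fix m assume "m \<in> {1..n} - {1..k}"
        then show "row_coeff c (q a) 1 m * bottom_row n c m (Suc b) = 0"
          using unitri[of "Suc b" m] that by auto
      qed
    qed (use k in auto)
    also have "\<dots> = (\<Sum>m<k. row_coeff c (q a) 1 (k - m) * bottom_row n c (k - m) (Suc b))"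
      by (rule sum.reindex_bij_witness[of _ "\<lambda>m. k - m" "\<lambda>m. k - m"]) auto
    finally show ?thesis unfolding r .
  qed
  have "Matrix.mat k k (\<lambda>(a, b). theta_op n c 1 (unit_fun (Suc b)) (if a = 0 then 2 * n + 1 - k else 2 * n + 2 - k + a)) = ?T * ?Z"
  proof (rule eq_matI)
    fix a b assume "a < dim_row (?T * ?Z)" "b < dim_col (?T * ?Z)"
    then have ab: "a < k" "b < k" by simp_all
    have "(?T * ?Z) $$ (a, b) = (\<Sum>m<k. row_coeff c (q a) 1 (k - m) * bottom_row n c (k - m) (Suc b))"
      using ab by (simp add: scalar_prod_def lessThan_atLeast0)
    then show "Matrix.mat k k (\<lambda>(a, b). theta_op n c 1 (unit_fun (Suc b))
        (if a = 0 then 2 * n + 1 - k else 2 * n + 2 - k + a)) $$ (a, b) = (?T * ?Z) $$ (a, b)"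
      using entry[OF ab] by (simp only: index_mat(1)[OF ab] prod.case)
  qed simp_all
  then have minor: "row_minor k (\<lambda>a. if a = 0 then 2 * n + 1 - k else 2 * n + 2 - k + a) (\<lambda>b. theta_op n c 1 (unit_fun (Suc b)))
      = Determinant.det ?T * Determinant.det ?Z"
    unfolding row_minor_def using det_mult[of ?T k ?Z] by simp
  have Z: "Determinant.det ?Z = (\<Prod>i<k. (- 1) ^ i)"
    using k by (intro det_antitriangular) (auto simp: unitri)
  have "upper_triangular ?T"
    by (auto simp: upper_triangular_def q_def intro!: row_coeff_zero)
  then have "Determinant.det ?T = prod_list (diag_mat ?T)"
    by (rule det_upper_triangular) auto
  also have "\<dots> = (\<Prod>a<k. row_coeff c (q a) 1 (k - a))"
    by (simp add: prod_list_diag_prod lessThan_atLeast0)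
  also have "\<dots> = (\<Prod>a<k. (if a = 0 then t else 1) * (- 1) ^ (k - Suc a))"
  proof (rule prod.cong)
    fix a assume "a \<in> {..<k}"
    then have a: "a < k" by simp
    show "row_coeff c (q a) 1 (k - a) = (if a = 0 then t else 1) * (- 1) ^ (k - Suc a)"
    proof (cases "a = 0")
      case True
      then show ?thesis
        using row_coeff_subdiag[of c "k - 1" 1] k by (simp add: q_def t_def)
    next
      case False
      have e: "1 + (k - Suc a) = k - a" using a by simp
      show ?thesis using False row_coeff_diag[of c "k - Suc a" 1, unfolded e] by (simp add: q_def)
    qed
  qed simp
  also have "\<dots> = t * (\<Prod>a<k. (- 1) ^ (k - Suc a))"
    using k by (simp add: prod.distrib prod.delta)
  also have "(\<Prod>a<k. (- 1) ^ (k - Suc a)) = (\<Prod>a<k. (- 1) ^ a :: complex)"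
    by (rule prod.nat_diff_reindex)
  finally have T: "Determinant.det ?T = t * (\<Prod>i<k. (- 1) ^ i)" .
  have "(\<Prod>i<k. (- 1) ^ i) * (\<Prod>i<k. (- 1) ^ i) = (1 :: complex)"
    unfolding prod.distrib[symmetric] by (simp add: power_mult_distrib[symmetric])
  then have "row_minor k (\<lambda>a. if a = 0 then 2 * n + 1 - k else 2 * n + 2 - k + a) (\<lambda>b. theta_op n c 1 (unit_fun (Suc b))) = t"
    unfolding minor T Z by (simp add: mult.assoc)
  also have "t = (\<Sum>j\<in>{1..k}. c_ratio c j (k - j))"
    unfolding t_def by (rule sum.reindex_bij_witness[of _ "\<lambda>j. j - 1" Suc]) (use k in auto)
  also have "{1..k} = insert k {1..k - 1}" using k by auto
  also have "(\<Sum>j\<in>insert k {1..k - 1}. c_ratio c j (k - j)) = c_ratio c k 0 + (\<Sum>j = 1..k - 1. c_ratio c j (k - j))"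
    using k by (subst sum.insert) auto
  also have "\<dots> = 1 / c k 1 + (\<Sum>j = 1..k - 1. c j (k - j) / c j (k - j + 1))"
    by (intro arg_cong2[where f = "(+)"] sum.cong) (auto simp: c_ratio_def)
  finally show ?thesis .
qed

definition theta_word :: "nat \<Rightarrow> (nat \<Rightarrow> nat \<Rightarrow> complex) \<Rightarrow> letter list" where
  "theta_word n c = concat [[Neg i (c m i), Tor i (inverse (c m i))]. m \<leftarrow> [1..<n + 1], i \<leftarrow> [1..<n + 1]]"

lemma vec_word_theta: "vec_word n (theta_word n c) = theta_op n c 1"
proof -
  have block: "vec_word n (concat (map (\<lambda>i. [Neg i (c i), Tor i (inverse (c i))]) is)) \<phi> = y_ops n c is \<phi>" for c "is" \<phi>
    by (induction "is") (simp_all add: y_op_def del: vec_op.simps)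
  have "vec_word n (concat (concat (map (\<lambda>m. map (\<lambda>i. [Neg i (c m i), Tor i (inverse (c m i))]) [1..<Suc n]) ms))) \<phi>
      = foldr (\<lambda>m. block_op n (c m)) ms \<phi>" for ms \<phi>
    by (induction ms) (simp_all add: block del: vec_op.simps upt_Suc)
  then show ?thesis by (simp add: fun_eq_iff theta_word_def theta_op_def del: vec_op.simps upt_Suc)
qed

section \<open>Words in the one-parameter subgroups\<close>

fun admissible :: "nat \<Rightarrow> letter \<Rightarrow> bool" where
  "admissible n (Pos i t) \<longleftrightarrow> i \<in> {1..n}"
| "admissible n (Neg i t) \<longleftrightarrow> i \<in> {1..n}"
| "admissible n (Tor i t) \<longleftrightarrow> i \<in> {1..n} \<and> t \<noteq> 0"

definition pos_word :: "nat \<Rightarrow> letter list \<Rightarrow> bool" where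
  "pos_word n w \<longleftrightarrow> (\<forall>l\<in>set w. \<exists>i t. l = Pos i t \<and> i \<in> {1..n})"

definition neg_word :: "nat \<Rightarrow> letter list \<Rightarrow> bool" where
  "neg_word n w \<longleftrightarrow> (\<forall>l\<in>set w. \<exists>i t. l = Neg i t \<and> i \<in> {1..n})"

definition tor_word :: "nat \<Rightarrow> letter list \<Rightarrow> bool" where
  "tor_word n w \<longleftrightarrow> (\<forall>l\<in>set w. \<exists>i t. l = Tor i t \<and> i \<in> {1..n} \<and> t \<noteq> 0)"

abbreviation admissible_word :: "nat \<Rightarrow> letter list \<Rightarrow> bool" where
  "admissible_word n w \<equiv> \<forall>l\<in>set w. admissible n l"

lemma admissible_words:
  "pos_word n w \<Longrightarrow> admissible_word n w" "neg_word n w \<Longrightarrow> admissible_word n w" "tor_word n w \<Longrightarrow> admissible_word n w"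
  by (auto simp: pos_word_def neg_word_def tor_word_def)

lemma word_simps [simp]:
  "pos_word n []" "neg_word n []" "tor_word n []"
  "pos_word n (l # w) \<longleftrightarrow> (\<exists>i t. l = Pos i t \<and> i \<in> {1..n}) \<and> pos_word n w"
  "neg_word n (l # w) \<longleftrightarrow> (\<exists>i t. l = Neg i t \<and> i \<in> {1..n}) \<and> neg_word n w"
  "tor_word n (l # w) \<longleftrightarrow> (\<exists>i t. l = Tor i t \<and> i \<in> {1..n} \<and> t \<noteq> 0) \<and> tor_word n w"
  "pos_word n (v @ w) \<longleftrightarrow> pos_word n v \<and> pos_word n w"
  "neg_word n (v @ w) \<longleftrightarrow> neg_word n v \<and> neg_word n w"
  "tor_word n (v @ w) \<longleftrightarrow> tor_word n v \<and> tor_word n w"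
  by (auto simp: pos_word_def neg_word_def tor_word_def)

definition tor_value :: "nat \<Rightarrow> letter list \<Rightarrow> complex" where
  "tor_value k w = prod_list (map (\<lambda>l. case l of Tor i c \<Rightarrow> if i = k then c else 1 | _ \<Rightarrow> 1) w)"

text \<open>The same three properties that characterize \<Delta>_k on the big cell: invariance under
  U^-, the character \<Lambda>_k of the torus, and the value 1 on U^+.\<close>

lemma lead_minor_normal_form:
  assumes k: "k < n" and "neg_word n u" "tor_word n t" "pos_word n v"
  shows "lead_minor n k (u @ t @ v) = tor_value k t"
proof -
  have "lead_minor n k (t @ v) = tor_value k t" using assms(3)
  proof (induction t)
    case Nil
    show ?case using assms(4) by (simp add: tor_value_def pos_word_def lead_minor_Pos)
  next
    case (Cons l t)
    then obtain i c where l: "l = Tor i c" "i \<in> {1..n}" "c \<noteq> 0" by auto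
    have "lead_minor n k (l # t @ v) = (if i = k then c else 1) * lead_minor n k (t @ v)"
      unfolding lead_minor_def l(1) foldr.simps comp_apply by (rule row_minor_Tor[OF k l(2,3)])
    then show ?case using Cons by (simp add: l(1) tor_value_def)
  qed
  moreover have "lead_minor n k (u @ w) = lead_minor n k w" for w
    using assms(2)
  proof (induction u)
    case (Cons l u)
    then obtain i c where l: "l = Neg i c" "i \<in> {1..n}" by auto
    have "lead_minor n k (l # u @ w) = lead_minor n k (u @ w)"
      unfolding lead_minor_def l(1) foldr.simps comp_apply by (rule row_minor_Neg[OF k l(2)])
    then show ?case using Cons by simp
  qed simp
  ultimately show ?thesis by simp
qed

section \<open>Words in G and relations between them\<close>

lemma mat_prod_simps [simp]: "mat_prod N [] = 1\<^sub>m N" "mat_prod N (g # gs) = g * mat_prod N gs"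
  by (simp_all add: mat_prod_def)

locale chevalley_matrices =
  fixes n N :: nat and e f h :: "nat \<Rightarrow> complex mat"
  assumes e_carrier: "i \<in> {1..n} \<Longrightarrow> e i \<in> carrier_mat N N"
    and f_carrier: "i \<in> {1..n} \<Longrightarrow> f i \<in> carrier_mat N N"
    and h_carrier: "i \<in> {1..n} \<Longrightarrow> h i \<in> carrier_mat N N"
    and e_f: "i \<in> {1..n} \<Longrightarrow> j \<in> {1..n} \<Longrightarrow> lie_bracket (e i) (f j) = (if i = j then h i else 0\<^sub>m N N)"
    and h_e: "i \<in> {1..n} \<Longrightarrow> j \<in> {1..n} \<Longrightarrow> lie_bracket (h i) (e j) = of_int (cartan_B n i j) \<cdot>\<^sub>m e j"
    and h_f: "i \<in> {1..n} \<Longrightarrow> j \<in> {1..n} \<Longrightarrow> lie_bracket (h i) (f j) = of_int (- cartan_B n i j) \<cdot>\<^sub>m f j"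
begin

fun letter_mat :: "letter \<Rightarrow> complex mat" where
  "letter_mat (Pos i t) = root_elt e i t"
| "letter_mat (Neg i t) = root_elt f i t"
| "letter_mat (Tor i t) = coroot h i t"

definition word_mat :: "letter list \<Rightarrow> complex mat" where
  "word_mat w = mat_prod N (map letter_mat w)"

lemma word_mat_simps [simp]: "word_mat [] = 1\<^sub>m N" "word_mat (l # w) = letter_mat l * word_mat w"
  by (simp_all add: word_mat_def)

lemma letter_mat_carrier: "admissible n l \<Longrightarrow> letter_mat l \<in> carrier_mat N N"
  by (cases l) (auto simp: root_elt_def coroot_def e_carrier f_carrier h_carrier)

lemma word_mat_carrier: "admissible_word n w \<Longrightarrow> word_mat w \<in> carrier_mat N N"
  by (induction w) (auto intro!: mult_carrier_mat letter_mat_carrier)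

lemma word_mat_append:
  assumes "admissible_word n v" "admissible_word n w"
  shows "word_mat (v @ w) = word_mat v * word_mat w"
  using assms(1)
proof (induction v)
  case Nil
  then show ?case using word_mat_carrier[OF assms(2)] by simp
next
  case (Cons l v)
  then have "letter_mat l * (word_mat v * word_mat w) = letter_mat l * word_mat v * word_mat w"
    using letter_mat_carrier word_mat_carrier assms(2) by (intro assoc_mult_mat[symmetric]) auto
  then show ?case using Cons by simp
qed

text \<open>Both evaluations agree, so rewriting along this relation changes neither the function on
  G nor the leading minor.\<close>

definition word_eq :: "letter list \<Rightarrow> letter list \<Rightarrow> bool" where
  "word_eq v w \<longleftrightarrow> admissible_word n v \<and> admissible_word n w \<and> word_mat v = word_mat w \<and> vec_word n v = vec_word n w"

lemma word_eq_refl: "admissible_word n w \<Longrightarrow> word_eq w w"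
  by (simp add: word_eq_def)

lemma word_eq_trans [trans]: "word_eq u v \<Longrightarrow> word_eq v w \<Longrightarrow> word_eq u w"
  by (simp add: word_eq_def)

lemma word_eq_context:
  assumes "word_eq v w" "admissible_word n a" "admissible_word n b"
  shows "word_eq (a @ v @ b) (a @ w @ b)"
proof -
  have "word_mat (a @ v @ b) = word_mat (a @ w @ b)"
    using assms by (auto simp: word_eq_def word_mat_append ball_Un)
  moreover have "vec_word n (a @ v @ b) = vec_word n (a @ w @ b)"
    by (rule ext) (use assms in \<open>simp add: word_eq_def\<close>)
  ultimately show ?thesis using assms by (auto simp: word_eq_def)
qed

lemma word_eq_Pos_Neg_same:
  assumes i: "i \<in> {1..n}" and st: "Re (1 + s * t) > 0"
  shows "word_eq [Pos i s, Neg i t] [Neg i (t / (1 + s * t)), Tor i (1 + s * t), Pos i (s / (1 + s * t))]"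
proof -
  have nz: "1 + s * t \<noteq> 0" using st by (metis less_irrefl zero_complex.simps(1))
  interpret sl2_triple N "e i" "f i" "h i"
    using i e_carrier f_carrier h_carrier e_f h_e h_f
    by unfold_locales (auto simp: cartan_B_def)
  have "mat_exp (a \<cdot>\<^sub>m e i) \<in> carrier_mat N N" "mat_exp (a \<cdot>\<^sub>m f i) \<in> carrier_mat N N" for a
    using E F by auto
  then have "word_mat [Pos i s, Neg i t] = word_mat [Neg i (t / (1 + s * t)), Tor i (1 + s * t), Pos i (s / (1 + s * t))]"
    using mat_exp_E_F[OF st] by (simp add: root_elt_def coroot_def right_mult_one_mat[of _ N N])
  moreover have "vec_word n [Pos i s, Neg i t] = vec_word n [Neg i (t / (1 + s * t)), Tor i (1 + s * t), Pos i (s / (1 + s * t))]"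
    using vec_op_Pos_Neg_same[OF i nz] by (simp add: fun_eq_iff del: vec_op.simps)
  ultimately show ?thesis using i nz by (simp add: word_eq_def)
qed

lemma word_eq_Pos_Neg_distinct:
  assumes ij: "i \<in> {1..n}" "j \<in> {1..n}" "i \<noteq> j"
  shows "word_eq [Pos i s, Neg j t] [Neg j t, Pos i s]"
proof -
  have "root_elt e i s * root_elt f j t = root_elt f j t * root_elt e i s"
    unfolding root_elt_def using mat_exp_commute[OF e_carrier f_carrier] e_f ij by simp
  moreover have "root_elt e i s \<in> carrier_mat N N" "root_elt f j t \<in> carrier_mat N N"
    using letter_mat_carrier[of "Pos i s"] letter_mat_carrier[of "Neg j t"] ij by auto
  ultimately have "word_mat [Pos i s, Neg j t] = word_mat [Neg j t, Pos i s]" by simp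
  moreover have "vec_word n [Pos i s, Neg j t] = vec_word n [Neg j t, Pos i s]"
    using vec_op_Pos_Neg_distinct[OF ij] by (simp add: fun_eq_iff del: vec_op.simps)
  ultimately show ?thesis using ij by (simp add: word_eq_def)
qed

text \<open>For an integer exponent the branch of the logarithm is immaterial; this turns the
  exponentials from \<open>mat_exp_conjugate\<close> into powers of c.\<close>

lemma exp_Ln_of_int: "c \<noteq> 0 \<Longrightarrow> exp (of_int a * Ln c) = c powi a"
  by (metis exp_Ln exp_power_int)

lemma word_eq_Tor_Neg:
  assumes ij: "i \<in> {1..n}" "j \<in> {1..n}" and c: "c \<noteq> 0"
  shows "word_eq [Tor i c, Neg j t] [Neg j (c powi (- cartan_B n i j) * t), Tor i c]"
proof -
  let ?t = "c powi (- cartan_B n i j) * t"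
  have "coroot h i c * root_elt f j t = root_elt f j ?t * coroot h i c"
    unfolding root_elt_def coroot_def
    using mat_exp_conjugate[OF h_carrier[OF ij(1)] f_carrier[OF ij(2)] h_f[OF ij], of "Ln c" t]
    unfolding exp_Ln_of_int[OF c] .
  moreover have "root_elt f j t \<in> carrier_mat N N" "root_elt f j ?t \<in> carrier_mat N N" "coroot h i c \<in> carrier_mat N N"
    using letter_mat_carrier[of "Neg j _"] letter_mat_carrier[of "Tor i c"] ij c by auto
  ultimately have "word_mat [Tor i c, Neg j t] = word_mat [Neg j ?t, Tor i c]" by simp
  moreover have "vec_word n [Tor i c, Neg j t] = vec_word n [Neg j ?t, Tor i c]"
    using vec_op_Tor_Neg[OF ij c] by (simp add: fun_eq_iff del: vec_op.simps)
  ultimately show ?thesis using ij c by (simp add: word_eq_def)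
qed

lemma word_eq_Pos_Tor:
  assumes ij: "i \<in> {1..n}" "j \<in> {1..n}" and c: "c \<noteq> 0"
  shows "word_eq [Pos j t, Tor i c] [Tor i c, Pos j (c powi (- cartan_B n i j) * t)]"
proof -
  let ?t = "c powi (- cartan_B n i j) * t"
  have "coroot h i c * root_elt e j ?t = root_elt e j (c powi cartan_B n i j * ?t) * coroot h i c"
    unfolding root_elt_def coroot_def
    using mat_exp_conjugate[OF h_carrier[OF ij(1)] e_carrier[OF ij(2)] h_e[OF ij], of "Ln c" ?t] exp_Ln_of_int[OF c]
    by simp
  also have "c powi cartan_B n i j * ?t = t" using c by (simp add: power_int_minus)
  finally have "root_elt e j t * coroot h i c = coroot h i c * root_elt e j ?t" by simp
  moreover have "root_elt e j t \<in> carrier_mat N N" "root_elt e j ?t \<in> carrier_mat N N" "coroot h i c \<in> carrier_mat N N"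
    using letter_mat_carrier[of "Pos j _"] letter_mat_carrier[of "Tor i c"] ij c by auto
  ultimately have "word_mat [Pos j t, Tor i c] = word_mat [Tor i c, Pos j ?t]" by simp
  moreover have "vec_word n [Pos j t, Tor i c] = vec_word n [Tor i c, Pos j ?t]"
    using vec_op_Pos_Tor[OF ij c] by (simp add: fun_eq_iff del: vec_op.simps)
  ultimately show ?thesis using ij c by (simp add: word_eq_def)
qed

section \<open>Gauss decomposition of words\<close>

lemma move_Tor:
  assumes i: "i \<in> {1..n}" "c \<noteq> 0" and "neg_word n u"
  shows "\<exists>u'. neg_word n u' \<and> word_eq (Tor i c # u) (u' @ [Tor i c])"
  using assms(3)
proof (induction u)
  case Nil
  show ?case using i by (intro exI[of _ "[]"]) (simp add: word_eq_refl)
next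
  case (Cons l u)
  then obtain j t where l: "l = Neg j t" "j \<in> {1..n}" and u: "neg_word n u" by auto
  obtain u' where u': "neg_word n u'" "word_eq (Tor i c # u) (u' @ [Tor i c])" using Cons.IH[OF u] by blast
  let ?l = "Neg j (c powi (- cartan_B n i j) * t)"
  have "word_eq (Tor i c # l # u) (?l # Tor i c # u)"
    using word_eq_context[OF word_eq_Tor_Neg[OF i(1) l(2) i(2), of t], of "[]" u] admissible_words(2)[OF u] l by simp
  also have "word_eq (?l # Tor i c # u) (?l # u' @ [Tor i c])"
    using word_eq_context[OF u'(2), of "[?l]" "[]"] l by simp
  finally show ?case using u' l by (intro exI[of _ "?l # u'"]) simp
qed

lemma move_Pos:
  assumes "tor_word n t" and i: "i \<in> {1..n}"
  shows "\<exists>s'. word_eq (Pos i s # t) (t @ [Pos i s'])"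
  using assms(1)
proof (induction t arbitrary: s)
  case Nil
  show ?case using i by (intro exI[of _ s]) (simp add: word_eq_refl)
next
  case (Cons l t)
  then obtain j c where l: "l = Tor j c" "j \<in> {1..n}" "c \<noteq> 0" and t: "tor_word n t" by auto
  let ?s = "c powi (- cartan_B n j i) * s"
  obtain s' where s': "word_eq (Pos i ?s # t) (t @ [Pos i s'])" using Cons.IH[OF t] by blast
  have "word_eq (Pos i s # l # t) (l # Pos i ?s # t)"
    using word_eq_context[OF word_eq_Pos_Tor[OF l(2) i l(3), of s], of "[]" t] admissible_words(3)[OF t] l by simp
  also have "word_eq (l # Pos i ?s # t) (l # t @ [Pos i s'])"
    using word_eq_context[OF s', of "[l]" "[]"] l by simp
  finally show ?case by auto
qed

lemma move_pos_word:
  assumes t: "tor_word n t" and "pos_word n v"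
  shows "\<exists>v'. pos_word n v' \<and> word_eq (v @ t) (t @ v')"
  using assms(2)
proof (induction v)
  case Nil
  show ?case using t admissible_words(3) by (intro exI[of _ "[]"]) (simp add: word_eq_refl)
next
  case (Cons l v)
  then obtain i s where l: "l = Pos i s" "i \<in> {1..n}" and v: "pos_word n v" by auto
  obtain v' where v': "pos_word n v'" "word_eq (v @ t) (t @ v')" using Cons.IH[OF v] by blast
  obtain s' where s': "word_eq (Pos i s # t) (t @ [Pos i s'])" using move_Pos[OF t l(2)] by blast
  have "word_eq (l # v @ t) (l # t @ v')"
    using word_eq_context[OF v'(2), of "[l]" "[]"] l by simp
  also have "word_eq (l # t @ v') (t @ Pos i s' # v')"
    using word_eq_context[OF s', of "[]" v'] admissible_words(1)[OF v'(1)] l by simp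
  finally show ?case using v' l by (intro exI[of _ "Pos i s' # v'"]) simp
qed

text \<open>x_i(s) passes a letter y_j unchanged if i and j differ. Passing y_i(t) changes s to s /
  q and leaves behind a torus letter, which is then moved to the right; the admissible radius
  shrinks with each letter.\<close>

lemma normal_form_Pos_neg_word:
  assumes i: "i \<in> {1..n}" and "neg_word n u"
  shows "\<exists>\<delta>>0. \<forall>s. cmod s < \<delta> \<longrightarrow> (\<exists>u' t v. neg_word n u' \<and> tor_word n t \<and> pos_word n v \<and> word_eq (Pos i s # u) (u' @ t @ v))"
  using assms(2)
proof (induction u)
  case Nil
  have "\<exists>u' t v. neg_word n u' \<and> tor_word n t \<and> pos_word n v \<and> word_eq [Pos i s] (u' @ t @ v)" for s
    using i by (intro exI[of _ "[]"] exI[of _ "[Pos i s]"]) (simp add: word_eq_refl)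
  then show ?case by (auto intro: exI[of _ 1])
next
  case (Cons l u)
  then obtain j t where l: "l = Neg j t" "j \<in> {1..n}" and u: "neg_word n u" by auto
  obtain \<delta> where \<delta>: "\<delta> > 0" "\<And>s. cmod s < \<delta> \<Longrightarrow>
      \<exists>u' t v. neg_word n u' \<and> tor_word n t \<and> pos_word n v \<and> word_eq (Pos i s # u) (u' @ t @ v)"
    using Cons.IH[OF u] by blast
  show ?case
  proof (cases "i = j")
    case False
    have "\<exists>u' t v. neg_word n u' \<and> tor_word n t \<and> pos_word n v \<and> word_eq (Pos i s # l # u) (u' @ t @ v)"
      if s: "cmod s < \<delta>" for s
    proof -
      obtain u' t' v where w: "neg_word n u'" "tor_word n t'" "pos_word n v" "word_eq (Pos i s # u) (u' @ t' @ v)"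
        using \<delta>(2)[OF s] by blast
      have "word_eq (Pos i s # l # u) (l # Pos i s # u)"
        using word_eq_context[OF word_eq_Pos_Neg_distinct[OF i l(2) False], of "[]" u] admissible_words(2)[OF u] l by simp
      also have "word_eq (l # Pos i s # u) (l # u' @ t' @ v)"
        using word_eq_context[OF w(4), of "[l]" "[]"] l by simp
      finally show ?thesis
        using w l by (intro exI[of _ "l # u'"] exI[of _ t'] exI[of _ v]) simp
    qed
    then show ?thesis using \<delta>(1) by blast
  next
    case True
    \<comment> \<open>The second bound gives |s t| < 1/2, hence |q| > 1/2, and then the first one
      gives |s / q| < \<delta>. The summand 1 guards against t = 0.\<close>
    define \<epsilon> where "\<epsilon> = min (\<delta> / 2) (1 / (2 * (cmod t + 1)))"
    have "\<epsilon> > 0" using \<delta>(1) by (simp add: \<epsilon>_def add_nonneg_pos)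
    moreover have "\<exists>u' t v. neg_word n u' \<and> tor_word n t \<and> pos_word n v \<and> word_eq (Pos i s # l # u) (u' @ t @ v)"
      if s: "cmod s < \<epsilon>" for s
    proof -
      define q where "q = 1 + s * t"
      have "cmod (s * t) \<le> cmod s * (cmod t + 1)"
        by (simp add: norm_mult mult_left_mono)
      also have "\<dots> < 1 / (2 * (cmod t + 1)) * (cmod t + 1)"
        using s by (intro mult_strict_right_mono) (auto simp: \<epsilon>_def add_nonneg_pos)
      also have "\<dots> = 1 / 2"
        using add_nonneg_pos[of "cmod t" 1] by (simp add: field_simps)
      finally have st: "cmod (s * t) < 1 / 2" .
      have "- Re (s * t) \<le> cmod (s * t)" using complex_Re_le_cmod[of "- (s * t)"] by simp
      then have q: "Re q > 1 / 2" using st by (simp add: q_def)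
      then have "cmod q > 1 / 2" using complex_Re_le_cmod[of q] by linarith
      then have "cmod (s / q) \<le> cmod s / (1 / 2)"
        unfolding norm_divide by (intro divide_left_mono) auto
      also have "\<dots> < \<delta>" using s by (simp add: \<epsilon>_def)
      finally obtain u' t' v where w: "neg_word n u'" "tor_word n t'" "pos_word n v" "word_eq (Pos i (s / q) # u) (u' @ t' @ v)"
        using \<delta>(2) by blast
      have nz: "q \<noteq> 0" using q by auto
      obtain u'' where u'': "neg_word n u''" "word_eq (Tor i q # u') (u'' @ [Tor i q])"
        using move_Tor[OF i nz w(1)] by blast
      have "word_eq (Pos i s # l # u) (Neg i (t / q) # Tor i q # Pos i (s / q) # u)"
        using word_eq_context[OF word_eq_Pos_Neg_same[OF i, of s t], of "[]" u] admissible_words(2)[OF u] l q True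
        by (simp add: q_def)
      also have "word_eq \<dots> (Neg i (t / q) # Tor i q # u' @ t' @ v)"
        using word_eq_context[OF w(4), of "[Neg i (t / q), Tor i q]" "[]"] i nz by simp
      also have "word_eq \<dots> (Neg i (t / q) # u'' @ Tor i q # t' @ v)"
        using word_eq_context[OF u''(2), of "[Neg i (t / q)]" "t' @ v"] i nz admissible_words(3)[OF w(2)] admissible_words(1)[OF w(3)]
        by (simp add: ball_Un)
      finally show ?thesis
        using w u'' i nz by (intro exI[of _ "Neg i (t / q) # u''"] exI[of _ "Tor i q # t'"] exI[of _ v]) simp
    qed
    ultimately show ?thesis by blast
  qed
qed

text \<open>Words whose parameters in the \<open>x\<^sub>i\<close> are small have a Gauss decomposition that is obtained from the
  relations above, and the two sides are holomorphic in each parameter.\<close>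

lemma lead_minor_transfer:
  assumes hol: "\<And>a i b. admissible_word n a \<Longrightarrow> i \<in> {1..n} \<Longrightarrow> admissible_word n b \<Longrightarrow>
      (\<lambda>s. D (word_mat (a @ Pos i s # b))) holomorphic_on UNIV"
    and D: "\<And>u t v. neg_word n u \<Longrightarrow> tor_word n t \<Longrightarrow> pos_word n v \<Longrightarrow>
      D (word_mat (u @ t @ v)) = lead_minor n k (u @ t @ v)"
    and w: "admissible_word n w"
  shows "D (word_mat w) = lead_minor n k w"
proof -
  have eq: "D (word_mat v) = lead_minor n k v" if "word_eq v w" "D (word_mat w) = lead_minor n k w" for v w
    using that by (simp add: word_eq_def lead_minor_def)
  \<comment> \<open>Letters are taken from the right end of w and absorbed into a tail that is
    already decomposed. The tail is arbitrary because absorbing a letter changes it.\<close>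
  have "D (word_mat (w @ u @ t @ v)) = lead_minor n k (w @ u @ t @ v)"
    if "neg_word n u" "tor_word n t" "pos_word n v" for u t v
    using w that
  proof (induction w arbitrary: u t v rule: rev_induct)
    case Nil
    then show ?case using D by simp
  next
    case (snoc l w)
    then have adm: "admissible_word n w" "admissible n l" by auto
    note utv = snoc.prems(2-4)
    note adm' = admissible_words(2)[OF utv(1)] admissible_words(3)[OF utv(2)] admissible_words(1)[OF utv(3)]
    show ?case
    proof (cases l)
      case (Neg i c)
      then show ?thesis using snoc.IH[OF adm(1), of "l # u" t v] adm utv by simp
    next
      case (Tor i c)
      then obtain u' where u': "neg_word n u'" "word_eq (l # u) (u' @ [l])"
        using move_Tor[of i c u] adm(2) utv(1) by auto
      have "word_eq (w @ (l # u) @ (t @ v)) (w @ (u' @ [l]) @ (t @ v))"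
        using word_eq_context[OF u'(2) adm(1)] adm' by (simp add: ball_Un)
      moreover have "D (word_mat (w @ u' @ (l # t) @ v)) = lead_minor n k (w @ u' @ (l # t) @ v)"
        using snoc.IH[OF adm(1) u'(1), of "l # t" v] utv adm(2) Tor by simp
      ultimately show ?thesis using eq[of "w @ (l # u) @ (t @ v)"] by simp
    next
      case (Pos i s)
      then have i: "i \<in> {1..n}" using adm(2) by simp
      obtain \<delta> where \<delta>: "\<delta> > 0" "\<And>s. cmod s < \<delta> \<Longrightarrow>
          \<exists>u' t v. neg_word n u' \<and> tor_word n t \<and> pos_word n v \<and> word_eq (Pos i s # u) (u' @ t @ v)"
        using normal_form_Pos_neg_word[OF i utv(1)] by blast
      have small: "D (word_mat (w @ Pos i s # u @ t @ v)) = lead_minor n k (w @ Pos i s # u @ t @ v)"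
        if s: "s \<in> ball 0 \<delta>" for s
      proof -
        obtain u' t' v' where w': "neg_word n u'" "tor_word n t'" "pos_word n v'" "word_eq (Pos i s # u) (u' @ t' @ v')"
          using \<delta>(2)[of s] s by auto
        obtain v'' where v'': "pos_word n v''" "word_eq (v' @ t) (t @ v'')"
          using move_pos_word[OF utv(2) w'(3)] by blast
        have "word_eq (w @ (Pos i s # u) @ (t @ v)) (w @ (u' @ t' @ v') @ (t @ v))"
          using word_eq_context[OF w'(4) adm(1)] adm' by (simp add: ball_Un)
        also have "word_eq \<dots> (w @ u' @ t' @ t @ v'' @ v)"
          using word_eq_context[OF v''(2), of "w @ u' @ t'" v] adm(1) adm' admissible_words(2)[OF w'(1)] admissible_words(3)[OF w'(2)]
          by (simp add: ball_Un)
        finally have "word_eq (w @ Pos i s # u @ t @ v) (w @ u' @ t' @ t @ v'' @ v)" by simp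
        moreover have "D (word_mat (w @ u' @ (t' @ t) @ (v'' @ v))) = lead_minor n k (w @ u' @ (t' @ t) @ (v'' @ v))"
          using w' v'' utv by (intro snoc.IH[OF adm(1)]) auto
        ultimately show ?thesis using eq by simp
      qed
      \<comment> \<open>Both sides are entire in the parameter of this letter and agree on a disc
        around 0, hence also at its actual value.\<close>
      have "D (word_mat (w @ Pos i s # (u @ t @ v))) = lead_minor n k (w @ Pos i s # (u @ t @ v))"
      proof (rule analytic_continuation_open[of "ball 0 \<delta>" UNIV "\<lambda>s. D (word_mat (w @ Pos i s # (u @ t @ v)))"
            "\<lambda>s. lead_minor n k (w @ Pos i s # (u @ t @ v))"])
        show "(\<lambda>s. D (word_mat (w @ Pos i s # (u @ t @ v)))) holomorphic_on UNIV"
          using adm' by (intro hol adm(1) i) auto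
        show "(\<lambda>s. lead_minor n k (w @ Pos i s # (u @ t @ v))) holomorphic_on UNIV"
          by (rule holomorphic_lead_minor)
      qed (use \<delta>(1) small in auto)
      then show ?thesis using Pos by simp
    qed
  qed
  from this[of "[]" "[]" "[]"] show ?thesis by simp
qed

end

section \<open>Regular functions on the group\<close>

lemma carrier_GL: "g \<in> carrier (GL N) \<Longrightarrow> g \<in> carrier_mat N N \<and> Determinant.det g \<noteq> 0"
  using unit_imp_det_non_zero[of g N "()"] by (auto simp: GL_def units_of_def Units_def ring_mat_def)

lemma group_GL: "group (GL N)"
  unfolding GL_def by (intro monoid.units_group ring.is_monoid ring_mat)

lemma GL_simps [simp]: "x \<otimes>\<^bsub>GL N\<^esub> y = x * y" "\<one>\<^bsub>GL N\<^esub> = 1\<^sub>m N"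
  by (simp_all add: GL_def units_of_def ring_mat_def)

lemma holomorphic_det:
  assumes "\<And>s. R s \<in> carrier_mat N N" "\<And>i j. i < N \<Longrightarrow> j < N \<Longrightarrow> (\<lambda>s. R s $$ (i, j)) holomorphic_on A"
  shows "(\<lambda>s. Determinant.det (R s)) holomorphic_on A"
proof -
  have "(\<lambda>s. Determinant.det (R s)) = (\<lambda>s. \<Sum>p\<in>{p. p permutes {0..<N}}. signof p * (\<Prod>i = 0..<N. R s $$ (i, p i)))"
    using det_def'[OF assms(1)] by (intro ext) simp
  then show ?thesis
    using assms(2) by (auto intro!: holomorphic_intros simp: permutes_in_image[of _ "{0..<N}", simplified])
qed

lemma holomorphic_GL_regular:
  assumes "p \<in> GL_regular N" "\<And>s. R s \<in> carrier_mat N N" "\<And>s. Determinant.det (R s) \<noteq> 0"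
    "\<And>i j. i < N \<Longrightarrow> j < N \<Longrightarrow> (\<lambda>s. R s $$ (i, j)) holomorphic_on A"
  shows "(\<lambda>s. p (R s)) holomorphic_on A"
  using assms(1)
  by induction (auto intro!: holomorphic_intros holomorphic_det[OF assms(2,4)] assms(3,4))

text \<open>A regular function may contain 1 / det. The determinant has no zero for any value of s,
  so the function is entire.\<close>

lemma GL_regular_word_holomorphic:
  assumes "chevalley_matrices n N e f h" and p: "p \<in> GL_regular N"
    and det: "\<And>w. admissible_word n w \<Longrightarrow> Determinant.det (chevalley_matrices.word_mat N e f h w) \<noteq> 0"
    and a: "admissible_word n a" and i: "i \<in> {1..n}" and b: "admissible_word n b"
  shows "(\<lambda>s. p (chevalley_matrices.word_mat N e f h (a @ Pos i s # b))) holomorphic_on UNIV"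
proof -
  interpret chevalley_matrices n N e f h by fact
  let ?A = "word_mat a" and ?B = "word_mat b"
  have c: "?A \<in> carrier_mat N N" "?B \<in> carrier_mat N N" using word_mat_carrier a b by auto
  have w: "word_mat (a @ Pos i s # b) = ?A * (mat_exp (s \<cdot>\<^sub>m e i) * ?B)" for s
    using word_mat_append[OF a, of "Pos i s # b"] b i by (simp add: root_elt_def)
  have adm: "admissible_word n (a @ Pos i s # b)" for s using a b i by (auto simp: ball_Un)
  show ?thesis
  proof (rule holomorphic_GL_regular[OF p])
    show "word_mat (a @ Pos i s # b) \<in> carrier_mat N N" for s by (rule word_mat_carrier[OF adm])
    show "Determinant.det (word_mat (a @ Pos i s # b)) \<noteq> 0" for s by (rule det[OF adm])
    fix k l assume kl: "k < N" "l < N"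
    have "\<exists>D. ((\<lambda>s. word_mat (a @ Pos i s # b) $$ (k, l)) has_field_derivative D) (at z)" for z
    proof -
      have "has_mat_derivative N (\<lambda>s. ?A * (mat_exp (s \<cdot>\<^sub>m e i) * ?B))
          (?A * (e i * mat_exp (z \<cdot>\<^sub>m e i) * ?B + mat_exp (z \<cdot>\<^sub>m e i) * 0\<^sub>m N N)) z"
        by (intro has_mat_derivative_const_mult c has_mat_derivative_mult has_mat_derivative_mat_exp
            e_carrier i has_mat_derivative_const)
      then show ?thesis unfolding w using kl unfolding has_mat_derivative_def by blast
    qed
    then show "(\<lambda>s. word_mat (a @ Pos i s # b) $$ (k, l)) holomorphic_on UNIV"
      by (auto simp: holomorphic_on_def field_differentiable_def)
  qed
qed

lemma root_elt_inverse:
  "e i \<in> carrier_mat N N \<Longrightarrow> root_elt e i t * root_elt e i (- t) = 1\<^sub>m N"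
  using mat_exp_minus_mult[of "e i" N "- t"] by (simp add: root_elt_def)

context chevalley_matrices
begin

lemma admissible_inv_word: "set is \<subseteq> {1..n} \<Longrightarrow> admissible_word n (inv_word is)"
  by (auto simp: inv_word_def)

lemma word_mat_inv_word:
  assumes "set is \<subseteq> {1..n}"
  shows "mat_prod N (map (s_bar e f) is) \<in> carrier_mat N N"
    "word_mat (inv_word is) * mat_prod N (map (s_bar e f) is) = 1\<^sub>m N"
proof -
  have s: "s_bar e f i \<in> carrier_mat N N" if "i \<in> {1..n}" for i
    using letter_mat_carrier[of "Pos i (- 1)"] letter_mat_carrier[of "Neg i 1"] that
    unfolding s_bar_def by (auto intro!: mult_carrier_mat)
  have inv: "word_mat [Pos i 1, Neg i (- 1), Pos i 1] * (s_bar e f i * M) = M"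
    if i: "i \<in> {1..n}" and M: "M \<in> carrier_mat N N" for i M
  proof -
    have c: "root_elt e i t \<in> carrier_mat N N" "root_elt f i t \<in> carrier_mat N N" for t
      using letter_mat_carrier[of "Pos i t"] letter_mat_carrier[of "Neg i t"] i by auto
    have x: "root_elt e i 1 * (root_elt e i (- 1) * Z) = Z" if "Z \<in> carrier_mat N N" for Z
    proof -
      have "root_elt e i 1 * (root_elt e i (- 1) * Z) = root_elt e i 1 * root_elt e i (- 1) * Z"
        using assoc_mult_mat[OF c(1) c(1) that] by simp
      then show ?thesis using root_elt_inverse[of e i N 1] e_carrier[OF i] that by simp
    qed
    have y: "root_elt f i (- 1) * (root_elt f i 1 * Z) = Z" if "Z \<in> carrier_mat N N" for Z
    proof -
      have "root_elt f i (- 1) * (root_elt f i 1 * Z) = root_elt f i (- 1) * root_elt f i 1 * Z"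
        using assoc_mult_mat[OF c(2) c(2) that] by simp
      then show ?thesis using root_elt_inverse[of f i N "- 1"] f_carrier[OF i] that by simp
    qed
    show ?thesis
      using c M by (simp add: s_bar_def mat_ring_simps[where N = N] right_mult_one_mat[of _ N N] x y)
  qed
  have "mat_prod N (map (s_bar e f) is) \<in> carrier_mat N N \<and>
      word_mat (inv_word is) * mat_prod N (map (s_bar e f) is) = 1\<^sub>m N"
    using assms
  proof (induction "is")
    case Nil
    show ?case by (simp add: inv_word_def)
  next
    case (Cons i "is")
    let ?M = "mat_prod N (map (s_bar e f) is)" and ?s = "word_mat [Pos i 1, Neg i (- 1), Pos i 1]"
    have i: "i \<in> {1..n}" and IH: "?M \<in> carrier_mat N N" "word_mat (inv_word is) * ?M = 1\<^sub>m N"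
      using Cons by auto
    have adm: "admissible_word n (inv_word is)" "admissible_word n [Pos i 1, Neg i (- 1), Pos i 1]"
      using admissible_inv_word Cons.prems i by auto
    have "word_mat (inv_word (i # is)) = word_mat (inv_word is) * ?s"
      using word_mat_append[OF adm] by (simp add: inv_word_def)
    then have "word_mat (inv_word (i # is)) * (s_bar e f i * ?M) = word_mat (inv_word is) * (?s * (s_bar e f i * ?M))"
      using word_mat_carrier[OF adm(1)] word_mat_carrier[OF adm(2)] s[OF i] IH(1)
      by (simp only:) (intro assoc_mult_mat[of _ N N _ N _ N] mult_carrier_mat[of _ N N])
    then show ?case using inv[OF i IH(1)] IH s[OF i] by simp
  qed
  then show "mat_prod N (map (s_bar e f) is) \<in> carrier_mat N N"
    "word_mat (inv_word is) * mat_prod N (map (s_bar e f) is) = 1\<^sub>m N" by auto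
qed

lemma word_mat_concat:
  "(\<And>w. w \<in> set ws \<Longrightarrow> admissible_word n w) \<Longrightarrow> word_mat (concat ws) = mat_prod N (map word_mat ws)"
proof (induction ws)
  case (Cons w ws)
  have "admissible_word n w" using Cons.prems[of w] by simp
  moreover have "admissible_word n (concat ws)" using Cons.prems by auto
  ultimately have "word_mat (w @ concat ws) = word_mat w * word_mat (concat ws)" by (rule word_mat_append)
  moreover have "word_mat (concat ws) = mat_prod N (map word_mat ws)"
    by (rule Cons.IH) (rule Cons.prems, simp)
  ultimately show ?case by simp
qed simp

lemma admissible_theta_word:
  assumes "\<And>m i. m \<in> {1..n} \<Longrightarrow> i \<in> {1..n} \<Longrightarrow> c m i \<noteq> 0"
  shows "admissible_word n (theta_word n c)"
  using assms by (auto simp: theta_word_def)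

lemma Theta_minus_eq_word_mat:
  assumes c: "\<And>m i. m \<in> {1..n} \<Longrightarrow> i \<in> {1..n} \<Longrightarrow> c m i \<noteq> 0"
  shows "Theta_minus n N f h c = word_mat (theta_word n c)"
proof -
  let ?ws = "[[Neg i (c m i), Tor i (inverse (c m i))]. m \<leftarrow> [1..<n + 1], i \<leftarrow> [1..<n + 1]]"
  have y: "word_mat [Neg i (c m i), Tor i (inverse (c m i))] = y_bold f h i (c m i)"
    if "m \<in> {1..n}" "i \<in> {1..n}" for m i
    using letter_mat_carrier[of "Tor i (inverse (c m i))"] that c
    by (simp add: y_bold_def right_mult_one_mat[of _ N N])
  have "map word_mat ?ws = [y_bold f h i (c m i). m \<leftarrow> [1..<n + 1], i \<leftarrow> [1..<n + 1]]"
    unfolding map_concat map_map comp_def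
    by (intro arg_cong[of _ _ concat] map_cong refl) (auto intro!: y simp del: word_mat_simps)
  then show ?thesis
    unfolding Theta_minus_def theta_word_def using c by (subst word_mat_concat) auto
qed

end

section \<open>The generalized minor in terms of the vector representation\<close>

lemma chevalley_matrices_of_generators:
  assumes "chevalley_generators_B n N G e f h"
  shows "chevalley_matrices n N e f h"
proof -
  have "X \<in> carrier_mat N N" if "X \<in> e ` {1..n} \<union> f ` {1..n} \<union> h ` {1..n}" for X
  proof -
    have "X \<in> lie_generated N (e ` {1..n} \<union> f ` {1..n} \<union> h ` {1..n})"
      using that by (rule lie_generated.incl)
    then have "X \<in> lie_algebra N G" using assms by (simp add: chevalley_generators_B_def)
    then show ?thesis by (simp add: lie_algebra_def)
  qed
  then show ?thesis
    using assms unfolding chevalley_generators_B_def by unfold_locales auto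
qed

text \<open>\<open>lie_algebra\<close> asks all exp(t X) to lie in G, so letters do, and words are
  products of letters.\<close>

lemma generators_in_group:
  assumes ch: "chevalley_generators_B n N G e f h" and G: "subgroup G (GL N)"
    and w: "admissible_word n w"
  shows "chevalley_matrices.word_mat N e f h w \<in> G"
proof -
  interpret chevalley_matrices n N e f h by (rule chevalley_matrices_of_generators[OF ch])
  have exp: "mat_exp (t \<cdot>\<^sub>m X) \<in> G" if "X \<in> e ` {1..n} \<union> f ` {1..n} \<union> h ` {1..n}" for X t
  proof -
    have "X \<in> lie_generated N (e ` {1..n} \<union> f ` {1..n} \<union> h ` {1..n})"
      using that by (rule lie_generated.incl)
    then have "X \<in> lie_algebra N G" using ch by (simp add: chevalley_generators_B_def)
    then show ?thesis by (simp add: lie_algebra_def)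
  qed
  have letter: "letter_mat l \<in> G" if "admissible n l" for l
    using that by (cases l) (auto simp: root_elt_def coroot_def intro!: exp)
  show ?thesis using w
  proof (induction w)
    case Nil
    show ?case using subgroup.one_closed[OF G] by simp
  next
    case (Cons l w)
    then show ?case using subgroup.m_closed[OF G, of "letter_mat l" "word_mat w"] letter[of l] by simp
  qed
qed

lemma word_mat_unipotent:
  assumes "chevalley_matrices n N e f h"
  shows "neg_word n u \<Longrightarrow> chevalley_matrices.word_mat N e f h u \<in> unipotent_subgroup n N f"
    "pos_word n v \<Longrightarrow> chevalley_matrices.word_mat N e f h v \<in> unipotent_subgroup n N e"
    "tor_word n t \<Longrightarrow> chevalley_matrices.word_mat N e f h t \<in> max_torus n N h"
proof -
  interpret chevalley_matrices n N e f h by fact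
  show "word_mat u \<in> unipotent_subgroup n N f" if "neg_word n u"
    using that unfolding unipotent_subgroup_def
  proof (induction u)
    case Nil
    show ?case using generate.one[of "GL N"] by simp
  next
    case (Cons l u)
    then obtain i t where l: "l = Neg i t" "i \<in> {1..n}" by auto
    have "root_elt f i t \<in> generate (GL N) {root_elt f i t |i t. i \<in> {1..n}}"
      using l by (intro generate.incl) blast
    then show ?case using generate.eng[of _ "GL N" _ "word_mat u"] Cons l by simp
  qed
  show "word_mat v \<in> unipotent_subgroup n N e" if "pos_word n v"
    using that unfolding unipotent_subgroup_def
  proof (induction v)
    case Nil
    show ?case using generate.one[of "GL N"] by simp
  next
    case (Cons l v)
    then obtain i t where l: "l = Pos i t" "i \<in> {1..n}" by auto
    have "root_elt e i t \<in> generate (GL N) {root_elt e i t |i t. i \<in> {1..n}}"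
      using l by (intro generate.incl) blast
    then show ?case using generate.eng[of _ "GL N" _ "word_mat v"] Cons l by simp
  qed
  show "word_mat t \<in> max_torus n N h" if "tor_word n t"
    using that unfolding max_torus_def
  proof (induction t)
    case Nil
    show ?case using generate.one[of "GL N"] by simp
  next
    case (Cons l w)
    then obtain i t where l: "l = Tor i t" "i \<in> {1..n}" "t \<noteq> 0" by auto
    have "coroot h i t \<in> generate (GL N) {coroot h i t |i t. i \<in> {1..n} \<and> t \<noteq> 0}"
      using l by (intro generate.incl) blast
    then show ?case using generate.eng[of _ "GL N" _ "word_mat w"] Cons l by simp
  qed
qed

lemma fundamental_weight_word:
  assumes "chevalley_matrices n N e f h" and \<psi>: "fundamental_weight n N h k \<psi>" and t: "tor_word n t"
  shows "\<psi> (chevalley_matrices.word_mat N e f h t) = tor_value k t"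
proof -
  interpret chevalley_matrices n N e f h by fact
  have nz: "\<psi> s \<noteq> 0" and mult: "\<psi> (s * u) = \<psi> s * \<psi> u"
    if "s \<in> max_torus n N h" "u \<in> max_torus n N h" for s u
    using \<psi> that by (auto simp: fundamental_weight_def torus_character_def)
  show ?thesis using t
  proof (induction t)
    case Nil
    have one: "1\<^sub>m N \<in> max_torus n N h" using word_mat_unipotent(3)[OF assms(1), of "[]"] by simp
    have "\<psi> (1\<^sub>m N) = \<psi> (1\<^sub>m N) * \<psi> (1\<^sub>m N)" using mult[OF one one] by simp
    then show ?case using nz[OF one one] by (simp add: tor_value_def)
  next
    case (Cons l w)
    then obtain i c where l: "l = Tor i c" "i \<in> {1..n}" "c \<noteq> 0" by auto
    have "coroot h i c \<in> max_torus n N h"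
      unfolding max_torus_def using l by (intro generate.incl) blast
    then have "\<psi> (coroot h i c * word_mat w) = \<psi> (coroot h i c) * \<psi> (word_mat w)"
      using word_mat_unipotent(3)[OF assms(1)] Cons.prems by (intro mult) auto
    also have "\<psi> (coroot h i c) = (if i = k then c else 1)"
      using \<psi> l by (simp add: fundamental_weight_def)
    finally show ?case using Cons l by (simp add: tor_value_def)
  qed
qed

text \<open>On a decomposed word D is \<Lambda>_k of the torus part by its definition, and so is the
  leading minor. Regularity of D supplies the holomorphy that extends this to all words.\<close>

lemma principal_minor_word:
  assumes ch: "chevalley_generators_B n N G e f h" and G: "subgroup G (GL N)" and k: "k < n"
    and \<psi>: "fundamental_weight n N h k \<psi>" and D: "principal_minor n N G e f h \<psi> D"
    and w: "admissible_word n w"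
  shows "D (chevalley_matrices.word_mat N e f h w) = lead_minor n k w"
proof -
  have cm: "chevalley_matrices n N e f h" by (rule chevalley_matrices_of_generators[OF ch])
  interpret chevalley_matrices n N e f h by (rule cm)
  note inG = generators_in_group[OF ch G]
  have det: "Determinant.det (word_mat w) \<noteq> 0" if "admissible_word n w" for w
    using inG[OF that] subgroup.subset[OF G] carrier_GL by blast
  obtain p where p: "p \<in> GL_regular N" "\<And>g. g \<in> G \<Longrightarrow> D g = p g"
    using D by (auto simp: principal_minor_def regular_fun_on_def)
  show ?thesis
  proof (rule lead_minor_transfer[OF _ _ w])
    fix a i b assume a: "admissible_word n a" "i \<in> {1..n}" "admissible_word n b"
    have "D (word_mat (a @ Pos i s # b)) = p (word_mat (a @ Pos i s # b))" for s
      using a by (intro p(2) inG) (auto simp: ball_Un)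
    then show "(\<lambda>s. D (word_mat (a @ Pos i s # b))) holomorphic_on UNIV"
      using GL_regular_word_holomorphic[OF cm p(1) det a] by simp
  next
    fix u t v assume utv: "neg_word n u" "tor_word n t" "pos_word n v"
    have "D (word_mat (u @ t @ v)) = D (word_mat u * word_mat t * word_mat v)"
    proof -
      note adm = admissible_words(2)[OF utv(1)] admissible_words(3)[OF utv(2)] admissible_words(1)[OF utv(3)]
      have "word_mat (u @ t @ v) = word_mat u * (word_mat t * word_mat v)"
        using adm by (simp add: word_mat_append ball_Un)
      also have "\<dots> = word_mat u * word_mat t * word_mat v"
        using word_mat_carrier[OF adm(1)] word_mat_carrier[OF adm(2)] word_mat_carrier[OF adm(3)]
        by (intro assoc_mult_mat[symmetric])
      finally show ?thesis by simp
    qed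
    also have "\<dots> = \<psi> (word_mat t)"
      using D word_mat_unipotent[OF cm] utv by (simp add: principal_minor_def)
    also have "\<dots> = lead_minor n k (u @ t @ v)"
      using fundamental_weight_word[OF cm \<psi> utv(2)] lead_minor_normal_form[OF k utv] by simp
    finally show "D (word_mat (u @ t @ v)) = lead_minor n k (u @ t @ v)" .
  qed
qed

lemma gen_minor_eq_row_minor:
  assumes ch: "chevalley_generators_B n N G e f h" and G: "subgroup G (GL N)" and k: "1 \<le> k" "k < n"
    and \<psi>: "fundamental_weight n N h k \<psi>" and D: "principal_minor n N G e f h \<psi> (\<Delta> k)"
    and w: "admissible_word n w"
  shows "gen_minor n N e f \<Delta> (longest_elt n \<circ> simple_reflection n k) id k (chevalley_matrices.word_mat N e f h w)
    = row_minor k (\<lambda>a. if a = 0 then 2 * n + 1 - k else 2 * n + 2 - k + a) (\<lambda>b. vec_word n w (unit_fun (Suc b)))"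
proof -
  have cm: "chevalley_matrices n N e f h" by (rule chevalley_matrices_of_generators[OF ch])
  interpret chevalley_matrices n N e f h by (rule cm)
  define v where "v = longest_elt n \<circ> simple_reflection n k"
  obtain js where js: "js \<in> lists {1..n}" "longest_elt n = word_elt n js"
    using longest_elt(1) by (rule weyl_groupE)
  have "v = word_elt n (js @ [k])" by (simp add: v_def js(2) word_elt_append)
  then have vW: "v \<in> weyl_group n" using js(1) k by (auto intro!: word_elt_mem_weyl_group)
  define "is" where "is = (SOME is. reduced_word n v is)"
  have red: "reduced_word n v is" unfolding is_def by (rule reduced_word_exists[OF vW])
  then have sub: "set is \<subseteq> {1..n}" by (auto simp: reduced_word_def)
  let ?W = "mat_prod N (map (s_bar e f) is)"
  note W = word_mat_inv_word[OF sub]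
  have adm: "admissible_word n (inv_word is)" by (rule admissible_inv_word[OF sub])
  interpret GL: group "GL N" by (rule group_GL)
  have inv_carrier: "word_mat (inv_word is) \<in> carrier (GL N)"
    using generators_in_group[OF ch G adm] subgroup.subset[OF G] by blast
  \<comment> \<open>The word \<open>inv_word is\<close> was only shown to be a left inverse of ?W;
    inverses in the group \<open>GL N\<close> are unique.\<close>
  have "?W = inv\<^bsub>GL N\<^esub> (word_mat (inv_word is))"
  proof -
    let ?I = "inv\<^bsub>GL N\<^esub> (word_mat (inv_word is))"
    have I: "?I \<in> carrier_mat N N" "?I * word_mat (inv_word is) = 1\<^sub>m N"
      using GL.inv_closed[OF inv_carrier] carrier_GL GL.l_inv[OF inv_carrier] by auto
    have "?I * (word_mat (inv_word is) * ?W) = ?I * word_mat (inv_word is) * ?W"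
      using I(1) W(1) word_mat_carrier[OF adm] by (intro assoc_mult_mat[symmetric])
    then show ?thesis using I W by simp
  qed
  then have inv: "inv\<^bsub>GL N\<^esub> ?W = word_mat (inv_word is)"
    using GL.inv_inv[OF inv_carrier] by simp
  have "gen_minor n N e f \<Delta> v id k (word_mat w) = \<Delta> k (word_mat (inv_word is) * word_mat w)"
    using inv word_mat_carrier[OF adm] word_mat_carrier[OF w]
    by (simp add: gen_minor_def w_bar_def reduced_word_id is_def[symmetric] right_mult_one_mat[of _ N N] mat_mult_closed)
  also have "\<dots> = \<Delta> k (word_mat (inv_word is @ w))"
    by (simp add: word_mat_append[OF adm w])
  also have "\<dots> = lead_minor n k (inv_word is @ w)"
    using adm w by (intro principal_minor_word[OF ch G k(2) \<psi> D]) auto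
  also have "\<dots> = row_minor k Suc (\<lambda>b. vec_word n (inv_word is) (vec_word n w (unit_fun (Suc b))))"
    by (simp add: lead_minor_def)
  also have "\<dots> = row_minor k (\<lambda>a. if a = 0 then 2 * n + 1 - k else 2 * n + 2 - k + a) (\<lambda>b. vec_word n w (unit_fun (Suc b)))"
    by (rule row_minor_longest_elt_simple_reflection[OF k red[unfolded v_def]])
  finally show ?thesis unfolding v_def .
qed

theorem theorem8p2:
  fixes n N k :: nat
    and G :: "complex mat set"
    and e f h :: "nat \<Rightarrow> complex mat"
    and \<Lambda> \<Delta> :: "nat \<Rightarrow> complex mat \<Rightarrow> complex"
    and c :: "nat \<Rightarrow> nat \<Rightarrow> complex"
  assumes "n \<ge> 2"
    and "simple_algebraic_group N G"
    and "chevalley_generators_B n N G e f h"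
    and "simply_connected_B n N h"
    and "\<And>i. i \<in> {1..n} \<Longrightarrow> fundamental_weight n N h i (\<Lambda> i)"
    and "\<And>i. i \<in> {1..n} \<Longrightarrow> principal_minor n N G e f h (\<Lambda> i) (\<Delta> i)"
    and "\<And>m i. m \<in> {1..n} \<Longrightarrow> i \<in> {1..n} \<Longrightarrow> c m i \<noteq> 0"
    and "k \<in> {1..n - 1}"
  shows "gen_minor n N e f \<Delta> (longest_elt n \<circ> simple_reflection n k) id k (Theta_minus n N f h c)
           = 1 / c k 1 + (\<Sum>j = 1..k - 1. c j (k - j) / c j (k - j + 1))"
proof -
  have G: "subgroup G (GL N)"
    using assms(2) by (simp add: simple_algebraic_group_def linear_algebraic_group_def)
  have k: "1 \<le> k" "k < n" "k \<in> {1..n}" using assms(1,8) by auto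
  interpret chevalley_matrices n N e f h by (rule chevalley_matrices_of_generators[OF assms(3)])
  have \<Theta>: "Theta_minus n N f h c = word_mat (theta_word n c)"
    by (rule Theta_minus_eq_word_mat) (rule assms(7))
  have "gen_minor n N e f \<Delta> (longest_elt n \<circ> simple_reflection n k) id k (Theta_minus n N f h c)
      = row_minor k (\<lambda>a. if a = 0 then 2 * n + 1 - k else 2 * n + 2 - k + a)
          (\<lambda>b. vec_word n (theta_word n c) (unit_fun (Suc b)))"
    unfolding \<Theta>
    by (intro gen_minor_eq_row_minor[where \<Delta> = \<Delta>, OF assms(3) G k(1,2) assms(5)[OF k(3)] assms(6)[OF k(3)]]
        admissible_theta_word assms(7))
  also have "\<dots> = 1 / c k 1 + (\<Sum>j = 1..k - 1. c j (k - j) / c j (k - j + 1))"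
    unfolding vec_word_theta by (rule row_minor_theta[OF _ k(1,2)]) (rule assms(7))
  finally show ?thesis .
qed

end
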